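(* Let $T=\int_Z^\oplus T(\zeta)\,d\omega(\zeta)$ be a densely defined, decomposable, (possibly unbounded) closed operator on the direct integral Hilbert space $\mathcal{H}=\int_Z^\oplus\mathcal{H}(\zeta)\,d\omega(\zeta)$, and let $T=V|T|$ be the polar decomposition of $T$. Then the polar part $V$ is decomposable and we have $$V=\int_Z^\oplus V(\zeta)\,d\omega(\zeta),$$ where $V(\zeta)$ is the polar part in the polar decomposition $T(\zeta)=V(\zeta)|T(\zeta)|$ of $T(\zeta)$.
   Context: Direct integrals. $Z$ is a standard Borel space (a Polish space with its Borel $\sigma$-algebra) and $\omega$ is a $\sigma$-finite positive measure on it. A measurable field of Hilbert spaces is a map $\zeta\mapsto\mathcal{H}(\zeta)$, each $\mathcal{H}(\zeta)$ a Hilbert space, with a set $S$ of vector fields $\zeta\mapsto x(\zeta)\in\mathcal{H}(\zeta)$ (called measurable) such that (i) $\zeta\mapsto\langle x(\zeta),y(\zeta)\rangle$ is measurable for all $x,y\in S$; (ii) if $v$ is a vector field with $\zeta\mapsto\langle x(\zeta),v(\zeta)\rangle$ measurable for every $x\in S$, then $v\in S$; (iii) there is a sequence $(x_n)$ in $S$ such that $\{x_n(\zeta)\}_n$ has dense linear span in $\mathcal{H}(\zeta)$ for every $\zeta$. The direct integral $\mathcal{H}=\int_Z^\oplus\mathcal{H}(\zeta)\,d\omega(\zeta)$ is the Hilbert space of all $x\in S$ (modulo a.e. equality) with $\int_Z\|x(\zeta)\|^2d\omega<\infty$ and inner product $\int_Z\langle x(\zeta),y(\zeta)\rangle\,d\omega(\zeta)$.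 Decomposable operators. A field of bounded operators $T(\zeta)\in B(\mathcal{H}(\zeta))$ is measurable if $\zeta\mapsto T(\zeta)x(\zeta)$ is in $S$ for all $x\in S$. If moreover $\zeta\mapsto\|T(\zeta)\|$ is essentially bounded, it defines a bounded decomposable operator $T=\int_Z^\oplus T(\zeta)\,d\omega(\zeta)$ by $(Tx)(\zeta)=T(\zeta)x(\zeta)$. A field of closed operators $T(\zeta)$ on $\mathcal{H}(\zeta)$ is measurable if the four entries of the projection in $M_2(B(\mathcal{H}(\zeta)))$ onto the graph of $T(\zeta)$ are measurable fields of bounded operators. The associated closed operator $T=\int_Z^\oplus T(\zeta)\,d\omega(\zeta)$ has domain the set of $x\in\mathcal{H}$ represented by square integrable fields with $x(\zeta)\in\mathrm{dom}(T(\zeta))$ for all $\zeta$ and $\zeta\mapsto T(\zeta)x(\zeta)$ square integrable, and $(Tx)(\zeta)=T(\zeta)x(\zeta)$. Closed operators of this form are called decomposable. Fields are identified when they agree almost everywhere. A decomposable closed $T$ is densely defined if and only if $T(\zeta)$ is densely defined for almost every $\zeta$. An equality $R=\int_Z^\oplus R(\zeta)\,d\omega(\zeta)$ asserts that the (a.e. defined) field $R(\zeta)$ is measurable and that $R$ is the associated decomposable operator. In the polar decomposition $T=V|T|$ of a closed densely defined operator, $|T|=(T^*T)^{1/2}$ and the polar part $V$ is the partial isometry whose initial space is the closure of the range of $|T|$. *)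

theory Defs
  imports "HOL-Analysis.Analysis"
begin

section \<open>Complex Hilbert spaces with explicit carriers\<close>

text \<open>The fibres of a field vary with the base point and the direct integral is a quotient of a
  function space, so Hilbert spaces are records over a carrier set rather than types.
  The inner product is linear in the first argument.\<close>

record 'a hilbert =
  hcarrier :: "'a set"
  hzero :: 'a
  hadd :: "'a \<Rightarrow> 'a \<Rightarrow> 'a"
  hscale :: "complex \<Rightarrow> 'a \<Rightarrow> 'a"
  hinner :: "'a \<Rightarrow> 'a \<Rightarrow> complex"

definition hminus :: "'a hilbert \<Rightarrow> 'a \<Rightarrow> 'a \<Rightarrow> 'a" where
  "hminus H x y = hadd H x (hscale H (- 1) y)"

definition hnorm :: "'a hilbert \<Rightarrow> 'a \<Rightarrow> real" where
  "hnorm H x = sqrt (Re (hinner H x x))"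

text \<open>The guard makes the distance symmetric and nonnegative on the whole type, as the locale
  \<^locale>\<open>Metric_space\<close> demands.\<close>

definition hdist :: "'a hilbert \<Rightarrow> 'a \<Rightarrow> 'a \<Rightarrow> real" where
  "hdist H x y = (if x \<in> hcarrier H \<and> y \<in> hcarrier H then hnorm H (hminus H x y) else 0)"

definition htopology :: "'a hilbert \<Rightarrow> 'a topology" where
  "htopology H = Metric_space.mtopology (hcarrier H) (hdist H)"

locale hilbert_space =
  fixes H :: "'a hilbert"
  assumes zero_closed: "hzero H \<in> hcarrier H"
    and add_closed: "\<lbrakk>x \<in> hcarrier H; y \<in> hcarrier H\<rbrakk> \<Longrightarrow> hadd H x y \<in> hcarrier H"
    and scale_closed: "x \<in> hcarrier H \<Longrightarrow> hscale H c x \<in> hcarrier H"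
    and add_assoc: "\<lbrakk>x \<in> hcarrier H; y \<in> hcarrier H; z \<in> hcarrier H\<rbrakk>
        \<Longrightarrow> hadd H (hadd H x y) z = hadd H x (hadd H y z)"
    and add_commute: "\<lbrakk>x \<in> hcarrier H; y \<in> hcarrier H\<rbrakk> \<Longrightarrow> hadd H x y = hadd H y x"
    and add_zero: "x \<in> hcarrier H \<Longrightarrow> hadd H x (hzero H) = x"
    and add_inverse: "x \<in> hcarrier H \<Longrightarrow> hminus H x x = hzero H"
    and scale_add_right: "\<lbrakk>x \<in> hcarrier H; y \<in> hcarrier H\<rbrakk>
        \<Longrightarrow> hscale H c (hadd H x y) = hadd H (hscale H c x) (hscale H c y)"
    and scale_add_left: "x \<in> hcarrier H
        \<Longrightarrow> hscale H (c + d) x = hadd H (hscale H c x) (hscale H d x)"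
    and scale_scale: "x \<in> hcarrier H \<Longrightarrow> hscale H c (hscale H d x) = hscale H (c * d) x"
    and scale_one: "x \<in> hcarrier H \<Longrightarrow> hscale H 1 x = x"
    and inner_commute: "\<lbrakk>x \<in> hcarrier H; y \<in> hcarrier H\<rbrakk> \<Longrightarrow> hinner H y x = cnj (hinner H x y)"
    and inner_add_left: "\<lbrakk>x \<in> hcarrier H; y \<in> hcarrier H; z \<in> hcarrier H\<rbrakk>
        \<Longrightarrow> hinner H (hadd H x y) z = hinner H x z + hinner H y z"
    and inner_scale_left: "\<lbrakk>x \<in> hcarrier H; y \<in> hcarrier H\<rbrakk>
        \<Longrightarrow> hinner H (hscale H c x) y = c * hinner H x y"
    and inner_nonneg: "x \<in> hcarrier H \<Longrightarrow> 0 \<le> Re (hinner H x x)"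
    and inner_definite: "\<lbrakk>x \<in> hcarrier H; hinner H x x = 0\<rbrakk> \<Longrightarrow> x = hzero H"
    and complete: "Metric_space.mcomplete (hcarrier H) (hdist H)"

definition hsubspace :: "'a hilbert \<Rightarrow> 'a set \<Rightarrow> bool" where
  "hsubspace H K \<longleftrightarrow> K \<subseteq> hcarrier H \<and> hzero H \<in> K \<and> (\<forall>x\<in>K. \<forall>y\<in>K. hadd H x y \<in> K)
     \<and> (\<forall>c. \<forall>x\<in>K. hscale H c x \<in> K)"

abbreviation hspan :: "'a hilbert \<Rightarrow> 'a set \<Rightarrow> 'a set" where
  "hspan H A \<equiv> hsubspace H hull A"

definition hdense :: "'a hilbert \<Rightarrow> 'a set \<Rightarrow> bool" where
  "hdense H A \<longleftrightarrow> htopology H closure_of A = hcarrier H"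

definition orth_compl :: "'a hilbert \<Rightarrow> 'a set \<Rightarrow> 'a set" where
  "orth_compl H A = {x \<in> hcarrier H. \<forall>a\<in>A. hinner H x a = 0}"

definition hsum :: "'a hilbert \<Rightarrow> 'b hilbert \<Rightarrow> ('a \<times> 'b) hilbert" where
  "hsum H K = \<lparr> hcarrier = hcarrier H \<times> hcarrier K,
     hzero = (hzero H, hzero K),
     hadd = (\<lambda>x y. (hadd H (fst x) (fst y), hadd K (snd x) (snd y))),
     hscale = (\<lambda>c x. (hscale H c (fst x), hscale K c (snd x))),
     hinner = (\<lambda>x y. hinner H (fst x) (fst y) + hinner K (snd x) (snd y)) \<rparr>"


section \<open>Operators\<close>

text \<open>A (partially defined) operator is its graph, so equality of operators includes equality of
  domains, and \<open>A O B\<close> is the product \<open>BA\<close> (first \<open>A\<close>, then \<open>B\<close>) on its natural domain.\<close>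

definition linear_op :: "'a hilbert \<Rightarrow> ('a \<times> 'a) set \<Rightarrow> bool" where
  "linear_op H T \<longleftrightarrow> hsubspace (hsum H H) T \<and> single_valued T"

definition op_app :: "('a \<times> 'a) set \<Rightarrow> 'a \<Rightarrow> 'a" where
  "op_app T x = (THE y. (x, y) \<in> T)"

definition closed_op :: "'a hilbert \<Rightarrow> ('a \<times> 'a) set \<Rightarrow> bool" where
  "closed_op H T \<longleftrightarrow> linear_op H T \<and> closedin (prod_topology (htopology H) (htopology H)) T"

definition densely_defined :: "'a hilbert \<Rightarrow> ('a \<times> 'a) set \<Rightarrow> bool" where
  "densely_defined H T \<longleftrightarrow> hdense H (Domain T)"

definition bounded_op :: "'a hilbert \<Rightarrow> ('a \<times> 'a) set \<Rightarrow> bool" where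
  "bounded_op H T \<longleftrightarrow> linear_op H T \<and> Domain T = hcarrier H
     \<and> (\<exists>C. \<forall>(x, y)\<in>T. hnorm H y \<le> C * hnorm H x)"

text \<open>For densely defined \<open>T\<close> this is the graph of the adjoint.\<close>

definition adjoint_op :: "'a hilbert \<Rightarrow> ('a \<times> 'a) set \<Rightarrow> ('a \<times> 'a) set" where
  "adjoint_op H T = {(y, z). y \<in> hcarrier H \<and> z \<in> hcarrier H
     \<and> (\<forall>(x, w)\<in>T. hinner H w y = hinner H x z)}"

definition self_adjoint :: "'a hilbert \<Rightarrow> ('a \<times> 'a) set \<Rightarrow> bool" where
  "self_adjoint H A \<longleftrightarrow> linear_op H A \<and> densely_defined H A \<and> adjoint_op H A = A"

definition positive_self_adjoint :: "'a hilbert \<Rightarrow> ('a \<times> 'a) set \<Rightarrow> bool" where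
  "positive_self_adjoint H A \<longleftrightarrow> self_adjoint H A \<and> (\<forall>(x, y)\<in>A. 0 \<le> Re (hinner H y x))"

definition op_sqrt :: "'a hilbert \<Rightarrow> ('a \<times> 'a) set \<Rightarrow> ('a \<times> 'a) set" where
  "op_sqrt H B = (THE A. positive_self_adjoint H A \<and> A O A = B)"

definition op_abs :: "'a hilbert \<Rightarrow> ('a \<times> 'a) set \<Rightarrow> ('a \<times> 'a) set" where
  "op_abs H T = op_sqrt H (T O adjoint_op H T)"

definition initial_space :: "'a hilbert \<Rightarrow> ('a \<times> 'a) set \<Rightarrow> 'a set" where
  "initial_space H V = orth_compl H {x. (x, hzero H) \<in> V}"

definition partial_isometry :: "'a hilbert \<Rightarrow> ('a \<times> 'a) set \<Rightarrow> bool" where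
  "partial_isometry H V \<longleftrightarrow> bounded_op H V
     \<and> (\<forall>(x, y)\<in>V. x \<in> initial_space H V \<longrightarrow> hnorm H y = hnorm H x)"

definition polar_part :: "'a hilbert \<Rightarrow> ('a \<times> 'a) set \<Rightarrow> ('a \<times> 'a) set" where
  "polar_part H T = (THE V. partial_isometry H V
     \<and> initial_space H V = htopology H closure_of (Range (op_abs H T))
     \<and> T = op_abs H T O V)"

definition orth_proj :: "'a hilbert \<Rightarrow> 'a set \<Rightarrow> ('a \<times> 'a) set" where
  "orth_proj H K = {(x, y). x \<in> hcarrier H \<and> y \<in> K \<and> hminus H x y \<in> orth_compl H K}"

text \<open>The entry in row \<open>i\<close> and column \<open>j\<close> (both in \<open>{1, 2}\<close>) of an operator on \<open>H \<oplus> H\<close>, viewed as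
  a two-by-two matrix of operators on \<open>H\<close>.\<close>

definition op_entry ::
    "'a hilbert \<Rightarrow> (('a \<times> 'a) \<times> ('a \<times> 'a)) set \<Rightarrow> nat \<Rightarrow> nat \<Rightarrow> ('a \<times> 'a) set" where
  "op_entry H P i j = {(x, if i = 1 then fst u else snd u) | x u.
     x \<in> hcarrier H \<and> (if j = 1 then (x, hzero H) else (hzero H, x), u) \<in> P}"


section \<open>Measurable fields and direct integrals\<close>

text \<open>\<open>S\<close> is the set of measurable vector fields.\<close>

locale measurable_hilbert_field =
  fixes \<omega> :: "'z measure" and H :: "'z \<Rightarrow> 'a hilbert" and S :: "('z \<Rightarrow> 'a) set"
  assumes fibre: "hilbert_space (H \<zeta>)"
    and fields: "S \<subseteq> (\<Pi> \<zeta>\<in>UNIV. hcarrier (H \<zeta>))"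
    and inner_measurable: "\<lbrakk>x \<in> S; y \<in> S\<rbrakk>
        \<Longrightarrow> (\<lambda>\<zeta>. hinner (H \<zeta>) (x \<zeta>) (y \<zeta>)) \<in> borel_measurable \<omega>"
    and maximal: "\<lbrakk>v \<in> (\<Pi> \<zeta>\<in>UNIV. hcarrier (H \<zeta>));
          \<And>x. x \<in> S \<Longrightarrow> (\<lambda>\<zeta>. hinner (H \<zeta>) (x \<zeta>) (v \<zeta>)) \<in> borel_measurable \<omega>\<rbrakk> \<Longrightarrow> v \<in> S"
    and fundamental: "\<exists>X :: nat \<Rightarrow> 'z \<Rightarrow> 'a. (\<forall>n. X n \<in> S)
        \<and> (\<forall>\<zeta>. hdense (H \<zeta>) (hspan (H \<zeta>) (range (\<lambda>n. X n \<zeta>))))"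

definition square_integrable ::
    "'z measure \<Rightarrow> ('z \<Rightarrow> 'a hilbert) \<Rightarrow> ('z \<Rightarrow> 'a) set \<Rightarrow> ('z \<Rightarrow> 'a) set" where
  "square_integrable \<omega> H S = {x \<in> S. integrable \<omega> (\<lambda>\<zeta>. (hnorm (H \<zeta>) (x \<zeta>))\<^sup>2)}"

definition ae_eq ::
    "'z measure \<Rightarrow> ('z \<Rightarrow> 'a hilbert) \<Rightarrow> ('z \<Rightarrow> 'a) set \<Rightarrow> (('z \<Rightarrow> 'a) \<times> ('z \<Rightarrow> 'a)) set" where
  "ae_eq \<omega> H S = {(x, y). x \<in> square_integrable \<omega> H S \<and> y \<in> square_integrable \<omega> H S
     \<and> (AE \<zeta> in \<omega>. x \<zeta> = y \<zeta>)}"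

definition field_class ::
    "'z measure \<Rightarrow> ('z \<Rightarrow> 'a hilbert) \<Rightarrow> ('z \<Rightarrow> 'a) set \<Rightarrow> ('z \<Rightarrow> 'a) \<Rightarrow> ('z \<Rightarrow> 'a) set" where
  "field_class \<omega> H S x = ae_eq \<omega> H S `` {x}"

definition field_rep :: "('z \<Rightarrow> 'a) set \<Rightarrow> 'z \<Rightarrow> 'a" where
  "field_rep X = (SOME x. x \<in> X)"

definition direct_integral ::
    "'z measure \<Rightarrow> ('z \<Rightarrow> 'a hilbert) \<Rightarrow> ('z \<Rightarrow> 'a) set \<Rightarrow> ('z \<Rightarrow> 'a) set hilbert" where
  "direct_integral \<omega> H S = \<lparr> hcarrier = square_integrable \<omega> H S // ae_eq \<omega> H S,
     hzero = field_class \<omega> H S (\<lambda>\<zeta>. hzero (H \<zeta>)),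
     hadd = (\<lambda>X Y. field_class \<omega> H S (\<lambda>\<zeta>. hadd (H \<zeta>) (field_rep X \<zeta>) (field_rep Y \<zeta>))),
     hscale = (\<lambda>c X. field_class \<omega> H S (\<lambda>\<zeta>. hscale (H \<zeta>) c (field_rep X \<zeta>))),
     hinner = (\<lambda>X Y. \<integral>\<zeta>. hinner (H \<zeta>) (field_rep X \<zeta>) (field_rep Y \<zeta>) \<partial>\<omega>) \<rparr>"

definition measurable_bounded_field ::
    "('z \<Rightarrow> 'a hilbert) \<Rightarrow> ('z \<Rightarrow> 'a) set \<Rightarrow> ('z \<Rightarrow> ('a \<times> 'a) set) \<Rightarrow> bool" where
  "measurable_bounded_field H S T \<longleftrightarrow> (\<forall>\<zeta>. bounded_op (H \<zeta>) (T \<zeta>))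
     \<and> (\<forall>x\<in>S. (\<lambda>\<zeta>. op_app (T \<zeta>) (x \<zeta>)) \<in> S)"

definition measurable_closed_field ::
    "('z \<Rightarrow> 'a hilbert) \<Rightarrow> ('z \<Rightarrow> 'a) set \<Rightarrow> ('z \<Rightarrow> ('a \<times> 'a) set) \<Rightarrow> bool" where
  "measurable_closed_field H S T \<longleftrightarrow> (\<forall>\<zeta>. closed_op (H \<zeta>) (T \<zeta>))
     \<and> (\<forall>i\<in>{1, 2}. \<forall>j\<in>{1, 2}. measurable_bounded_field H S
          (\<lambda>\<zeta>. op_entry (H \<zeta>) (orth_proj (hsum (H \<zeta>) (H \<zeta>)) (T \<zeta>)) i j))"

text \<open>The operator \<open>(Tx)(\<zeta>) = T(\<zeta>)x(\<zeta>)\<close> on its maximal domain, for an everywhere defined field.\<close>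

definition op_integral :: "'z measure \<Rightarrow> ('z \<Rightarrow> 'a hilbert) \<Rightarrow> ('z \<Rightarrow> 'a) set
    \<Rightarrow> ('z \<Rightarrow> ('a \<times> 'a) set) \<Rightarrow> (('z \<Rightarrow> 'a) set \<times> ('z \<Rightarrow> 'a) set) set" where
  "op_integral \<omega> H S T = {(field_class \<omega> H S x, field_class \<omega> H S y) | x y.
     x \<in> square_integrable \<omega> H S \<and> y \<in> square_integrable \<omega> H S \<and> (\<forall>\<zeta>. (x \<zeta>, y \<zeta>) \<in> T \<zeta>)}"

text \<open>The next two predicates express \<open>R = \<integral>\<^sup>\<oplus> T(\<zeta>) d\<omega>(\<zeta>)\<close> for a field \<open>T\<close> that is only
  relevant almost everywhere: some almost everywhere equal field \<open>T'\<close> is measurable and \<open>R\<close> is its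
  associated operator.  The first one is for fields of closed operators, the second one for
  essentially bounded fields of bounded operators.\<close>

definition is_op_integral :: "'z measure \<Rightarrow> ('z \<Rightarrow> 'a hilbert) \<Rightarrow> ('z \<Rightarrow> 'a) set
    \<Rightarrow> ('z \<Rightarrow> ('a \<times> 'a) set) \<Rightarrow> (('z \<Rightarrow> 'a) set \<times> ('z \<Rightarrow> 'a) set) set \<Rightarrow> bool" where
  "is_op_integral \<omega> H S T R \<longleftrightarrow> (\<exists>T'. measurable_closed_field H S T'
     \<and> (AE \<zeta> in \<omega>. T' \<zeta> = T \<zeta>) \<and> R = op_integral \<omega> H S T')"

definition is_bounded_op_integral :: "'z measure \<Rightarrow> ('z \<Rightarrow> 'a hilbert) \<Rightarrow> ('z \<Rightarrow> 'a) set
    \<Rightarrow> ('z \<Rightarrow> ('a \<times> 'a) set) \<Rightarrow> (('z \<Rightarrow> 'a) set \<times> ('z \<Rightarrow> 'a) set) set \<Rightarrow> bool" where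
  "is_bounded_op_integral \<omega> H S T R \<longleftrightarrow> (\<exists>T'. measurable_bounded_field H S T'
     \<and> (\<exists>C. AE \<zeta> in \<omega>. \<forall>(u, v)\<in>T' \<zeta>. hnorm (H \<zeta>) v \<le> C * hnorm (H \<zeta>) u)
     \<and> (AE \<zeta> in \<omega>. T' \<zeta> = T \<zeta>) \<and> R = op_integral \<omega> H S T')"

definition decomposable :: "'z measure \<Rightarrow> ('z \<Rightarrow> 'a hilbert) \<Rightarrow> ('z \<Rightarrow> 'a) set
    \<Rightarrow> (('z \<Rightarrow> 'a) set \<times> ('z \<Rightarrow> 'a) set) set \<Rightarrow> bool" where
  "decomposable \<omega> H S R \<longleftrightarrow> (\<exists>T. is_op_integral \<omega> H S T R)"

end

theory Submission
  imports Defs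
begin

text \<open>
  The polar part of a closed operator is obtained from the projection onto its graph by sums,
  products and strong limits, and constructions of this kind commute with direct integrals.

  In detail, let \<open>T\<close> be a closed operator on a Hilbert space and let \<open>P\<close> be the projection onto
  its graph. Write \<open>P(x, 0) = (R x, B x)\<close>; for densely defined \<open>T\<close> this means
  \<open>R = (1 + T\<^sup>*T)\<inverse>\<close> and \<open>B = T R\<close>, but both maps make sense for every closed \<open>T\<close>. They are
  bounded, \<open>0 \<le> R \<le> 1\<close>, and \<open>\<parallel>B x\<parallel> = \<parallel>C x\<parallel>\<close> where \<open>C = (R (1 - R))\<^sup>1\<^sup>/\<^sup>2\<close>. Hence
  \<open>V = lim B (1 + (1 - C) + \<dots> + (1 - C)\<^sup>n)\<close> exists strongly, is a partial isometry with the same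
  kernel as \<open>C\<close>, and satisfies \<open>V C = B\<close>. For densely defined \<open>T\<close> it is the polar part
  (\<open>polar_part_eq\<close>). This requires the identification of \<open>|T|\<close>. With \<open>D = R\<^sup>1\<^sup>/\<^sup>2\<close> and
  \<open>E = (1 - R)\<^sup>1\<^sup>/\<^sup>2\<close>, the graph of \<open>|T|\<close> is \<open>{(D x, E x)}\<close>: from \<open>D\<^sup>2 + E\<^sup>2 = 1\<close> one reads off
  that this operator is positive, self-adjoint and a square root of
  \<open>T\<^sup>*T = {(u, w). R (u + w) = u}\<close> (\<open>TstarT\<close>). It is the only such root
  (\<open>positive_root_unique\<close>), because for any root \<open>A\<close> the bounded operator \<open>A R\<close> is a positive
  root of \<open>R (1 - R)\<close>, hence equal to \<open>C\<close>, and \<open>A\<close> can be recovered from \<open>R\<close> and \<open>C\<close>. The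
  equation \<open>V C = B\<close> then extends to \<open>V |T| = T\<close>.

  The direct integral is a Hilbert space (\<open>hilbert_space_DI\<close>, the Riesz-Fischer argument), so this
  applies to the operator \<open>\<integral>\<^sup>\<oplus> T(\<zeta>)\<close> as well as to its fibres. The integral of a measurable field
  of closed operators is closed and its graph projection is computed fibrewise, so \<open>R\<close> and \<open>B\<close>
  are the direct integrals of the \<open>R(\<zeta>)\<close> and \<open>B(\<zeta>)\<close>. By dominated convergence, being a direct
  integral of a field of operators survives strong limits of contractions
  (\<open>decomposes_limit\<close>), and so it passes from \<open>R\<close> and \<open>B\<close> to \<open>V\<close>.

  Two points remain. Almost every \<open>T(\<zeta>)\<close> is densely defined (\<open>dense_fibres\<close>): a closed operator
  is densely defined iff \<open>R\<close> is injective, and the projection onto the kernel of \<open>R\<close>, being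
  \<open>lim (1 - R)\<^sup>n\<close>, is again a direct integral. And \<open>V(\<zeta>)\<close> is measurable also as a field of closed
  operators (\<open>polar_map_closed_field\<close>), because the projection onto the graph of a partial isometry
  is an explicit expression in it, its adjoint and its kernel projection.
\<close>

section \<open>Inner product spaces and sequential convergence\<close>

text \<open>The axioms of \<^locale>\<open>hilbert_space\<close> without completeness. They are separated because direct sums,
  closed subspaces and the direct integral are first shown to be inner product spaces, and their
  completeness is then proved by means of the norm calculus that an inner product provides.\<close>

locale inner_space =
  fixes H :: "'a hilbert"
  assumes zero_closed [simp, intro]: "hzero H \<in> hcarrier H"
    and add_closed [simp, intro]: "\<lbrakk>x \<in> hcarrier H; y \<in> hcarrier H\<rbrakk> \<Longrightarrow> hadd H x y \<in> hcarrier H"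
    and scale_closed [simp, intro]: "x \<in> hcarrier H \<Longrightarrow> hscale H c x \<in> hcarrier H"
    and add_assoc: "\<lbrakk>x \<in> hcarrier H; y \<in> hcarrier H; z \<in> hcarrier H\<rbrakk>
        \<Longrightarrow> hadd H (hadd H x y) z = hadd H x (hadd H y z)"
    and add_commute: "\<lbrakk>x \<in> hcarrier H; y \<in> hcarrier H\<rbrakk> \<Longrightarrow> hadd H x y = hadd H y x"
    and add_zero: "x \<in> hcarrier H \<Longrightarrow> hadd H x (hzero H) = x"
    and add_inverse: "x \<in> hcarrier H \<Longrightarrow> hminus H x x = hzero H"
    and scale_add_right: "\<lbrakk>x \<in> hcarrier H; y \<in> hcarrier H\<rbrakk>
        \<Longrightarrow> hscale H c (hadd H x y) = hadd H (hscale H c x) (hscale H c y)"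
    and scale_add_left: "x \<in> hcarrier H
        \<Longrightarrow> hscale H (c + d) x = hadd H (hscale H c x) (hscale H d x)"
    and scale_scale: "x \<in> hcarrier H \<Longrightarrow> hscale H c (hscale H d x) = hscale H (c * d) x"
    and scale_one: "x \<in> hcarrier H \<Longrightarrow> hscale H 1 x = x"
    and inner_commute: "\<lbrakk>x \<in> hcarrier H; y \<in> hcarrier H\<rbrakk> \<Longrightarrow> hinner H y x = cnj (hinner H x y)"
    and inner_add_left: "\<lbrakk>x \<in> hcarrier H; y \<in> hcarrier H; z \<in> hcarrier H\<rbrakk>
        \<Longrightarrow> hinner H (hadd H x y) z = hinner H x z + hinner H y z"
    and inner_scale_left: "\<lbrakk>x \<in> hcarrier H; y \<in> hcarrier H\<rbrakk>
        \<Longrightarrow> hinner H (hscale H c x) y = c * hinner H x y"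
    and inner_nonneg: "x \<in> hcarrier H \<Longrightarrow> 0 \<le> Re (hinner H x x)"
    and inner_definite: "\<lbrakk>x \<in> hcarrier H; hinner H x x = 0\<rbrakk> \<Longrightarrow> x = hzero H"

sublocale hilbert_space \<subseteq> inner_space
  by unfold_locales (fact zero_closed add_closed scale_closed add_assoc add_commute add_zero
      add_inverse scale_add_right scale_add_left scale_scale scale_one inner_commute inner_add_left
      inner_scale_left inner_nonneg inner_definite)+

text \<open>Convergence of sequences replaces the topological notions throughout: closures, density and
  closedness of graphs are all characterised by it below.\<close>

definition hlim :: "'a hilbert \<Rightarrow> (nat \<Rightarrow> 'a) \<Rightarrow> 'a \<Rightarrow> bool" where
  "hlim H f x \<longleftrightarrow> (\<forall>n. f n \<in> hcarrier H) \<and> x \<in> hcarrier H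
     \<and> (\<lambda>n. hnorm H (hminus H (f n) x)) \<longlonglongrightarrow> 0"

context inner_space
begin

abbreviation carr ("\<H>") where "carr \<equiv> hcarrier H"
abbreviation vzero ("\<zero>") where "vzero \<equiv> hzero H"
abbreviation vadd (infixl "\<oplus>" 65) where "vadd \<equiv> hadd H"
abbreviation vminus (infixl "\<ominus>" 65) where "vminus \<equiv> hminus H"
abbreviation vscale (infixr "\<odot>" 75) where "vscale \<equiv> hscale H"
abbreviation ip ("\<langle>_,/ _\<rangle>") where "ip \<equiv> hinner H"
abbreviation nm where "nm \<equiv> hnorm H"

lemma minus_closed [simp, intro]: "x \<in> \<H> \<Longrightarrow> y \<in> \<H> \<Longrightarrow> x \<ominus> y \<in> \<H>"
  by (simp add: hminus_def)

lemma inner_minus_left: "\<lbrakk>x \<in> \<H>; y \<in> \<H>; z \<in> \<H>\<rbrakk> \<Longrightarrow> \<langle>x \<ominus> y, z\<rangle> = \<langle>x, z\<rangle> - \<langle>y, z\<rangle>"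
  by (simp add: hminus_def inner_add_left inner_scale_left)

lemma inner_add_right: "\<lbrakk>x \<in> \<H>; y \<in> \<H>; z \<in> \<H>\<rbrakk> \<Longrightarrow> \<langle>z, x \<oplus> y\<rangle> = \<langle>z, x\<rangle> + \<langle>z, y\<rangle>"
  by (subst (1 2 3) inner_commute) (simp_all add: inner_add_left)

lemma inner_minus_right: "\<lbrakk>x \<in> \<H>; y \<in> \<H>; z \<in> \<H>\<rbrakk> \<Longrightarrow> \<langle>z, x \<ominus> y\<rangle> = \<langle>z, x\<rangle> - \<langle>z, y\<rangle>"
  by (subst (1 2 3) inner_commute) (simp_all add: inner_minus_left)

lemma inner_scale_right: "\<lbrakk>x \<in> \<H>; z \<in> \<H>\<rbrakk> \<Longrightarrow> \<langle>z, c \<odot> x\<rangle> = cnj c * \<langle>z, x\<rangle>"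
  by (subst (1 2) inner_commute) (simp_all add: inner_scale_left)

lemma inner_zero_left [simp]: "x \<in> \<H> \<Longrightarrow> \<langle>\<zero>, x\<rangle> = 0"
  using inner_minus_left[of x x x] add_inverse[of x] by simp

lemma inner_zero_right [simp]: "x \<in> \<H> \<Longrightarrow> \<langle>x, \<zero>\<rangle> = 0"
  using inner_commute[of "\<zero>" x] by simp

lemmas inner_simps = inner_add_left inner_add_right inner_minus_left inner_minus_right
  inner_scale_left inner_scale_right

text \<open>The standard way of proving vector identities here. Testing against all vectors turns an identity
  in \<open>H\<close> into an identity of complex numbers, where the simplifier applies.\<close>

lemma vec_eqI:
  assumes "x \<in> \<H>" "y \<in> \<H>" "\<And>z. z \<in> \<H> \<Longrightarrow> \<langle>x, z\<rangle> = \<langle>y, z\<rangle>"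
  shows "x = y"
proof -
  have "x \<ominus> y = \<zero>"
    using assms by (intro inner_definite) (simp_all add: inner_minus_left)
  then have "y \<oplus> (x \<ominus> y) = y" using assms by (simp add: add_zero)
  moreover have "y \<oplus> (x \<ominus> y) = x \<oplus> (y \<ominus> y)"
    unfolding hminus_def using assms add_assoc[of y x "(- 1) \<odot> y"] add_assoc[of x y "(- 1) \<odot> y"]
    by (simp add: add_commute[of x y])
  ultimately show ?thesis using assms by (simp add: add_inverse add_zero)
qed

lemma minus_eq_zero_iff [simp]: "x \<in> \<H> \<Longrightarrow> y \<in> \<H> \<Longrightarrow> x \<ominus> y = \<zero> \<longleftrightarrow> x = y"
  by (metis add_inverse inner_minus_left inner_zero_left right_minus_eq vec_eqI)

lemma inner_self: "x \<in> \<H> \<Longrightarrow> \<langle>x, x\<rangle> = complex_of_real ((nm x)\<^sup>2)"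
proof -
  assume x: "x \<in> \<H>"
  have "Im \<langle>x, x\<rangle> = 0" using inner_commute[OF x x] by (simp add: complex_eq_iff)
  then show ?thesis using inner_nonneg[OF x] by (simp add: hnorm_def complex_eq_iff)
qed

lemma norm_sq: "x \<in> \<H> \<Longrightarrow> (nm x)\<^sup>2 = Re \<langle>x, x\<rangle>"
  by (simp add: hnorm_def inner_nonneg)

lemma norm_nonneg [simp]: "x \<in> \<H> \<Longrightarrow> 0 \<le> nm x"
  by (simp add: hnorm_def inner_nonneg)

lemma norm_zero [simp]: "nm \<zero> = 0"
  by (simp add: hnorm_def)

lemma norm_eq_zero [simp]: "x \<in> \<H> \<Longrightarrow> nm x = 0 \<longleftrightarrow> x = \<zero>"
  using inner_definite inner_self by fastforce

lemma inner_self_eq_zero: "x \<in> \<H> \<Longrightarrow> Re \<langle>x, x\<rangle> = 0 \<longleftrightarrow> x = \<zero>"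
  by (metis norm_eq_zero norm_sq zero_eq_power2)

lemma Re_inner_commute: "x \<in> \<H> \<Longrightarrow> y \<in> \<H> \<Longrightarrow> Re \<langle>y, x\<rangle> = Re \<langle>x, y\<rangle>"
  by (metis inner_commute complex_cnj complex.sel(1) cnj.simps(1))

lemma norm_add_sq: "x \<in> \<H> \<Longrightarrow> y \<in> \<H> \<Longrightarrow> (nm (x \<oplus> y))\<^sup>2 = (nm x)\<^sup>2 + (nm y)\<^sup>2 + 2 * Re \<langle>x, y\<rangle>"
  by (simp add: norm_sq inner_simps Re_inner_commute[of x y])

lemma norm_minus_sq: "x \<in> \<H> \<Longrightarrow> y \<in> \<H> \<Longrightarrow> (nm (x \<ominus> y))\<^sup>2 = (nm x)\<^sup>2 + (nm y)\<^sup>2 - 2 * Re \<langle>x, y\<rangle>"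
  by (simp add: norm_sq inner_simps Re_inner_commute[of x y])

lemma norm_scale: "x \<in> \<H> \<Longrightarrow> nm (c \<odot> x) = cmod c * nm x"
proof -
  assume x: "x \<in> \<H>"
  have "complex_of_real ((nm (c \<odot> x))\<^sup>2) = c * cnj c * complex_of_real ((nm x)\<^sup>2)"
    using x by (simp only: inner_self[symmetric] scale_closed) (simp add: inner_simps)
  also have "\<dots> = complex_of_real ((cmod c * nm x)\<^sup>2)"
    by (simp add: complex_norm_square[symmetric] power_mult_distrib)
  finally have "(nm (c \<odot> x))\<^sup>2 = (cmod c * nm x)\<^sup>2" using of_real_eq_iff by blast
  then show ?thesis using x by (simp add: power2_eq_iff_nonneg)
qed

lemma cauchy_schwarz:
  assumes x: "x \<in> \<H>" and y: "y \<in> \<H>"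
  shows "cmod \<langle>x, y\<rangle> \<le> nm x * nm y"
proof (cases "y = \<zero>")
  case False
  define n where "n = (nm y)\<^sup>2"
  have n: "n > 0" using False y by (simp add: n_def)
  \<comment> \<open>The coefficient of the projection of \<open>x\<close> onto the line through \<open>y\<close>.\<close>
  define c where "c = \<langle>x, y\<rangle> / complex_of_real n"
  have cc: "c * cnj \<langle>x, y\<rangle> = complex_of_real ((cmod \<langle>x, y\<rangle>)\<^sup>2 / n)"
    by (simp add: c_def complex_norm_square[symmetric])
  have "(nm (x \<ominus> c \<odot> y))\<^sup>2 = (nm x)\<^sup>2 + (cmod c)\<^sup>2 * n - 2 * Re (cnj c * \<langle>x, y\<rangle>)"
    using x y by (simp add: norm_minus_sq norm_scale inner_simps power_mult_distrib n_def)
  also have "Re (cnj c * \<langle>x, y\<rangle>) = (cmod \<langle>x, y\<rangle>)\<^sup>2 / n"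
    using cc by (metis complex_cnj_cnj complex_cnj_mult Re_complex_of_real complex_cnj_complex_of_real)
  also have "(cmod c)\<^sup>2 * n = (cmod \<langle>x, y\<rangle>)\<^sup>2 / n"
    using n by (simp add: c_def norm_divide power_divide power2_eq_square)
  finally have "0 \<le> (nm x)\<^sup>2 - (cmod \<langle>x, y\<rangle>)\<^sup>2 / n"
    using zero_le_power2[of "nm (x \<ominus> c \<odot> y)"] by linarith
  then have "(cmod \<langle>x, y\<rangle>)\<^sup>2 \<le> (nm x)\<^sup>2 * n" using n by (simp add: field_simps)
  then have "(cmod \<langle>x, y\<rangle>)\<^sup>2 \<le> (nm x * nm y)\<^sup>2" by (simp add: n_def power_mult_distrib)
  then show ?thesis using x y by (simp add: power2_le_iff_abs_le)
qed (use x in simp)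

lemma norm_triangle:
  assumes x: "x \<in> \<H>" and y: "y \<in> \<H>"
  shows "nm (x \<oplus> y) \<le> nm x + nm y"
proof -
  have "Re \<langle>x, y\<rangle> \<le> nm x * nm y"
    using cauchy_schwarz[OF x y] complex_Re_le_cmod order_trans by blast
  then have "(nm (x \<oplus> y))\<^sup>2 \<le> (nm x + nm y)\<^sup>2"
    using x y by (simp add: norm_add_sq power2_sum)
  then show ?thesis using x y by (simp add: power2_le_iff_abs_le)
qed

lemma norm_minus_commute: "x \<in> \<H> \<Longrightarrow> y \<in> \<H> \<Longrightarrow> nm (x \<ominus> y) = nm (y \<ominus> x)"
  by (rule power2_eq_imp_eq) (simp_all add: norm_minus_sq Re_inner_commute[of x y])

lemma norm_triangle_minus:
  assumes "x \<in> \<H>" "y \<in> \<H>" "z \<in> \<H>"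
  shows "nm (x \<ominus> z) \<le> nm (x \<ominus> y) + nm (y \<ominus> z)"
proof -
  have "x \<ominus> z = (x \<ominus> y) \<oplus> (y \<ominus> z)"
    using assms by (intro vec_eqI) (simp_all add: inner_simps)
  then show ?thesis using norm_triangle[of "x \<ominus> y" "y \<ominus> z"] assms by simp
qed

lemma norm_diff_le: "x \<in> \<H> \<Longrightarrow> y \<in> \<H> \<Longrightarrow> \<bar>nm x - nm y\<bar> \<le> nm (x \<ominus> y)"
proof -
  assume x: "x \<in> \<H>" and y: "y \<in> \<H>"
  have z: "\<And>u. u \<in> \<H> \<Longrightarrow> u \<ominus> \<zero> = u"
    by (rule vec_eqI) (simp_all add: inner_simps)
  show ?thesis
    using norm_triangle_minus[of x y \<zero>] norm_triangle_minus[of y x \<zero>] x y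
    by (simp add: z norm_minus_commute[of y x])
qed

lemma minus_zero_right [simp]: "x \<in> \<H> \<Longrightarrow> x \<ominus> \<zero> = x"
  by (rule vec_eqI) (simp_all add: inner_simps)

lemma add_zero_right [simp]: "x \<in> \<H> \<Longrightarrow> x \<oplus> \<zero> = x"
  by (rule add_zero)

lemma add_zero_left [simp]: "x \<in> \<H> \<Longrightarrow> \<zero> \<oplus> x = x"
  by (rule vec_eqI) (simp_all add: inner_simps)

lemma minus_self [simp]: "x \<in> \<H> \<Longrightarrow> x \<ominus> x = \<zero>"
  by (rule add_inverse)

lemma scale_zero_vec [simp]: "c \<odot> \<zero> = \<zero>"
  by (rule vec_eqI) (simp_all add: inner_simps)

lemma metric: "Metric_space \<H> (hdist H)"
proof
  show "0 \<le> hdist H x y" for x y by (simp add: hdist_def)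
  show "hdist H x y = hdist H y x" for x y by (simp add: hdist_def norm_minus_commute)
  show "x \<in> \<H> \<Longrightarrow> y \<in> \<H> \<Longrightarrow> (hdist H x y = 0) = (x = y)" for x y by (simp add: hdist_def)
  show "x \<in> \<H> \<Longrightarrow> y \<in> \<H> \<Longrightarrow> z \<in> \<H> \<Longrightarrow> hdist H x z \<le> hdist H x y + hdist H y z" for x y z
    by (simp add: hdist_def norm_triangle_minus)
qed

lemma limitin_iff_hlim:
  assumes "\<And>n. f n \<in> \<H>"
  shows "limitin (htopology H) f x sequentially \<longleftrightarrow> hlim H f x"
proof -
  have "limitin (htopology H) f x sequentially \<longleftrightarrow>
      x \<in> \<H> \<and> (\<forall>\<epsilon>>0. eventually (\<lambda>n. f n \<in> \<H> \<and> hdist H (f n) x < \<epsilon>) sequentially)"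
    by (simp add: htopology_def Metric_space.limitin_metric[OF metric])
  also have "\<dots> \<longleftrightarrow> hlim H f x"
    unfolding hlim_def tendsto_iff using assms by (cases "x \<in> \<H>") (simp_all add: hdist_def dist_real_def)
  finally show ?thesis .
qed

lemma closure_iff_hlim:
  assumes "A \<subseteq> \<H>"
  shows "x \<in> htopology H closure_of A \<longleftrightarrow> (\<exists>f. (\<forall>n. f n \<in> A) \<and> hlim H f x)"
proof -
  have "x \<in> htopology H closure_of A \<longleftrightarrow>
      x \<in> \<H> \<and> (\<exists>f. range f \<subseteq> A \<inter> \<H> \<and> limitin (htopology H) f x sequentially)"
    by (simp add: htopology_def Metric_space.closure_of_sequentially[OF metric])
  also have "\<dots> \<longleftrightarrow> (\<exists>f. (\<forall>n. f n \<in> A) \<and> hlim H f x)" (is "?L \<longleftrightarrow> ?R")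
  proof
    assume ?L
    then obtain f where f: "range f \<subseteq> A \<inter> \<H>" "limitin (htopology H) f x sequentially" by blast
    then have "\<And>n. f n \<in> \<H>" by blast
    then show ?R using f limitin_iff_hlim by blast
  next
    assume ?R
    then obtain f where f: "\<And>n. f n \<in> A" "hlim H f x" by blast
    then have "\<And>n. f n \<in> \<H>" "range f \<subseteq> A \<inter> \<H>" using assms by blast+
    then show ?L using f limitin_iff_hlim[of f x] by (auto simp: hlim_def)
  qed
  finally show ?thesis .
qed

lemma hdense_iff: "A \<subseteq> \<H> \<Longrightarrow> hdense H A \<longleftrightarrow> (\<forall>x\<in>\<H>. \<exists>f. (\<forall>n. f n \<in> A) \<and> hlim H f x)"
  unfolding hdense_def set_eq_iff by (simp add: closure_iff_hlim) (meson hlim_def)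

lemma hlim_in: "hlim H f x \<Longrightarrow> f n \<in> \<H>" "hlim H f x \<Longrightarrow> x \<in> \<H>"
  by (simp_all add: hlim_def)

lemma hlim_norm: "hlim H f x \<Longrightarrow> (\<lambda>n. nm (f n)) \<longlonglongrightarrow> nm x"
proof -
  assume f: "hlim H f x"
  have "(\<lambda>n. nm (f n) - nm x) \<longlonglongrightarrow> 0"
  proof (rule tendsto_0_le[where K = 1])
    show "(\<lambda>n. nm (f n \<ominus> x)) \<longlonglongrightarrow> 0" using f by (simp add: hlim_def)
    show "\<forall>\<^sub>F n in sequentially. norm (nm (f n) - nm x) \<le> norm (nm (f n \<ominus> x)) * 1"
      using norm_diff_le[OF hlim_in[OF f]] hlim_in[OF f] by simp
  qed
  then show ?thesis by (simp add: LIM_zero_iff)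
qed

lemma hlim_inner:
  assumes f: "hlim H f x" and g: "hlim H g y"
  shows "(\<lambda>n. \<langle>f n, g n\<rangle>) \<longlonglongrightarrow> \<langle>x, y\<rangle>"
proof -
  have "(\<lambda>n. \<langle>f n, g n\<rangle> - \<langle>x, y\<rangle>) \<longlonglongrightarrow> 0"
  proof (rule tendsto_0_le[where K = 1])
    show "(\<lambda>n. nm (f n \<ominus> x) * nm (g n) + nm x * nm (g n \<ominus> y)) \<longlonglongrightarrow> 0"
    proof -
      have "(\<lambda>n. nm (f n \<ominus> x) * nm (g n) + nm x * nm (g n \<ominus> y)) \<longlonglongrightarrow> 0 * nm y + nm x * 0"
        using f g hlim_norm[OF g] by (intro tendsto_intros) (auto simp: hlim_def)
      then show ?thesis by simp
    qed
    show "\<forall>\<^sub>F n in sequentially. norm (\<langle>f n, g n\<rangle> - \<langle>x, y\<rangle>)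
        \<le> norm (nm (f n \<ominus> x) * nm (g n) + nm x * nm (g n \<ominus> y)) * 1"
    proof (intro always_eventually allI)
      fix n
      have m: "f n \<in> \<H>" "g n \<in> \<H>" "x \<in> \<H>" "y \<in> \<H>" using f g by (auto intro: hlim_in)
      have "\<langle>f n, g n\<rangle> - \<langle>x, y\<rangle> = \<langle>f n \<ominus> x, g n\<rangle> + \<langle>x, g n \<ominus> y\<rangle>"
        using m by (simp add: inner_simps)
      then have "cmod (\<langle>f n, g n\<rangle> - \<langle>x, y\<rangle>) \<le> cmod \<langle>f n \<ominus> x, g n\<rangle> + cmod \<langle>x, g n \<ominus> y\<rangle>"
        by (metis norm_triangle_ineq)
      also have "\<dots> \<le> nm (f n \<ominus> x) * nm (g n) + nm x * nm (g n \<ominus> y)"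
        using m by (intro add_mono cauchy_schwarz) auto
      also have "\<dots> \<le> norm \<dots> * 1" by simp
      finally show "norm (\<langle>f n, g n\<rangle> - \<langle>x, y\<rangle>)
        \<le> norm (nm (f n \<ominus> x) * nm (g n) + nm x * nm (g n \<ominus> y)) * 1" .
    qed
  qed
  then show ?thesis by (simp add: LIM_zero_iff)
qed

lemma hlim_const [simp]: "hlim H (\<lambda>n. x) x \<longleftrightarrow> x \<in> \<H>"
  by (auto simp: hlim_def)

lemma hlim_unique: 
  assumes "hlim H f x" "hlim H f y" shows "x = y"
proof (rule vec_eqI)
  fix z assume "z \<in> \<H>"
  then show "\<langle>x, z\<rangle> = \<langle>y, z\<rangle>"
    using hlim_inner[OF assms(1), of "\<lambda>_. z" z] hlim_inner[OF assms(2), of "\<lambda>_. z" z] LIMSEQ_unique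
    by auto
qed (use assms in \<open>auto intro: hlim_in\<close>)

lemma hlim_lipschitz:
  assumes f: "hlim H f x" and a: "\<And>u. u \<in> \<H> \<Longrightarrow> a u \<in> \<H>"
    and K: "\<And>u v. u \<in> \<H> \<Longrightarrow> v \<in> \<H> \<Longrightarrow> nm (a u \<ominus> a v) \<le> K * nm (u \<ominus> v)"
  shows "hlim H (\<lambda>n. a (f n)) (a x)"
proof -
  have "(\<lambda>n. nm (a (f n) \<ominus> a x)) \<longlonglongrightarrow> 0"
  proof (rule tendsto_0_le[where K = "\<bar>K\<bar>"])
    show "(\<lambda>n. nm (f n \<ominus> x)) \<longlonglongrightarrow> 0" using f by (simp add: hlim_def)
    show "\<forall>\<^sub>F n in sequentially. norm (nm (a (f n) \<ominus> a x)) \<le> norm (nm (f n \<ominus> x)) * \<bar>K\<bar>"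
    proof (intro always_eventually allI)
      fix n
      have m: "f n \<in> \<H>" "x \<in> \<H>" using f by (auto intro: hlim_in)
      have "nm (a (f n) \<ominus> a x) \<le> K * nm (f n \<ominus> x)" using K m by blast
      also have "\<dots> \<le> \<bar>K\<bar> * nm (f n \<ominus> x)" using m by (intro mult_right_mono) auto
      finally show "norm (nm (a (f n) \<ominus> a x)) \<le> norm (nm (f n \<ominus> x)) * \<bar>K\<bar>"
        using m a by (simp add: mult.commute)
    qed
  qed
  then show ?thesis using f a by (auto simp: hlim_def)
qed

lemma hlim_add:
  assumes f: "hlim H f x" and g: "hlim H g y"
  shows "hlim H (\<lambda>n. f n \<oplus> g n) (x \<oplus> y)"
proof -
  have "(\<lambda>n. nm ((f n \<oplus> g n) \<ominus> (x \<oplus> y))) \<longlonglongrightarrow> 0"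
  proof (rule tendsto_0_le[where K = 1])
    show "(\<lambda>n. nm (f n \<ominus> x) + nm (g n \<ominus> y)) \<longlonglongrightarrow> 0"
      using f g by (auto simp: hlim_def intro: tendsto_add_zero)
    show "\<forall>\<^sub>F n in sequentially. norm (nm ((f n \<oplus> g n) \<ominus> (x \<oplus> y)))
        \<le> norm (nm (f n \<ominus> x) + nm (g n \<ominus> y)) * 1"
    proof (intro always_eventually allI)
      fix n
      have m: "f n \<in> \<H>" "g n \<in> \<H>" "x \<in> \<H>" "y \<in> \<H>" using f g by (auto intro: hlim_in)
      have "(f n \<oplus> g n) \<ominus> (x \<oplus> y) = (f n \<ominus> x) \<oplus> (g n \<ominus> y)"
        using m by (intro vec_eqI) (simp_all add: inner_simps)
      then show "norm (nm ((f n \<oplus> g n) \<ominus> (x \<oplus> y))) \<le> norm (nm (f n \<ominus> x) + nm (g n \<ominus> y)) * 1"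
        using norm_triangle[of "f n \<ominus> x" "g n \<ominus> y"] m by simp
    qed
  qed
  then show ?thesis using f g by (auto simp: hlim_def)
qed

lemma hlim_scale: "hlim H f x \<Longrightarrow> hlim H (\<lambda>n. c \<odot> f n) (c \<odot> x)"
proof (rule hlim_lipschitz[where K = "cmod c" and a = "vscale c"])
  fix u v assume m: "u \<in> \<H>" "v \<in> \<H>"
  have "c \<odot> u \<ominus> c \<odot> v = c \<odot> (u \<ominus> v)"
    using m by (intro vec_eqI) (simp_all add: inner_simps algebra_simps)
  then show "nm (c \<odot> u \<ominus> c \<odot> v) \<le> cmod c * nm (u \<ominus> v)" using m by (simp add: norm_scale)
qed auto

lemma hlim_minus: "hlim H f x \<Longrightarrow> hlim H g y \<Longrightarrow> hlim H (\<lambda>n. f n \<ominus> g n) (x \<ominus> y)"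
  unfolding hminus_def by (intro hlim_add hlim_scale)

definition hcauchy :: "(nat \<Rightarrow> 'a) \<Rightarrow> bool" where
  "hcauchy f \<longleftrightarrow> (\<forall>n. f n \<in> \<H>) \<and> (\<forall>e>0. \<exists>N. \<forall>m\<ge>N. \<forall>n\<ge>N. nm (f m \<ominus> f n) < e)"

lemma MCauchy_iff: "Metric_space.MCauchy \<H> (hdist H) f \<longleftrightarrow> hcauchy f"
proof (cases "\<forall>n. f n \<in> \<H>")
  case True
  then have "range f \<subseteq> \<H>" by auto
  then show ?thesis
    using True unfolding Metric_space.MCauchy_def[OF metric] hcauchy_def hdist_def by simp
next
  case False
  then show ?thesis
    unfolding Metric_space.MCauchy_def[OF metric] hcauchy_def by auto
qed

lemma hcauchyI:
  assumes "\<And>n. f n \<in> \<H>" "\<And>m n. nm (f m \<ominus> f n) \<le> r m + r n" "r \<longlonglongrightarrow> 0"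
  shows "hcauchy f"
  unfolding hcauchy_def
proof (intro conjI allI impI)
  fix e :: real assume "e > 0"
  then have "eventually (\<lambda>n. r n < e / 2) sequentially"
    using assms(3) by (intro order_tendstoD(2)) auto
  then obtain N where N: "\<And>n. n \<ge> N \<Longrightarrow> r n < e / 2" by (auto simp: eventually_sequentially)
  show "\<exists>N. \<forall>m\<ge>N. \<forall>n\<ge>N. nm (f m \<ominus> f n) < e"
  proof (intro exI[of _ N] allI impI)
    fix m n assume "m \<ge> N" "n \<ge> N"
    then show "nm (f m \<ominus> f n) < e" using N[of m] N[of n] assms(2)[of m n] by linarith
  qed
qed (rule assms)

lemma hilbert_spaceI:
  assumes "\<And>f. hcauchy f \<Longrightarrow> \<exists>x. hlim H f x"
  shows "hilbert_space H"
proof -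
  have "Metric_space.mcomplete \<H> (hdist H)"
    unfolding Metric_space.mcomplete_def[OF metric] MCauchy_iff
  proof (intro allI impI)
    fix f assume f: "hcauchy f"
    then obtain x where "hlim H f x" using assms by blast
    then show "\<exists>x. limitin (Metric_space.mtopology \<H> (hdist H)) f x sequentially"
      using limitin_iff_hlim[of f x] f by (auto simp: hcauchy_def htopology_def)
  qed
  then show ?thesis
    by unfold_locales ((rule zero_closed add_closed scale_closed add_assoc add_commute add_zero
      add_inverse scale_add_right scale_add_left scale_scale scale_one inner_commute inner_add_left
      inner_scale_left inner_nonneg inner_definite; assumption) | assumption)+
qed

lemma hsubspaceI:
  assumes "K \<subseteq> \<H>" "\<zero> \<in> K" "\<And>x y. x \<in> K \<Longrightarrow> y \<in> K \<Longrightarrow> x \<oplus> y \<in> K" "\<And>c x. x \<in> K \<Longrightarrow> c \<odot> x \<in> K"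
  shows "hsubspace H K"
  using assms by (simp add: hsubspace_def)

lemma hsubspace_minus: "hsubspace H K \<Longrightarrow> x \<in> K \<Longrightarrow> y \<in> K \<Longrightarrow> x \<ominus> y \<in> K"
  by (simp add: hsubspace_def hminus_def)

end

context hilbert_space
begin

lemma hcauchy_lim:
  assumes f: "hcauchy f" shows "\<exists>x. hlim H f x"
proof -
  obtain x where "limitin (Metric_space.mtopology \<H> (hdist H)) f x sequentially"
    using complete f unfolding Metric_space.mcomplete_def[OF metric] MCauchy_iff by blast
  then show ?thesis
    using limitin_iff_hlim[of f x] f by (auto simp: hcauchy_def htopology_def)
qed

end

section \<open>The Riesz representation theorem\<close>

text \<open>Used for first variations: a real quadratic polynomial with minimum at \<open>0\<close> has no linear term.\<close>

lemma nonneg_quadratic_imp_linear_zero: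
  fixes a b :: real
  assumes "0 \<le> a" "\<And>t. 0 \<le> t\<^sup>2 * a + 2 * t * b"
  shows "b = 0"
proof (rule ccontr)
  assume "b \<noteq> 0"
  define t where "t = - b / (a + 1)"
  have b: "b = - t * (a + 1)" using assms(1) by (simp add: t_def)
  have "t\<^sup>2 * a + 2 * t * b = - (t\<^sup>2 * (a + 2))"
    unfolding b by (simp add: power2_eq_square algebra_simps)
  moreover have "0 < t\<^sup>2 * (a + 2)"
    using \<open>b \<noteq> 0\<close> b assms(1) by (intro mult_pos_pos) auto
  ultimately show False using assms(2)[of t] by linarith
qed

context hilbert_space
begin

text \<open>The representing vector minimises \<open>J x = \<parallel>x\<parallel>\<^sup>2 - 2 Re (f x)\<close>. The parallelogram law makes every
  minimising sequence Cauchy, and the first variation of \<open>J\<close> at the minimum says that the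
  functional is the inner product with it.\<close>

theorem riesz:
  assumes add: "\<And>x y. x \<in> \<H> \<Longrightarrow> y \<in> \<H> \<Longrightarrow> f (x \<oplus> y) = f x + f y"
    and scale: "\<And>c x. x \<in> \<H> \<Longrightarrow> f (c \<odot> x) = c * f x"
    and bound: "\<And>x. x \<in> \<H> \<Longrightarrow> cmod (f x) \<le> K * nm x"
  obtains z where "z \<in> \<H>" "\<And>x. x \<in> \<H> \<Longrightarrow> f x = \<langle>x, z\<rangle>"
proof -
  define J where "J x = (nm x)\<^sup>2 - 2 * Re (f x)" for x
  have J_below: "- (K\<^sup>2) \<le> J x" if x: "x \<in> \<H>" for x
  proof -
    have "Re (f x) \<le> K * nm x" using bound[OF x] complex_Re_le_cmod order_trans by blast
    moreover have "0 \<le> (nm x - K)\<^sup>2" by simp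
    ultimately show ?thesis by (simp add: J_def power2_eq_square algebra_simps)
  qed
  define m where "m = Inf (J ` \<H>)"
  have bdd: "bdd_below (J ` \<H>)" using J_below by (auto simp: bdd_below_def)
  have ne: "J ` \<H> \<noteq> {}" using zero_closed by blast
  have m_le: "m \<le> J x" if "x \<in> \<H>" for x
    unfolding m_def using that bdd by (auto intro: cInf_lower)
  have "\<exists>x\<in>\<H>. J x < m + inverse (Suc n)" for n
  proof -
    have "Inf (J ` \<H>) < m + inverse (Suc n)" by (simp add: m_def)
    then show ?thesis using cInf_lessD[OF ne] by blast
  qed
  then obtain s where s: "\<And>n. s n \<in> \<H>" "\<And>n. J (s n) < m + inverse (Suc n)" by metis
  have fdiff: "f (x \<ominus> y) = f x - f y" if "x \<in> \<H>" "y \<in> \<H>" for x y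
    using that by (simp add: hminus_def add scale)
  (* parallelogram law *)
  have par: "(nm (x \<ominus> y))\<^sup>2 \<le> 2 * (J x - m) + 2 * (J y - m)" if x: "x \<in> \<H>" and y: "y \<in> \<H>" for x y
  proof -
    define w where "w = (1/2) \<odot> (x \<oplus> y)"
    have "w \<in> \<H>" using x y by (simp add: w_def)
    have "J w = (nm (x \<oplus> y))\<^sup>2 / 4 - Re (f x) - Re (f y)"
      using x y by (simp add: J_def w_def norm_scale scale add norm_divide power_divide add_divide_distrib)
    moreover have "(nm (x \<ominus> y))\<^sup>2 + (nm (x \<oplus> y))\<^sup>2 = 2 * (nm x)\<^sup>2 + 2 * (nm y)\<^sup>2"
      using x y by (simp add: norm_minus_sq norm_add_sq)
    moreover have "m \<le> J w" using m_le \<open>w \<in> \<H>\<close> by blast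
    moreover have "Re (f x) = ((nm x)\<^sup>2 - J x) / 2" "Re (f y) = ((nm y)\<^sup>2 - J y) / 2"
      by (simp_all add: J_def)
    ultimately show ?thesis by argo
  qed
  have "hcauchy s"
  proof (rule hcauchyI)
    show "nm (s j \<ominus> s k) \<le> sqrt (2 * inverse (Suc j)) + sqrt (2 * inverse (Suc k))" for j k
    proof -
      have "(nm (s j \<ominus> s k))\<^sup>2 \<le> 2 * inverse (Suc j) + 2 * inverse (Suc k)"
        using par[OF s(1)[of j] s(1)[of k]] s(2)[of j] s(2)[of k] by argo
      also have "\<dots> \<le> (sqrt (2 * inverse (Suc j)) + sqrt (2 * inverse (Suc k)))\<^sup>2"
        by (simp add: power2_sum)
      finally show ?thesis by (rule power2_le_imp_le) simp
    qed
    have "(\<lambda>n. sqrt (2 * inverse (real (Suc n)))) \<longlonglongrightarrow> sqrt (2 * 0)"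
      by (intro tendsto_intros LIMSEQ_inverse_real_of_nat)
    then show "(\<lambda>n. sqrt (2 * inverse (real (Suc n)))) \<longlonglongrightarrow> 0" by simp
  qed (rule s)
  then obtain z where z: "hlim H s z" using hcauchy_lim by blast
  then have zc: "z \<in> \<H>" by (rule hlim_in)
  have "(\<lambda>n. f (s n) - f z) \<longlonglongrightarrow> 0"
  proof (rule tendsto_0_le[where K = "\<bar>K\<bar>"])
    show "(\<lambda>n. nm (s n \<ominus> z)) \<longlonglongrightarrow> 0" using z by (simp add: hlim_def)
    have "norm (f (s n) - f z) \<le> norm (nm (s n \<ominus> z)) * \<bar>K\<bar>" for n
    proof -
      have "norm (f (s n) - f z) \<le> K * nm (s n \<ominus> z)"
        using bound[of "s n \<ominus> z"] fdiff s(1) zc by simp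
      also have "\<dots> \<le> \<bar>K\<bar> * nm (s n \<ominus> z)" using s(1) zc by (intro mult_right_mono) auto
      finally show ?thesis using s(1) zc by (simp add: mult.commute)
    qed
    then show "\<forall>\<^sub>F n in sequentially. norm (f (s n) - f z) \<le> norm (nm (s n \<ominus> z)) * \<bar>K\<bar>" by simp
  qed
  then have "(\<lambda>n. f (s n)) \<longlonglongrightarrow> f z" by (simp add: LIM_zero_iff)
  then have "(\<lambda>n. J (s n)) \<longlonglongrightarrow> J z"
    unfolding J_def by (intro tendsto_intros hlim_norm z)
  moreover have "(\<lambda>n. m + inverse (real (Suc n))) \<longlonglongrightarrow> m + 0"
    by (intro tendsto_intros LIMSEQ_inverse_real_of_nat)
  ultimately have "J z \<le> m + 0"
    using s(2) by (intro LIMSEQ_le) (auto intro: less_imp_le)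
  then have min: "J z \<le> J x" if "x \<in> \<H>" for x using m_le[OF that] by simp
  have re: "Re \<langle>u, z\<rangle> = Re (f u)" if u: "u \<in> \<H>" for u
  proof -
    have "Re \<langle>u, z\<rangle> - Re (f u) = 0"
    proof (rule nonneg_quadratic_imp_linear_zero[where a = "(nm u)\<^sup>2"])
      fix t :: real
      have "J (z \<oplus> complex_of_real t \<odot> u) = J z + t\<^sup>2 * (nm u)\<^sup>2 + 2 * t * (Re \<langle>u, z\<rangle> - Re (f u))"
        using u zc by (simp add: J_def norm_add_sq norm_scale add scale inner_simps
            Re_inner_commute[of z u] power_mult_distrib algebra_simps)
      moreover have "J z \<le> J (z \<oplus> complex_of_real t \<odot> u)" using u zc by (intro min) auto
      ultimately show "0 \<le> t\<^sup>2 * (nm u)\<^sup>2 + 2 * t * (Re \<langle>u, z\<rangle> - Re (f u))" by linarith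
    qed simp
    then show ?thesis by simp
  qed
  show thesis
  proof
    fix x assume x: "x \<in> \<H>"
    (* the imaginary part is the real part at -ix *)
    have "Im \<langle>x, z\<rangle> = Im (f x)"
      using re[of "(- \<i>) \<odot> x"] x zc by (simp add: scale inner_scale_left)
    then show "f x = \<langle>x, z\<rangle>" using re[OF x] by (simp add: complex_eq_iff)
  qed (rule zc)
qed

end

section \<open>Closed subspaces, projections and direct sums\<close>

definition closed_subspace :: "'a hilbert \<Rightarrow> 'a set \<Rightarrow> bool" where
  "closed_subspace H K \<longleftrightarrow> hsubspace H K \<and> (\<forall>f x. (\<forall>n. f n \<in> K) \<and> hlim H f x \<longrightarrow> x \<in> K)"

definition hproj :: "'a hilbert \<Rightarrow> 'a set \<Rightarrow> 'a \<Rightarrow> 'a" where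
  "hproj H K x = (THE y. y \<in> K \<and> hminus H x y \<in> orth_compl H K)"

context inner_space
begin

text \<open>On a closed subspace the inherited structure is also complete, so that the Riesz theorem can be
  applied inside it; this gives the orthogonal projection.\<close>

lemma inner_space_subspace:
  assumes "hsubspace H K"
  shows "inner_space (H\<lparr>hcarrier := K\<rparr>)"
proof -
  have K: "K \<subseteq> \<H>" "\<zero> \<in> K" "\<And>x y. x \<in> K \<Longrightarrow> y \<in> K \<Longrightarrow> x \<oplus> y \<in> K" "\<And>c x. x \<in> K \<Longrightarrow> c \<odot> x \<in> K"
    using assms by (auto simp: hsubspace_def)
  then have m: "\<And>x. x \<in> K \<Longrightarrow> x \<in> \<H>" by blast
  show ?thesis
  proof (unfold_locales, simp_all add: hminus_def K m inner_add_left inner_scale_left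
      inner_nonneg scale_scale scale_one scale_add_left scale_add_right add_assoc)
    show "x \<oplus> y = y \<oplus> x" if "x \<in> K" "y \<in> K" for x y using add_commute that m by blast
    show "x \<oplus> - 1 \<odot> x = \<zero>" if "x \<in> K" for x
      using add_inverse[OF m[OF that]] by (simp add: hminus_def)
    show "\<langle>y, x\<rangle> = cnj \<langle>x, y\<rangle>" if "x \<in> K" "y \<in> K" for x y using inner_commute that m by blast
    show "x = \<zero>" if "x \<in> K" "\<langle>x, x\<rangle> = 0" for x using inner_definite that m by blast
  qed
qed

lemma hminus_sub [simp]: "hminus (H\<lparr>hcarrier := K\<rparr>) = hminus H"
  by (simp add: hminus_def fun_eq_iff)

lemma hnorm_sub [simp]: "hnorm (H\<lparr>hcarrier := K\<rparr>) = hnorm H"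
  by (simp add: hnorm_def fun_eq_iff)

lemma orth_complD: "x \<in> orth_compl H K \<Longrightarrow> y \<in> K \<Longrightarrow> \<langle>x, y\<rangle> = 0"
  by (simp add: orth_compl_def)

lemma hproj_unique:
  assumes K: "hsubspace H K" and x: "x \<in> \<H>"
    and y: "y \<in> K" "x \<ominus> y \<in> orth_compl H K" and z: "z \<in> K" "x \<ominus> z \<in> orth_compl H K"
  shows "y = z"
proof -
  have m: "y \<in> \<H>" "z \<in> \<H>" using K y z by (auto simp: hsubspace_def)
  have d: "y \<ominus> z \<in> K" using hsubspace_minus[OF K] y z by blast
  have "\<langle>x \<ominus> y, y \<ominus> z\<rangle> = 0" "\<langle>x \<ominus> z, y \<ominus> z\<rangle> = 0" using y z d orth_complD by blast+
  moreover have "\<langle>y \<ominus> z, y \<ominus> z\<rangle> = \<langle>x \<ominus> z, y \<ominus> z\<rangle> - \<langle>x \<ominus> y, y \<ominus> z\<rangle>"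
    using m x by (simp add: inner_simps)
  ultimately have "\<langle>y \<ominus> z, y \<ominus> z\<rangle> = 0" by simp
  then show ?thesis using m inner_definite[of "y \<ominus> z"] by simp
qed

lemma hproj_eqI:
  assumes "hsubspace H K" "x \<in> \<H>" "y \<in> K" "x \<ominus> y \<in> orth_compl H K"
  shows "hproj H K x = y"
  unfolding hproj_def using assms by (intro the_equality) (auto intro: hproj_unique)

lemma closed_op_iff:
  "closed_op H T \<longleftrightarrow> single_valued T \<and> hsubspace (hsum H H) T \<and>
     (\<forall>f g x y. (\<forall>n. (f n, g n) \<in> T) \<and> hlim H f x \<and> hlim H g y \<longrightarrow> (x, y) \<in> T)"
proof (cases "hsubspace (hsum H H) T")
  case True
  then have sub: "T \<subseteq> \<H> \<times> \<H>" by (auto simp: hsubspace_def hsum_def)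
  interpret M: Metric_space12 \<H> "hdist H" \<H> "hdist H"
    using metric by (simp add: Metric_space12_def)
  have "closedin (prod_topology (htopology H) (htopology H)) T \<longleftrightarrow>
     (\<forall>s l. range s \<subseteq> T \<and> limitin (prod_topology (htopology H) (htopology H)) s l sequentially \<longrightarrow> l \<in> T)"
    using M.Prod_metric.metric_closedin_iff_sequentially_closed[of T] sub
    by (simp add: M.mtopology_prod_metric htopology_def)
  also have "\<dots> \<longleftrightarrow> (\<forall>f g x y. (\<forall>n. (f n, g n) \<in> T) \<and> hlim H f x \<and> hlim H g y \<longrightarrow> (x, y) \<in> T)"
    (is "?L \<longleftrightarrow> ?R")
  proof
    assume L: ?L
    show ?R
    proof (intro allI impI)
      fix f g x y assume fg: "(\<forall>n. (f n, g n) \<in> T) \<and> hlim H f x \<and> hlim H g y"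
      have "limitin (prod_topology (htopology H) (htopology H)) (\<lambda>n. (f n, g n)) (x, y) sequentially"
        using fg limitin_iff_hlim[of f x] limitin_iff_hlim[of g y]
        by (simp add: limitin_pairwise o_def hlim_def)
      moreover have "range (\<lambda>n. (f n, g n)) \<subseteq> T" using fg by auto
      ultimately show "(x, y) \<in> T" using L by blast
    qed
  next
    assume R: ?R
    show ?L
    proof (intro allI impI)
      fix s l assume s: "range s \<subseteq> T \<and> limitin (prod_topology (htopology H) (htopology H)) s l sequentially"
      have m: "fst (s n) \<in> \<H>" "snd (s n) \<in> \<H>" for n using s sub by (auto simp: subset_iff) (metis mem_Times_iff rangeI s subsetD sub)+
      have "hlim H (\<lambda>n. fst (s n)) (fst l)" "hlim H (\<lambda>n. snd (s n)) (snd l)"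
        using s m limitin_iff_hlim[of "\<lambda>n. fst (s n)" "fst l"] limitin_iff_hlim[of "\<lambda>n. snd (s n)" "snd l"]
        by (auto simp: limitin_pairwise o_def)
      moreover have "\<forall>n. (fst (s n), snd (s n)) \<in> T" using s by auto
      ultimately have "(fst l, snd l) \<in> T"
        using R[rule_format, of "\<lambda>n. fst (s n)" "\<lambda>n. snd (s n)" "fst l" "snd l"] by blast
      then show "l \<in> T" by simp
    qed
  qed
  finally show ?thesis using True by (auto simp: closed_op_def linear_op_def)
qed (auto simp: closed_op_def linear_op_def)

end

lemma inner_space_hsum:
  assumes "inner_space H" "inner_space K"
  shows "inner_space (hsum H K)"
proof -
  interpret H: inner_space H by fact
  interpret K: inner_space K by fact
  show ?thesis
  proof (unfold_locales, simp_all add: hsum_def hminus_def)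
    fix x :: "'a \<times> 'b"
    assume x: "x \<in> hcarrier H \<times> hcarrier K" "hinner H (fst x) (fst x) + hinner K (snd x) (snd x) = 0"
    then have m: "fst x \<in> hcarrier H" "snd x \<in> hcarrier K" by auto
    have "Re (hinner H (fst x) (fst x)) + Re (hinner K (snd x) (snd x)) = 0"
      using x(2) by (metis plus_complex.sel(1) zero_complex.sel(1))
    then have "Re (hinner H (fst x) (fst x)) = 0" "Re (hinner K (snd x) (snd x)) = 0"
      using H.inner_nonneg[OF m(1)] K.inner_nonneg[OF m(2)] by linarith+
    then show "x = (hzero H, hzero K)"
      using m by (simp add: H.inner_self_eq_zero K.inner_self_eq_zero prod_eq_iff)
  next
    fix x y :: "'a \<times> 'b"
    assume "x \<in> hcarrier H \<times> hcarrier K" "y \<in> hcarrier H \<times> hcarrier K"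
    then have m: "fst x \<in> hcarrier H" "snd x \<in> hcarrier K" "fst y \<in> hcarrier H" "snd y \<in> hcarrier K" by auto
    show "hinner H (fst y) (fst x) + hinner K (snd y) (snd x) =
        cnj (hinner H (fst x) (fst y)) + cnj (hinner K (snd x) (snd y))"
      using m H.inner_commute[of "fst x" "fst y"] K.inner_commute[of "snd x" "snd y"] by simp
    show "hadd H (fst x) (fst y) = hadd H (fst y) (fst x) \<and> hadd K (snd x) (snd y) = hadd K (snd y) (snd x)"
      using m H.add_commute[of "fst x" "fst y"] K.add_commute[of "snd x" "snd y"] by simp
  qed (auto simp: H.add_assoc K.add_assoc H.scale_add_right K.scale_add_right
      H.scale_add_left K.scale_add_left H.scale_scale K.scale_scale H.scale_one K.scale_one
      H.inner_add_left K.inner_add_left H.inner_scale_left K.inner_scale_left H.inner_nonneg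
      K.inner_nonneg H.add_zero K.add_zero distrib_left H.add_inverse[unfolded hminus_def]
      K.add_inverse[unfolded hminus_def])
qed

lemma hsum_simps [simp]:
  "hcarrier (hsum H K) = hcarrier H \<times> hcarrier K"
  "hzero (hsum H K) = (hzero H, hzero K)"
  "hadd (hsum H K) (x, y) (x', y') = (hadd H x x', hadd K y y')"
  "hscale (hsum H K) c (x, y) = (hscale H c x, hscale K c y)"
  "hminus (hsum H K) (x, y) (x', y') = (hminus H x x', hminus K y y')"
  "hinner (hsum H K) (x, y) (x', y') = hinner H x x' + hinner K y y'"
  by (simp_all add: hsum_def hminus_def)

lemma hsum_norm_sq:
  assumes "inner_space H" "inner_space K" "x \<in> hcarrier H" "y \<in> hcarrier K"
  shows "(hnorm (hsum H K) (x, y))\<^sup>2 = (hnorm H x)\<^sup>2 + (hnorm K y)\<^sup>2"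
  using inner_space.norm_sq[OF inner_space_hsum[OF assms(1,2)], of "(x, y)"] assms
  by (simp add: inner_space.norm_sq)

lemma hsum_norm_ge:
  assumes "inner_space H" "inner_space K" "x \<in> hcarrier H" "y \<in> hcarrier K"
  shows "hnorm H x \<le> hnorm (hsum H K) (x, y)" "hnorm K y \<le> hnorm (hsum H K) (x, y)"
    "hnorm (hsum H K) (x, y) \<le> hnorm H x + hnorm K y"
proof -
  have n: "0 \<le> hnorm H x" "0 \<le> hnorm K y" "0 \<le> hnorm (hsum H K) (x, y)"
    using assms inner_space.norm_nonneg inner_space_hsum[OF assms(1,2)] by fastforce+
  show "hnorm H x \<le> hnorm (hsum H K) (x, y)" "hnorm K y \<le> hnorm (hsum H K) (x, y)"
    by (rule power2_le_imp_le; use n hsum_norm_sq[OF assms] in simp)+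
  show "hnorm (hsum H K) (x, y) \<le> hnorm H x + hnorm K y"
    by (rule power2_le_imp_le) (use n hsum_norm_sq[OF assms] in \<open>simp_all add: power2_sum\<close>)
qed

lemma hlim_hsum_iff:
  assumes "inner_space H" "inner_space K"
  shows "hlim (hsum H K) f l \<longleftrightarrow> hlim H (\<lambda>n. fst (f n)) (fst l) \<and> hlim K (\<lambda>n. snd (f n)) (snd l)"
proof -
  obtain x y where l: "l = (x, y)" by (cases l)
  define g where "g n = fst (f n)" for n
  define h where "h n = snd (f n)" for n
  have f: "f = (\<lambda>n. (g n, h n))" by (simp add: g_def h_def)
  interpret H: inner_space H by fact
  interpret K: inner_space K by fact
  show ?thesis
  proof (cases "(\<forall>n. g n \<in> hcarrier H) \<and> x \<in> hcarrier H \<and> (\<forall>n. h n \<in> hcarrier K) \<and> y \<in> hcarrier K")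
    case True
    define u where "u n = hminus H (g n) x" for n
    define v where "v n = hminus K (h n) y" for n
    have uv: "u n \<in> hcarrier H" "v n \<in> hcarrier K" for n using True by (auto simp: u_def v_def)
    note b = hsum_norm_ge[OF assms uv]
    have nn: "0 \<le> hnorm H (u n)" "0 \<le> hnorm K (v n)" for n using uv by auto
    have nn2: "0 \<le> hnorm (hsum H K) (u n, v n)" for n using b(1)[of n n] nn(1)[of n] by linarith
    have "(\<lambda>n. hnorm (hsum H K) (u n, v n)) \<longlonglongrightarrow> 0 \<longleftrightarrow>
       (\<lambda>n. hnorm H (u n)) \<longlonglongrightarrow> 0 \<and> (\<lambda>n. hnorm K (v n)) \<longlonglongrightarrow> 0" (is "?L \<longleftrightarrow> ?R")
    proof
      assume L: ?L
      show ?R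
        by (intro conjI tendsto_0_le[OF L, where K = 1] always_eventually allI)
          (use b nn nn2 in auto)
    next
      assume ?R
      then have "(\<lambda>n. hnorm H (u n) + hnorm K (v n)) \<longlonglongrightarrow> 0" by (auto intro: tendsto_add_zero)
      then show ?L
        by (rule tendsto_0_le[where K = 1]) (use b nn nn2 in auto)
    qed
    then show ?thesis using True by (simp add: hlim_def f l u_def v_def)
  qed (auto simp: hlim_def f l)
qed

lemma hilbert_space_hsum:
  assumes "hilbert_space H" "hilbert_space K"
  shows "hilbert_space (hsum H K)"
proof -
  interpret H: hilbert_space H by fact
  interpret K: hilbert_space K by fact
  have i: "inner_space H" "inner_space K" by unfold_locales
  interpret S: inner_space "hsum H K" by (rule inner_space_hsum[OF i])
  show ?thesis
  proof (rule S.hilbert_spaceI)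
    fix f assume f: "S.hcauchy f"
    define g where "g n = fst (f n)" for n
    define h where "h n = snd (f n)" for n
    have fe: "f n = (g n, h n)" for n by (simp add: g_def h_def)
    have m: "g n \<in> hcarrier H" "h n \<in> hcarrier K" for n using f by (auto simp: S.hcauchy_def fe)
    have le: "hnorm H (hminus H (g j) (g k)) \<le> hnorm (hsum H K) (hminus (hsum H K) (f j) (f k))"
      "hnorm K (hminus K (h j) (h k)) \<le> hnorm (hsum H K) (hminus (hsum H K) (f j) (f k))" for j k
      unfolding fe hsum_simps by (intro hsum_norm_ge i H.minus_closed K.minus_closed m)+
    have "H.hcauchy g" "K.hcauchy h"
      using f m le unfolding S.hcauchy_def H.hcauchy_def K.hcauchy_def
      by (meson le_less_trans)+
    then obtain x y where "hlim H g x" "hlim K h y" using H.hcauchy_lim K.hcauchy_lim by blast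
    moreover have "g = (\<lambda>n. fst (f n))" "h = (\<lambda>n. snd (f n))" by (auto simp: g_def h_def)
    ultimately have "hlim (hsum H K) f (x, y)" by (simp add: hlim_hsum_iff[OF i])
    then show "\<exists>x. hlim (hsum H K) f x" ..
  qed
qed

context hilbert_space
begin

text \<open>The projection of \<open>x\<close> represents the functional \<open>u \<mapsto> \<langle>u, x\<rangle>\<close> on the Hilbert space \<open>K\<close>.\<close>

theorem projection_ex:
  assumes K: "closed_subspace H K" and x: "x \<in> \<H>"
  shows "\<exists>y\<in>K. x \<ominus> y \<in> orth_compl H K"
proof -
  have sub: "hsubspace H K" and sc: "\<And>f x. (\<forall>n. f n \<in> K) \<Longrightarrow> hlim H f x \<Longrightarrow> x \<in> K"
    using K by (auto simp: closed_subspace_def)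
  then have m: "\<And>y. y \<in> K \<Longrightarrow> y \<in> \<H>" by (auto simp: hsubspace_def)
  let ?HK = "H\<lparr>hcarrier := K\<rparr>"
  interpret S: inner_space ?HK by (rule inner_space_subspace[OF sub])
  interpret S: hilbert_space ?HK
  proof (rule S.hilbert_spaceI)
    fix f assume f: "S.hcauchy f"
    then have fK: "\<forall>n. f n \<in> K" by (simp add: S.hcauchy_def)
    have "hcauchy f" using f m by (simp add: S.hcauchy_def hcauchy_def)
    then obtain y where y: "hlim H f y" using hcauchy_lim by blast
    then have "hlim ?HK f y" using sc[OF fK y] fK by (simp add: hlim_def)
    then show "\<exists>y. hlim ?HK f y" ..
  qed
  have "\<exists>y\<in>K. \<forall>u\<in>K. \<langle>u, x\<rangle> = \<langle>u, y\<rangle>"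
  proof (rule S.riesz[of "\<lambda>u. \<langle>u, x\<rangle>" "nm x"])
    fix u assume "u \<in> hcarrier ?HK"
    then show "cmod \<langle>u, x\<rangle> \<le> nm x * hnorm ?HK u"
      using cauchy_schwarz[of u x] x m by (simp add: mult.commute)
  qed (use m x in \<open>auto simp: inner_add_left inner_scale_left\<close>)
  then obtain y where y: "y \<in> K" "\<And>u. u \<in> K \<Longrightarrow> \<langle>u, x\<rangle> = \<langle>u, y\<rangle>" by blast
  have "x \<ominus> y \<in> orth_compl H K"
  proof -
    have "\<langle>x \<ominus> y, u\<rangle> = 0" if u: "u \<in> K" for u
      using y(2)[OF u] inner_commute[of u x] inner_commute[of u y] m u x y(1) by (simp add: inner_simps)
    then show ?thesis using x m y by (simp add: orth_compl_def)
  qed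
  then show ?thesis using y(1) by blast
qed

lemma hproj:
  assumes "closed_subspace H K" "x \<in> \<H>"
  shows "hproj H K x \<in> K" "x \<ominus> hproj H K x \<in> orth_compl H K"
proof -
  obtain y where y: "y \<in> K" "x \<ominus> y \<in> orth_compl H K" using projection_ex assms by blast
  then have "hproj H K x = y" using assms by (intro hproj_eqI) (auto simp: closed_subspace_def)
  then show "hproj H K x \<in> K" "x \<ominus> hproj H K x \<in> orth_compl H K" using y by auto
qed

lemma closed_op_closed_subspace: "closed_op H T \<longleftrightarrow> single_valued T \<and> closed_subspace (hsum H H) T"
proof -
  have i: "inner_space H" by unfold_locales
  have "(\<forall>f g x y. (\<forall>n. (f n, g n) \<in> T) \<and> hlim H f x \<and> hlim H g y \<longrightarrow> (x, y) \<in> T) \<longleftrightarrow>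
     (\<forall>f l. (\<forall>n. f n \<in> T) \<and> hlim (hsum H H) f l \<longrightarrow> l \<in> T)" (is "?L \<longleftrightarrow> ?R")
  proof
    assume L: ?L
    show ?R
    proof (intro allI impI)
      fix f l assume f: "(\<forall>n. f n \<in> T) \<and> hlim (hsum H H) f l"
      then show "l \<in> T"
        using L[rule_format, of "\<lambda>n. fst (f n)" "\<lambda>n. snd (f n)" "fst l" "snd l"]
        by (simp add: hlim_hsum_iff[OF i i])
    qed
  next
    assume R: ?R
    show ?L
    proof (intro allI impI)
      fix f g x y assume f: "(\<forall>n. (f n, g n) \<in> T) \<and> hlim H f x \<and> hlim H g y"
      then show "(x, y) \<in> T"
        using R[rule_format, of "\<lambda>n. (f n, g n)" "(x, y)"] by (simp add: hlim_hsum_iff[OF i i])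
    qed
  qed
  then show ?thesis unfolding closed_op_iff closed_subspace_def by blast
qed

end

section \<open>Positive contractions\<close>

text \<open>Bounded operators defined on the whole space are total functions, of which only the values on the
  carrier matter; this makes composition and iteration easier than with graphs.\<close>

definition bop :: "'a hilbert \<Rightarrow> ('a \<Rightarrow> 'a) \<Rightarrow> bool" where
  "bop H c \<longleftrightarrow> (\<forall>x\<in>hcarrier H. c x \<in> hcarrier H)
     \<and> (\<forall>x\<in>hcarrier H. \<forall>y\<in>hcarrier H. c (hadd H x y) = hadd H (c x) (c y))
     \<and> (\<forall>k. \<forall>x\<in>hcarrier H. c (hscale H k x) = hscale H k (c x))
     \<and> (\<exists>K. \<forall>x\<in>hcarrier H. hnorm H (c x) \<le> K * hnorm H x)"

text \<open>Firmly nonexpansive symmetric maps. For a bounded self-adjoint \<open>a\<close> the inequality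
  \<open>\<parallel>a x\<parallel>\<^sup>2 \<le> \<langle>a x, x\<rangle>\<close> says \<open>a\<^sup>2 \<le> a\<close>, which is the same as \<open>0 \<le> a \<le> 1\<close>. In this form it
  passes to limits and to \<open>1 - a\<close> without any spectral theory, and an everywhere defined symmetric
  map is automatically linear.\<close>

definition firm :: "'a hilbert \<Rightarrow> ('a \<Rightarrow> 'a) \<Rightarrow> bool" where
  "firm H a \<longleftrightarrow> (\<forall>x\<in>hcarrier H. a x \<in> hcarrier H)
     \<and> (\<forall>x\<in>hcarrier H. \<forall>y\<in>hcarrier H. hinner H (a x) y = hinner H x (a y))
     \<and> (\<forall>x\<in>hcarrier H. (hnorm H (a x))\<^sup>2 \<le> Re (hinner H (a x) x))"

definition hcompl :: "'a hilbert \<Rightarrow> ('a \<Rightarrow> 'a) \<Rightarrow> 'a \<Rightarrow> 'a" where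
  "hcompl H a x = hminus H x (a x)"

definition hlim_of :: "'a hilbert \<Rightarrow> (nat \<Rightarrow> 'a) \<Rightarrow> 'a" where
  "hlim_of H f = (THE x. hlim H f x)"

text \<open>If \<open>y = (b + y\<^sup>2) / 2\<close> and \<open>b = 1 - a\<close> then \<open>(1 - y)\<^sup>2 = a\<close>. The iteration for this fixed point
  equation starts at \<open>0\<close> and stays among the polynomials in \<open>b\<close>.\<close>

primrec sqrt_iter :: "'a hilbert \<Rightarrow> ('a \<Rightarrow> 'a) \<Rightarrow> nat \<Rightarrow> 'a \<Rightarrow> 'a" where
  "sqrt_iter H b 0 x = hzero H"
| "sqrt_iter H b (Suc n) x = hscale H (1/2) (hadd H (b x) (sqrt_iter H b n (sqrt_iter H b n x)))"

definition hsqrt :: "'a hilbert \<Rightarrow> ('a \<Rightarrow> 'a) \<Rightarrow> 'a \<Rightarrow> 'a" where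
  "hsqrt H a = hcompl H (\<lambda>x. hlim_of H (\<lambda>n. sqrt_iter H (hcompl H a) n x))"

primrec neumann_sum :: "'a hilbert \<Rightarrow> ('a \<Rightarrow> 'a) \<Rightarrow> nat \<Rightarrow> 'a \<Rightarrow> 'a" where
  "neumann_sum H q 0 x = hzero H"
| "neumann_sum H q (Suc n) x = hadd H x (q (neumann_sum H q n x))"

text \<open>The projection onto the fixed vectors of a positive contraction.\<close>

definition fixed_proj :: "'a hilbert \<Rightarrow> ('a \<Rightarrow> 'a) \<Rightarrow> 'a \<Rightarrow> 'a" where
  "fixed_proj H q x = hlim_of H (\<lambda>n. (q ^^ n) x)"

text \<open>For \<open>|B| = C\<close> this is the polar part of \<open>B\<close>: formally, the sums \<open>1 + q + \<dots> + q\<^sup>n\<^sup>-\<^sup>1\<close> with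
  \<open>q = 1 - C\<close> converge to \<open>C\<inverse>\<close> on the range of \<open>C\<close>.\<close>

definition bounded_polar :: "'a hilbert \<Rightarrow> ('a \<Rightarrow> 'a) \<Rightarrow> ('a \<Rightarrow> 'a) \<Rightarrow> 'a \<Rightarrow> 'a" where
  "bounded_polar H B C x = hlim_of H (\<lambda>n. B (neumann_sum H (hcompl H C) n x))"

text \<open>The scalar iteration for \<open>b = 1\<close>. It majorises the operator iteration, and its
  convergence makes the operator iteration converge in norm.\<close>

primrec sqrt_bound :: "nat \<Rightarrow> real" where
  "sqrt_bound 0 = 0"
| "sqrt_bound (Suc n) = (1 + (sqrt_bound n)\<^sup>2) / 2"

lemma sqrt_bound_range: "0 \<le> sqrt_bound n \<and> sqrt_bound n \<le> 1"
proof (induction n)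
  case (Suc n)
  then have "(sqrt_bound n)\<^sup>2 \<le> 1" by (simp add: power_le_one)
  then show ?case by (simp del: One_nat_def)
qed simp

lemma incseq_sqrt_bound: "incseq sqrt_bound"
proof (rule incseq_SucI)
  fix n
  have "0 \<le> (1 - sqrt_bound n)\<^sup>2" by simp
  then show "sqrt_bound n \<le> sqrt_bound (Suc n)" by (simp add: power2_diff)
qed

lemma sqrt_bound_lim: "\<exists>L. sqrt_bound \<longlonglongrightarrow> L \<and> (\<forall>n. sqrt_bound n \<le> L)"
  using incseq_convergent[OF incseq_sqrt_bound] sqrt_bound_range by metis

context inner_space
begin

lemma hlim_of_eqI: "hlim H f x \<Longrightarrow> hlim_of H f = x"
  unfolding hlim_of_def by (intro the_equality) (auto intro: hlim_unique)

lemma bopD: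
  assumes "bop H c"
  shows "x \<in> \<H> \<Longrightarrow> c x \<in> \<H>" "x \<in> \<H> \<Longrightarrow> y \<in> \<H> \<Longrightarrow> c (x \<oplus> y) = c x \<oplus> c y"
    "x \<in> \<H> \<Longrightarrow> c (k \<odot> x) = k \<odot> c x" "x \<in> \<H> \<Longrightarrow> y \<in> \<H> \<Longrightarrow> c (x \<ominus> y) = c x \<ominus> c y"
    "c \<zero> = \<zero>"
proof -
  show 1: "x \<in> \<H> \<Longrightarrow> c x \<in> \<H>" "x \<in> \<H> \<Longrightarrow> y \<in> \<H> \<Longrightarrow> c (x \<oplus> y) = c x \<oplus> c y"
    "x \<in> \<H> \<Longrightarrow> c (k \<odot> x) = k \<odot> c x" for x y k
    using assms by (auto simp: bop_def)
  show 2: "x \<in> \<H> \<Longrightarrow> y \<in> \<H> \<Longrightarrow> c (x \<ominus> y) = c x \<ominus> c y" for x y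
    by (simp add: hminus_def 1)
  show "c \<zero> = \<zero>" using 2[of "\<zero>" "\<zero>"] 1(1)[of "\<zero>"] by simp
qed

lemma bop_boundE:
  assumes "bop H c" obtains K where "\<And>x. x \<in> \<H> \<Longrightarrow> nm (c x) \<le> K * nm x"
  using assms unfolding bop_def by blast

lemma bop_hlim:
  assumes c: "bop H c" and f: "hlim H f x"
  shows "hlim H (\<lambda>n. c (f n)) (c x)"
proof -
  obtain K where K: "\<And>x. x \<in> \<H> \<Longrightarrow> nm (c x) \<le> K * nm x" using bop_boundE[OF c] by blast
  show ?thesis
  proof (rule hlim_lipschitz[OF f, where K = K])
    show "nm (c u \<ominus> c v) \<le> K * nm (u \<ominus> v)" if "u \<in> \<H>" "v \<in> \<H>" for u v
      using K[of "u \<ominus> v"] that by (simp add: bopD(4)[OF c])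
  qed (rule bopD[OF c])
qed

lemma bop_comp:
  assumes "bop H b" "bop H c" shows "bop H (\<lambda>x. b (c x))"
proof -
  obtain K where K: "\<And>x. x \<in> \<H> \<Longrightarrow> nm (b x) \<le> K * nm x" using bop_boundE[OF assms(1)] by blast
  obtain L where L: "\<And>x. x \<in> \<H> \<Longrightarrow> nm (c x) \<le> L * nm x" using bop_boundE[OF assms(2)] by blast
  have "nm (b (c x)) \<le> (\<bar>K\<bar> * L) * nm x" if x: "x \<in> \<H>" for x
  proof -
    have "nm (b (c x)) \<le> K * nm (c x)" using x bopD(1)[OF assms(2)] by (intro K) auto
    also have "\<dots> \<le> \<bar>K\<bar> * nm (c x)" using x bopD(1)[OF assms(2)] by (intro mult_right_mono) auto
    also have "\<dots> \<le> \<bar>K\<bar> * (L * nm x)" using L[OF x] by (intro mult_left_mono) auto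
    finally show ?thesis by (simp add: mult.assoc)
  qed
  then show ?thesis unfolding bop_def using bopD[OF assms(1)] bopD[OF assms(2)] by auto
qed

lemma firmD:
  assumes "firm H a"
  shows "x \<in> \<H> \<Longrightarrow> a x \<in> \<H>" "x \<in> \<H> \<Longrightarrow> y \<in> \<H> \<Longrightarrow> \<langle>a x, y\<rangle> = \<langle>x, a y\<rangle>"
    "x \<in> \<H> \<Longrightarrow> (nm (a x))\<^sup>2 \<le> Re \<langle>a x, x\<rangle>"
  using assms by (auto simp: firm_def)

lemma firm_contraction:
  assumes "firm H a" "x \<in> \<H>" shows "nm (a x) \<le> nm x"
proof (cases "nm (a x) = 0")
  case False
  have m: "a x \<in> \<H>" using firmD assms by blast
  have "(nm (a x))\<^sup>2 \<le> nm (a x) * nm x"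
    using firmD(3)[OF assms] cauchy_schwarz[OF m assms(2)] complex_Re_le_cmod[of "\<langle>a x, x\<rangle>"] by linarith
  moreover have "0 < nm (a x)" using False norm_nonneg[OF m] by linarith
  ultimately show ?thesis by (simp add: power2_eq_square)
qed (use assms in simp)

lemma firm_nonneg: "firm H a \<Longrightarrow> x \<in> \<H> \<Longrightarrow> 0 \<le> Re \<langle>a x, x\<rangle>"
  using firmD(3)[of a x] zero_le_power2[of "nm (a x)"] by linarith

lemma firm_le_one: "firm H a \<Longrightarrow> x \<in> \<H> \<Longrightarrow> Re \<langle>a x, x\<rangle> \<le> (nm x)\<^sup>2"
proof -
  assume a: "firm H a" and x: "x \<in> \<H>"
  have "Re \<langle>a x, x\<rangle> \<le> nm (a x) * nm x"
    using cauchy_schwarz[OF firmD(1)[OF a x] x] complex_Re_le_cmod[of "\<langle>a x, x\<rangle>"] by linarith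
  also have "\<dots> \<le> nm x * nm x" using firm_contraction[OF a x] x by (intro mult_right_mono) auto
  finally show ?thesis by (simp add: power2_eq_square)
qed

lemma firm_null: "firm H a \<Longrightarrow> x \<in> \<H> \<Longrightarrow> Re \<langle>a x, x\<rangle> = 0 \<Longrightarrow> a x = \<zero>"
  using firmD[of a x] by (metis norm_eq_zero power2_less_0 less_eq_real_def zero_eq_power2)

lemma firm_bop: 
  assumes a: "firm H a" shows "bop H a"
proof -
  note D = firmD(1,2)[OF a]
  have "a (x \<oplus> y) = a x \<oplus> a y" if "x \<in> \<H>" "y \<in> \<H>" for x y
    by (rule vec_eqI) (simp_all add: that D inner_add_left)
  moreover have "a (k \<odot> x) = k \<odot> a x" if "x \<in> \<H>" for k x
    by (rule vec_eqI) (simp_all add: that D inner_scale_left)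
  moreover have "\<exists>K. \<forall>x\<in>\<H>. nm (a x) \<le> K * nm x"
    using firm_contraction[OF a] by (intro exI[of _ 1]) auto
  ultimately show ?thesis using D(1) by (simp add: bop_def)
qed

lemma firm_compl:
  assumes a: "firm H a" shows "firm H (hcompl H a)"
proof -
  note D = firmD[OF a]
  have "(nm (x \<ominus> a x))\<^sup>2 \<le> Re \<langle>x \<ominus> a x, x\<rangle>" if x: "x \<in> \<H>" for x
    using D(3)[OF x] x D(1) by (simp add: norm_minus_sq inner_simps norm_sq[symmetric] Re_inner_commute[of "a x" x])
  then show ?thesis using D(1) by (simp add: firm_def hcompl_def inner_simps D(2))
qed

lemma firm_limit:
  assumes f: "\<And>n. firm H (f n)" and l: "\<And>x. x \<in> \<H> \<Longrightarrow> hlim H (\<lambda>n. f n x) (g x)"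
  shows "firm H g"
proof -
  note D = firmD[OF f]
  have m: "g x \<in> \<H>" if "x \<in> \<H>" for x using l[OF that] hlim_in by blast
  have "\<langle>g x, y\<rangle> = \<langle>x, g y\<rangle>" if x: "x \<in> \<H>" and y: "y \<in> \<H>" for x y
  proof (rule LIMSEQ_unique)
    show "(\<lambda>n. \<langle>f n x, y\<rangle>) \<longlonglongrightarrow> \<langle>g x, y\<rangle>" using y by (intro hlim_inner l x) simp
    show "(\<lambda>n. \<langle>f n x, y\<rangle>) \<longlonglongrightarrow> \<langle>x, g y\<rangle>" using x y by (subst D(2)) (auto intro!: hlim_inner l)
  qed
  moreover have "(nm (g x))\<^sup>2 \<le> Re \<langle>g x, x\<rangle>" if x: "x \<in> \<H>" for x
  proof (rule LIMSEQ_le)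
    show "(\<lambda>n. (nm (f n x))\<^sup>2) \<longlonglongrightarrow> (nm (g x))\<^sup>2" by (intro tendsto_intros hlim_norm l x)
    show "(\<lambda>n. Re \<langle>f n x, x\<rangle>) \<longlonglongrightarrow> Re \<langle>g x, x\<rangle>" using x by (intro tendsto_intros hlim_inner l) auto
  qed (use D x in auto)
  ultimately show ?thesis using m by (simp add: firm_def)
qed

lemma firm_zero: "firm H (\<lambda>x. \<zero>)"
  by (simp add: firm_def)

text \<open>By the parallelogram law an average of positive contractions is one, and for a positive contraction
  \<open>y\<close> so is \<open>y\<^sup>2\<close>.\<close>

lemma firm_sqrt_iter: "firm H b \<Longrightarrow> firm H (sqrt_iter H b n)"
proof (induction n)
  case 0
  then show ?case using firm_zero by (simp add: firm_def)
next
  case (Suc n)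
  let ?y = "sqrt_iter H b n"
  have y: "firm H ?y" and b: "firm H b" using Suc by auto
  note Y = firmD[OF y] and B = firmD[OF b]
  have "(nm ((1/2) \<odot> (b x \<oplus> ?y (?y x))))\<^sup>2 \<le> Re \<langle>(1/2) \<odot> (b x \<oplus> ?y (?y x)), x\<rangle>" if x: "x \<in> \<H>" for x
  proof -
    define u v where "u = b x" and "v = ?y (?y x)"
    have m: "u \<in> \<H>" "v \<in> \<H>" using x B Y by (auto simp: u_def v_def)
    have "(nm u)\<^sup>2 \<le> Re \<langle>u, x\<rangle>" using B(3)[OF x] by (simp add: u_def)
    moreover have "(nm v)\<^sup>2 \<le> Re \<langle>v, x\<rangle>"
    proof -
      have "(nm v)\<^sup>2 \<le> (nm (?y x))\<^sup>2"
        unfolding v_def using firm_contraction[OF y Y(1)[OF x]] Y(1) x by (intro power_mono) auto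
      also have "\<dots> = Re \<langle>v, x\<rangle>" using x Y(1) by (simp add: norm_sq v_def Y(2))
      finally show ?thesis .
    qed
    moreover have "(nm (u \<oplus> v))\<^sup>2 + (nm (u \<ominus> v))\<^sup>2 = 2 * (nm u)\<^sup>2 + 2 * (nm v)\<^sup>2"
      using m by (simp add: norm_add_sq norm_minus_sq)
    moreover have "0 \<le> (nm (u \<ominus> v))\<^sup>2" by simp
    ultimately have "(nm (u \<oplus> v))\<^sup>2 / 4 \<le> (Re \<langle>u, x\<rangle> + Re \<langle>v, x\<rangle>) / 2" by argo
    then show ?thesis using m x unfolding u_def[symmetric] v_def[symmetric]
      by (simp add: norm_scale inner_simps power_mult_distrib power_divide norm_divide)
  qed
  then show ?case using B(1) Y(1) by (simp add: firm_def inner_simps Y(2) B(2))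
qed

lemma sqrt_iter_commute:
  assumes c: "bop H c" and b: "firm H b" and cb: "\<And>x. x \<in> \<H> \<Longrightarrow> c (b x) = b (c x)" and x: "x \<in> \<H>"
  shows "c (sqrt_iter H b n x) = sqrt_iter H b n (c x)"
  using x
proof (induction n arbitrary: x)
  case (Suc n)
  have m: "sqrt_iter H b n x \<in> \<H>" if "x \<in> \<H>" for x using firmD(1)[OF firm_sqrt_iter[OF b]] that by blast
  show ?case
    using Suc m bopD(1)[OF c] firmD(1)[OF b] by (simp add: bopD(2,3)[OF c] cb)
qed (simp add: bopD[OF c])

lemma sqrt_iter_bound:
  assumes b: "firm H b" and x: "x \<in> \<H>"
  shows "nm (sqrt_iter H b n x) \<le> sqrt_bound n * nm x"
  using x
proof (induction n arbitrary: x)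
  case (Suc n)
  let ?y = "sqrt_iter H b n"
  have m: "?y x \<in> \<H>" if "x \<in> \<H>" for x using firmD(1)[OF firm_sqrt_iter[OF b]] that by blast
  have mb: "b x \<in> \<H>" using firmD(1)[OF b] Suc by blast
  have "nm (?y (?y x)) \<le> sqrt_bound n * nm (?y x)" using Suc m by blast
  also have "\<dots> \<le> sqrt_bound n * (sqrt_bound n * nm x)"
    using Suc sqrt_bound_range by (intro mult_left_mono) auto
  finally have 1: "nm (?y (?y x)) \<le> (sqrt_bound n)\<^sup>2 * nm x" by (simp add: power2_eq_square mult.assoc)
  have "nm (b x \<oplus> ?y (?y x)) \<le> nm (b x) + nm (?y (?y x))"
    using m mb Suc by (intro norm_triangle) auto
  also have "\<dots> \<le> nm x + (sqrt_bound n)\<^sup>2 * nm x"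
    using 1 firm_contraction[OF b Suc.prems] by simp
  finally show ?case using m mb Suc by (simp add: norm_scale norm_divide algebra_simps)
qed simp

text \<open>Since the iterates commute, \<open>y\<^sub>n\<^sub>+\<^sub>2 - y\<^sub>n\<^sub>+\<^sub>1 = (y\<^sub>n\<^sub>+\<^sub>1 + y\<^sub>n) (y\<^sub>n\<^sub>+\<^sub>1 - y\<^sub>n) / 2\<close>, and the scalar
  iteration satisfies the same identity; so the bound on one step gives the bound on the next.\<close>

lemma sqrt_iter_step:
  assumes b: "firm H b" and x: "x \<in> \<H>"
  shows "nm (sqrt_iter H b (Suc n) x \<ominus> sqrt_iter H b n x) \<le> (sqrt_bound (Suc n) - sqrt_bound n) * nm x"
  using x
proof (induction n arbitrary: x)
  case 0
  then show ?case using firm_contraction[OF b 0] firmD(1)[OF b 0]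
    by (simp add: norm_scale norm_divide)
next
  case (Suc n)
  let ?y = "sqrt_iter H b n" and ?z = "sqrt_iter H b (Suc n)"
  note x = Suc.prems
  have fy: "firm H ?y" and fz: "firm H ?z" using firm_sqrt_iter[OF b] by blast+
  have m: "\<And>x. x \<in> \<H> \<Longrightarrow> ?y x \<in> \<H>" "\<And>x. x \<in> \<H> \<Longrightarrow> ?z x \<in> \<H>" "\<And>x. x \<in> \<H> \<Longrightarrow> b x \<in> \<H>"
    using firmD(1) fy fz b by blast+
  have yb: "\<And>x. x \<in> \<H> \<Longrightarrow> ?z (b x) = b (?z x)"
    using sqrt_iter_commute[OF firm_bop[OF b] b] by metis
  have yz: "\<And>x. x \<in> \<H> \<Longrightarrow> ?z (?y x) = ?y (?z x)"
    using sqrt_iter_commute[OF firm_bop[OF fz] b yb] by blast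
  define d where "d = ?z x \<ominus> ?y x"
  have md: "d \<in> \<H>" using m x by (simp add: d_def)
  have "?z d = ?z (?z x) \<ominus> ?z (?y x)" "?y d = ?y (?z x) \<ominus> ?y (?y x)"
    unfolding d_def by (intro bopD(4) firm_bop fz fy m x)+
  then have "sqrt_iter H b (Suc (Suc n)) x \<ominus> ?z x = (1/2) \<odot> (?z d \<oplus> ?y d)"
    using m x yz[OF x]
    by (intro vec_eqI) (simp_all add: sqrt_iter.simps(2)[of H b "Suc n"] inner_simps algebra_simps
        sqrt_iter.simps(2)[of H b n x] del: sqrt_iter.simps)
  then have "nm (sqrt_iter H b (Suc (Suc n)) x \<ominus> ?z x) = nm (?z d \<oplus> ?y d) / 2"
    using m md by (simp add: norm_scale norm_divide del: sqrt_iter.simps)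
  also have "\<dots> \<le> (nm (?z d) + nm (?y d)) / 2"
    using m md by (intro divide_right_mono norm_triangle) (auto simp del: sqrt_iter.simps)
  also have "\<dots> \<le> (sqrt_bound (Suc n) * nm d + sqrt_bound n * nm d) / 2"
    by (intro divide_right_mono add_mono sqrt_iter_bound[OF b md]) auto
  also have "\<dots> = (sqrt_bound (Suc n) + sqrt_bound n) / 2 * nm d" by (simp add: algebra_simps del: sqrt_bound.simps)
  also have "\<dots> \<le> (sqrt_bound (Suc n) + sqrt_bound n) / 2 * ((sqrt_bound (Suc n) - sqrt_bound n) * nm x)"
    using Suc.IH[OF x] sqrt_bound_range[of n] sqrt_bound_range[of "Suc n"] unfolding d_def
    by (intro mult_left_mono) (auto simp del: sqrt_iter.simps sqrt_bound.simps)
  also have "\<dots> = (sqrt_bound (Suc (Suc n)) - sqrt_bound (Suc n)) * nm x"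
    by (simp add: sqrt_bound.simps(2)[of "Suc n"] sqrt_bound.simps(2)[of n] power2_eq_square field_simps
        del: sqrt_bound.simps) 
  finally show ?case .
qed

lemma sqrt_iter_diff:
  assumes b: "firm H b" and x: "x \<in> \<H>"
  shows "nm (sqrt_iter H b (n + k) x \<ominus> sqrt_iter H b n x) \<le> (sqrt_bound (n + k) - sqrt_bound n) * nm x"
proof (induction k)
  case (Suc k)
  have m: "sqrt_iter H b n x \<in> \<H>" for n using firmD(1)[OF firm_sqrt_iter[OF b]] x by blast
  show ?case
    using norm_triangle_minus[OF m[of "Suc (n + k)"] m[of "n + k"] m[of n]] Suc sqrt_iter_step[OF b x, of "n + k"]
    by (simp add: algebra_simps del: sqrt_iter.simps sqrt_bound.simps)
qed (use firmD(1)[OF firm_sqrt_iter[OF b]] x in simp)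

text \<open>Contractivity makes strong limits compatible with composition.\<close>

lemma strong_limit_comp:
  assumes f: "\<And>n. firm H (f n)" and l: "\<And>x. x \<in> \<H> \<Longrightarrow> hlim H (\<lambda>n. f n x) (g x)"
    and u: "hlim H u v"
  shows "hlim H (\<lambda>n. f n (u n)) (g v)"
proof -
  have m: "u n \<in> \<H>" "v \<in> \<H>" "f n w \<in> \<H>" "g w \<in> \<H>" if "w \<in> \<H>" for n w
    using hlim_in[OF u] firmD(1)[OF f] hlim_in(2)[OF l] that by auto
  have v: "v \<in> \<H>" using hlim_in[OF u] by auto
  have "(\<lambda>n. nm (f n (u n) \<ominus> g v)) \<longlonglongrightarrow> 0"
  proof (rule tendsto_0_le[where K = 1])
    show "(\<lambda>n. nm (u n \<ominus> v) + nm (f n v \<ominus> g v)) \<longlonglongrightarrow> 0"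
      using u l[OF v] by (auto simp: hlim_def intro: tendsto_add_zero)
    have "nm (f n (u n) \<ominus> g v) \<le> nm (u n \<ominus> v) + nm (f n v \<ominus> g v)" for n
    proof -
      have "nm (f n (u n) \<ominus> g v) \<le> nm (f n (u n) \<ominus> f n v) + nm (f n v \<ominus> g v)"
        using m v by (intro norm_triangle_minus) auto
      also have "f n (u n) \<ominus> f n v = f n (u n \<ominus> v)" using m v bopD(4)[OF firm_bop[OF f]] by simp
      also have "nm \<dots> \<le> nm (u n \<ominus> v)" using m v by (intro firm_contraction[OF f]) auto
      finally show ?thesis by simp
    qed
    then show "\<forall>\<^sub>F n in sequentially. norm (nm (f n (u n) \<ominus> g v)) \<le> norm (nm (u n \<ominus> v) + nm (f n v \<ominus> g v)) * 1"
      using m v by (auto intro!: always_eventually)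
  qed
  then show ?thesis using m v by (auto simp: hlim_def)
qed

lemma firm_pow_inner:
  assumes q: "firm H q" and x: "x \<in> \<H>" and y: "y \<in> \<H>"
  shows "\<langle>(q ^^ m) x, (q ^^ n) y\<rangle> = \<langle>(q ^^ (m + n)) x, y\<rangle>"
proof (induction n arbitrary: m)
  case (Suc n)
  have c: "(q ^^ k) u \<in> \<H>" if "u \<in> \<H>" for k u using firmD(1)[OF q] that by (induction k) auto
  have "\<langle>(q ^^ m) x, (q ^^ Suc n) y\<rangle> = \<langle>(q ^^ Suc m) x, (q ^^ n) y\<rangle>"
    using firmD(2)[OF q c[OF x] c[OF y]] by simp
  then show ?case using Suc[of "Suc m"] by simp
qed simp

text \<open>The quadratic forms of the powers of \<open>q\<close> decrease. For even exponents this is \<open>q \<le> 1\<close> and for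
  odd exponents \<open>q\<^sup>2 \<le> q\<close>, applied to a lower power of \<open>q\<close>.\<close>

lemma firm_pow_decreasing:
  assumes q: "firm H q" and x: "x \<in> \<H>"
  shows "Re \<langle>(q ^^ Suc n) x, x\<rangle> \<le> Re \<langle>(q ^^ n) x, x\<rangle>"
proof -
  have c: "(q ^^ k) x \<in> \<H>" for k using firmD(1)[OF q] x by (induction k) auto
  show ?thesis
  proof (cases "even n")
    case True
    then obtain k where n: "n = k + k" by (metis evenE mult_2)
    have "Re \<langle>q ((q ^^ k) x), (q ^^ k) x\<rangle> \<le> (nm ((q ^^ k) x))\<^sup>2" by (rule firm_le_one[OF q c])
    also have "\<dots> = Re \<langle>(q ^^ k) x, (q ^^ k) x\<rangle>" by (rule norm_sq[OF c])
    finally show ?thesis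
      using firm_pow_inner[OF q x x, of "Suc k" k] firm_pow_inner[OF q x x, of k k] by (simp add: n)
  next
    case False
    then obtain k where n: "n = Suc k + k" by (metis oddE mult_2 Suc_eq_plus1 add_Suc)
    have "(nm (q ((q ^^ k) x)))\<^sup>2 \<le> Re \<langle>q ((q ^^ k) x), (q ^^ k) x\<rangle>" by (rule firmD(3)[OF q c])
    moreover have "(nm (q ((q ^^ k) x)))\<^sup>2 = Re \<langle>(q ^^ Suc k) x, (q ^^ Suc k) x\<rangle>"
      using norm_sq[OF c[of "Suc k"]] by simp
    ultimately show ?thesis
      using firm_pow_inner[OF q x x, of "Suc k" "Suc k"] firm_pow_inner[OF q x x, of "Suc k" k] by (simp add: n)
  qed
qed

lemma firm_pow:
  assumes q: "firm H q" shows "firm H (q ^^ n)"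
proof -
  have c: "(q ^^ k) x \<in> \<H>" if "x \<in> \<H>" for k x using firmD(1)[OF q] that by (induction k) auto
  have "(nm ((q ^^ n) x))\<^sup>2 \<le> Re \<langle>(q ^^ n) x, x\<rangle>" if x: "x \<in> \<H>" for x
  proof -
    have "decseq (\<lambda>n. Re \<langle>(q ^^ n) x, x\<rangle>)" by (intro decseq_SucI firm_pow_decreasing q x)
    then have "Re \<langle>(q ^^ (n + n)) x, x\<rangle> \<le> Re \<langle>(q ^^ n) x, x\<rangle>" by (rule decseqD) simp
    then show ?thesis using firm_pow_inner[OF q x x, of n n] norm_sq[OF c[OF x]] by simp
  qed
  moreover have "\<langle>(q ^^ n) x, y\<rangle> = \<langle>x, (q ^^ n) y\<rangle>" if "x \<in> \<H>" "y \<in> \<H>" for x y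
    using firm_pow_inner[OF q that, of 0 n] by simp
  ultimately show ?thesis using c by (simp add: firm_def)
qed

lemma neumann_sum_telescope:
  assumes q: "firm H q" and x: "x \<in> \<H>"
  shows "neumann_sum H q n x \<in> \<H> \<and> hcompl H q (neumann_sum H q n x) = x \<ominus> (q ^^ n) x"
proof (induction n)
  case (Suc n)
  note Q = firmD(1)[OF q] bopD[OF firm_bop[OF q]]
  have c: "(q ^^ k) x \<in> \<H>" for k using Q x by (induction k) auto
  have g: "neumann_sum H q n x \<in> \<H>" using Suc by simp
  have e: "q (neumann_sum H q n x) \<ominus> q (q (neumann_sum H q n x)) = q x \<ominus> q ((q ^^ n) x)"
  proof -
    have "q (hcompl H q (neumann_sum H q n x)) = q (x \<ominus> (q ^^ n) x)" using Suc by simp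
    then show ?thesis using Q x c g by (simp add: hcompl_def)
  qed
  have "hcompl H q (neumann_sum H q (Suc n) x) = x \<ominus> q x \<oplus> (q (neumann_sum H q n x) \<ominus> q (q (neumann_sum H q n x)))"
    using Q x g by (intro vec_eqI) (simp_all add: hcompl_def inner_simps)
  also have "\<dots> = x \<ominus> (q ^^ Suc n) x"
    unfolding e using Q x g c by (intro vec_eqI) (simp_all add: inner_simps)
  finally show ?case using Q x g by simp
qed (use x firmD[OF q] bopD[OF firm_bop[OF q]] in \<open>simp add: hcompl_def\<close>)

lemma bop_neumann_sum: assumes q: "firm H q" shows "bop H (neumann_sum H q n)"
proof (induction n)
  case 0 then show ?case by (auto simp: bop_def intro!: exI[of _ 0])
next
  case (Suc n)
  note Q = firmD(1)[OF q] bopD[OF firm_bop[OF q]] and G = bopD[OF Suc]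
  obtain K where K: "\<And>x. x \<in> \<H> \<Longrightarrow> nm (neumann_sum H q n x) \<le> K * nm x" using bop_boundE[OF Suc] by blast
  have "nm (x \<oplus> q (neumann_sum H q n x)) \<le> (1 + K) * nm x" if x: "x \<in> \<H>" for x
  proof -
    have "nm (x \<oplus> q (neumann_sum H q n x)) \<le> nm x + nm (q (neumann_sum H q n x))"
      using x Q G by (intro norm_triangle) auto
    also have "nm (q (neumann_sum H q n x)) \<le> nm (neumann_sum H q n x)" using firm_contraction[OF q] G x by blast
    finally show ?thesis using K[OF x] by (simp add: algebra_simps)
  qed
  moreover have "neumann_sum H q (Suc n) (x \<oplus> y) = neumann_sum H q (Suc n) x \<oplus> neumann_sum H q (Suc n) y" if "x \<in> \<H>" "y \<in> \<H>" for x y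
    using that Q G by (intro vec_eqI) (simp_all add: inner_simps algebra_simps)
  moreover have "neumann_sum H q (Suc n) (k \<odot> x) = k \<odot> neumann_sum H q (Suc n) x" if "x \<in> \<H>" for x k
    using that Q G by (intro vec_eqI) (simp_all add: inner_simps algebra_simps)
  ultimately show ?case using Q G unfolding bop_def by auto
qed

lemma commute_neumann_sum:
  assumes q: "firm H q" and c: "bop H c" and cq: "\<And>x. x \<in> \<H> \<Longrightarrow> c (q x) = q (c x)" and x: "x \<in> \<H>"
  shows "c (neumann_sum H q n x) = neumann_sum H q n (c x)"
  using bopD[OF c] bopD(1)[OF bop_neumann_sum[OF q]] firmD(1)[OF q] x cq by (induction n) auto

end

context hilbert_space
begin

lemma sqrt_iter_lim:
  assumes b: "firm H b" and x: "x \<in> \<H>"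
  shows "hlim H (\<lambda>n. sqrt_iter H b n x) (hlim_of H (\<lambda>n. sqrt_iter H b n x))"
proof -
  have m: "sqrt_iter H b n x \<in> \<H>" for n using firmD(1)[OF firm_sqrt_iter[OF b]] x by blast
  obtain L where L: "sqrt_bound \<longlonglongrightarrow> L" "\<And>n. sqrt_bound n \<le> L" using sqrt_bound_lim by blast
  have "hcauchy (\<lambda>n. sqrt_iter H b n x)"
  proof (rule hcauchyI[where r = "\<lambda>n. (L - sqrt_bound n) * nm x"])
    fix i j
    have le: "nm (sqrt_iter H b i x \<ominus> sqrt_iter H b j x) \<le> (L - sqrt_bound j) * nm x" if ij: "j \<le> i" for i j
    proof -
      obtain k where "i = j + k" using ij le_iff_add by blast
      then have "nm (sqrt_iter H b i x \<ominus> sqrt_iter H b j x) \<le> (sqrt_bound i - sqrt_bound j) * nm x"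
        using sqrt_iter_diff[OF b x, of j k] by simp
      also have "\<dots> \<le> (L - sqrt_bound j) * nm x" using L(2)[of i] x by (intro mult_right_mono) auto
      finally show ?thesis .
    qed
    have nn: "0 \<le> (L - sqrt_bound k) * nm x" for k using L(2)[of k] x by simp
    show "nm (sqrt_iter H b i x \<ominus> sqrt_iter H b j x) \<le> (L - sqrt_bound i) * nm x + (L - sqrt_bound j) * nm x"
      using le[of i j] le[of j i] nn[of i] nn[of j] norm_minus_commute[OF m[of i] m[of j]] by linarith
  next
    have "(\<lambda>n. (L - sqrt_bound n) * nm x) \<longlonglongrightarrow> (L - L) * nm x" by (intro tendsto_intros L)
    then show "(\<lambda>n. (L - sqrt_bound n) * nm x) \<longlonglongrightarrow> 0" by simp
  qed (rule m)
  then show ?thesis using hcauchy_lim hlim_of_eqI by metis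
qed

text \<open>The limit of the iteration solves the fixed point equation of \<^const>\<open>sqrt_iter\<close>. It inherits from
  the iterates that it is a positive contraction and that it commutes with everything that
  commutes with \<open>a\<close>.\<close>

theorem hsqrt:
  assumes a: "firm H a"
  shows firm_hsqrt: "firm H (hsqrt H a)"
    and hsqrt_square: "x \<in> \<H> \<Longrightarrow> hsqrt H a (hsqrt H a x) = a x"
    and hsqrt_commute: "bop H c \<Longrightarrow> (\<And>x. x \<in> \<H> \<Longrightarrow> c (a x) = a (c x)) \<Longrightarrow> x \<in> \<H> \<Longrightarrow>
        c (hsqrt H a x) = hsqrt H a (c x)"
proof -
  let ?b = "hcompl H a"
  let ?y = "\<lambda>x. hlim_of H (\<lambda>n. sqrt_iter H ?b n x)"
  have b: "firm H ?b" by (rule firm_compl[OF a])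
  note l = sqrt_iter_lim[OF b]
  have y: "firm H ?y" by (rule firm_limit[OF firm_sqrt_iter[OF b] l])
  show "firm H (hsqrt H a)" unfolding hsqrt_def by (rule firm_compl[OF y])
  note Y = firmD(1)[OF y] and A = firmD(1)[OF a]
  show "hsqrt H a (hsqrt H a x) = a x" if x: "x \<in> \<H>" for x
  proof -
    have "hlim H (\<lambda>n. sqrt_iter H ?b (Suc n) x) ((1/2) \<odot> (?b x \<oplus> ?y (?y x)))"
      unfolding sqrt_iter.simps
      by (intro hlim_scale hlim_add strong_limit_comp[OF firm_sqrt_iter[OF b] l] l x)
        (use firmD(1)[OF b] x in simp_all)
    moreover have "hlim H (\<lambda>n. sqrt_iter H ?b (Suc n) x) (?y x)"
      using l[OF x] unfolding hlim_def by (auto intro: LIMSEQ_Suc simp del: sqrt_iter.simps)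
    ultimately have e: "?y x = (1/2) \<odot> (?b x \<oplus> ?y (?y x))" by (rule hlim_unique[symmetric])
    have "?y (x \<ominus> ?y x) = ?y x \<ominus> ?y (?y x)" using bopD(4)[OF firm_bop[OF y]] x Y by blast
    then have "hsqrt H a (hsqrt H a x) = (x \<ominus> ?y x) \<ominus> (?y x \<ominus> ?y (?y x))"
      by (simp add: hsqrt_def hcompl_def)
    also have "\<dots> = a x"
    proof (rule vec_eqI)
      fix z assume z: "z \<in> \<H>"
      have "\<langle>?y x, z\<rangle> = \<langle>(1/2) \<odot> (?b x \<oplus> ?y (?y x)), z\<rangle>" by (simp only: e[symmetric])
      then have "2 * \<langle>?y x, z\<rangle> = \<langle>x, z\<rangle> - \<langle>a x, z\<rangle> + \<langle>?y (?y x), z\<rangle>"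
        using x z Y A by (simp add: hcompl_def inner_simps mult.commute)
      then show "\<langle>(x \<ominus> ?y x) \<ominus> (?y x \<ominus> ?y (?y x)), z\<rangle> = \<langle>a x, z\<rangle>"
        using x z Y A by (simp add: inner_simps)
    qed (use x Y A in auto)
    finally show ?thesis .
  qed
  show "c (hsqrt H a x) = hsqrt H a (c x)" if c: "bop H c" and ca: "\<And>x. x \<in> \<H> \<Longrightarrow> c (a x) = a (c x)" and x: "x \<in> \<H>"
  proof -
    have cb: "c (?b x) = ?b (c x)" if "x \<in> \<H>" for x
      using that A by (simp add: hcompl_def bopD[OF c] ca)
    have "hlim H (\<lambda>n. c (sqrt_iter H ?b n x)) (c (?y x))" by (rule bop_hlim[OF c l[OF x]])
    then have "hlim H (\<lambda>n. sqrt_iter H ?b n (c x)) (c (?y x))"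
      using sqrt_iter_commute[OF c b cb x] by simp
    then have "?y (c x) = c (?y x)" by (rule hlim_of_eqI)
    then show ?thesis using x Y by (simp add: hsqrt_def hcompl_def bopD[OF c])
  qed
qed

text \<open>With \<open>s\<^sup>2 = a\<close> and commuting factors, \<open>a b = s b s\<close>, whose form is that of \<open>b\<close> at \<open>s x\<close>.\<close>

lemma firm_mult:
  assumes a: "firm H a" and b: "firm H b" and ab: "\<And>x. x \<in> \<H> \<Longrightarrow> a (b x) = b (a x)"
  shows "firm H (\<lambda>x. a (b x))"
proof -
  let ?s = "hsqrt H a"
  note A = firmD[OF a] and B = firmD[OF b] and S = firmD[OF firm_hsqrt[OF a]]
  have "(nm (a (b x)))\<^sup>2 \<le> Re \<langle>a (b x), x\<rangle>" if x: "x \<in> \<H>" for x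
  proof -
    have e: "a (b x) = ?s (b (?s x))"
      using hsqrt_square[OF a B(1)[OF x]] hsqrt_commute[OF a firm_bop[OF b] ab[symmetric] x] by simp
    have "(nm (a (b x)))\<^sup>2 \<le> (nm (b (?s x)))\<^sup>2"
      unfolding e using S B x by (intro power_mono firm_contraction[OF firm_hsqrt[OF a]]) auto
    also have "\<dots> \<le> Re \<langle>b (?s x), ?s x\<rangle>" using S x by (intro B) auto
    also have "\<dots> = Re \<langle>a (b x), x\<rangle>" unfolding e using S B x by simp
    finally show ?thesis .
  qed
  then show ?thesis using A(1) B(1) ab by (simp add: firm_def A(2) B(2))
qed

text \<open>For \<open>y = a x - b x\<close> one has \<open>(a + b) y = 0\<close>, so both positive forms vanish at \<open>y\<close> and
  \<open>a y = b y = 0\<close>. Therefore \<open>\<langle>y, y\<rangle> = \<langle>x, a y - b y\<rangle> = 0\<close>.\<close>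

lemma square_root_unique:
  assumes a: "firm H a" and b: "firm H b" and ab: "\<And>x. x \<in> \<H> \<Longrightarrow> a (b x) = b (a x)"
    and sq: "\<And>x. x \<in> \<H> \<Longrightarrow> a (a x) = b (b x)" and x: "x \<in> \<H>"
  shows "a x = b x"
proof -
  note A = firmD(1,2)[OF a] bopD(4)[OF firm_bop[OF a]] and B = firmD(1,2)[OF b] bopD(4)[OF firm_bop[OF b]]
  define y where "y = a x \<ominus> b x"
  have y: "y \<in> \<H>" using A B x by (simp add: y_def)
  have "a y \<oplus> b y = \<zero>"
    unfolding y_def using A B x ab[OF x] sq[OF x] by (intro vec_eqI) (simp_all add: inner_simps)
  then have "\<langle>a y, y\<rangle> + \<langle>b y, y\<rangle> = 0" using y A B by (metis inner_add_left inner_zero_left)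
  then have "Re \<langle>a y, y\<rangle> + Re \<langle>b y, y\<rangle> = 0" by (metis plus_complex.sel(1) zero_complex.sel(1))
  then have "a y = \<zero>" "b y = \<zero>"
    using firm_nonneg[OF a y] firm_nonneg[OF b y] firm_null[OF a y] firm_null[OF b y] by auto
  then have "\<langle>y, y\<rangle> = 0"
    using A B x y unfolding y_def by (metis (no_types) A(2) B(2) cancel_comm_monoid_add_class.diff_cancel inner_minus_left inner_zero_right)
  then have "y = \<zero>" using inner_definite y by blast
  then show ?thesis using A B x by (simp add: y_def)
qed

text \<open>The powers converge strongly because
  \<open>\<parallel>q\<^sup>i x - q\<^sup>j x\<parallel>\<^sup>2 = t\<^sub>2\<^sub>i + t\<^sub>2\<^sub>j - 2 t\<^sub>i\<^sub>+\<^sub>j\<close>, where \<open>t\<^sub>n = \<langle>q\<^sup>n x, x\<rangle>\<close> is decreasing and bounded below.\<close>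

theorem fixed_proj:
  assumes q: "firm H q"
  shows fixed_proj_lim: "x \<in> \<H> \<Longrightarrow> hlim H (\<lambda>n. (q ^^ n) x) (fixed_proj H q x)"
    and firm_fixed_proj: "firm H (fixed_proj H q)"
    and fixed_proj_fixed: "x \<in> \<H> \<Longrightarrow> q (fixed_proj H q x) = fixed_proj H q x"
    and fixed_proj_of_fixed: "x \<in> \<H> \<Longrightarrow> q x = x \<Longrightarrow> fixed_proj H q x = x"
proof -
  show l: "hlim H (\<lambda>n. (q ^^ n) x) (fixed_proj H q x)" if x: "x \<in> \<H>" for x
  proof -
    define t where "t n = Re \<langle>(q ^^ n) x, x\<rangle>" for n
    have m: "(q ^^ n) x \<in> \<H>" for n using firmD(1)[OF firm_pow[OF q] x] .
    have antimono: "decseq t" unfolding t_def by (intro decseq_SucI firm_pow_decreasing q x)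
    have nn: "0 \<le> t n" for n unfolding t_def by (rule firm_nonneg[OF firm_pow[OF q] x])
    obtain L where L: "t \<longlonglongrightarrow> L" "\<And>n. L \<le> t n"
      using decseq_convergent[OF antimono, of 0] nn by metis
    have tt: "Re \<langle>(q ^^ i) x, (q ^^ j) x\<rangle> = t (i + j)" for i j
      using firm_pow_inner[OF q x x] by (simp add: t_def)
    have "hcauchy (\<lambda>n. (q ^^ n) x)"
    proof (rule hcauchyI[where r = "\<lambda>n. sqrt (t (n + n) - L)"])
      fix i j
      have tmin: "min (t (i + i)) (t (j + j)) \<le> t (i + j)"
        using decseqD[OF antimono, of "i + j" "i + i"] decseqD[OF antimono, of "i + j" "j + j"]
        by (cases "j \<le> i") (auto simp: min_le_iff_disj)
      have "(nm ((q ^^ i) x \<ominus> (q ^^ j) x))\<^sup>2 = t (i + i) + t (j + j) - 2 * t (i + j)"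
        unfolding norm_minus_sq[OF m m] norm_sq[OF m] tt ..
      also have "\<dots> \<le> (t (i + i) - L) + (t (j + j) - L)"
        using L(2)[of "i+i"] L(2)[of "j + j"] L(2)[of "i + j"] by linarith
      also have "\<dots> \<le> (sqrt (t (i + i) - L) + sqrt (t (j + j) - L))\<^sup>2"
        using L(2) by (simp add: power2_sum)
      finally show "nm ((q ^^ i) x \<ominus> (q ^^ j) x) \<le> sqrt (t (i + i) - L) + sqrt (t (j + j) - L)"
        by (rule power2_le_imp_le) (use L(2) in simp)
    next
      have "(\<lambda>n. t (n + n)) \<longlonglongrightarrow> L"
        using LIMSEQ_subseq_LIMSEQ[OF L(1), of "\<lambda>n. n + n"] by (simp add: strict_mono_def o_def)
      then have "(\<lambda>n. sqrt (t (n + n) - L)) \<longlonglongrightarrow> sqrt (L - L)" by (intro tendsto_intros)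
      then show "(\<lambda>n. sqrt (t (n + n) - L)) \<longlonglongrightarrow> 0" by simp
    qed (rule m)
    then show ?thesis unfolding fixed_proj_def using hcauchy_lim hlim_of_eqI by metis
  qed
  show p: "firm H (fixed_proj H q)" by (rule firm_limit[OF firm_pow[OF q] l])
  show "q (fixed_proj H q x) = fixed_proj H q x" if x: "x \<in> \<H>" for x
  proof (rule hlim_unique)
    show "hlim H (\<lambda>n. (q ^^ Suc n) x) (q (fixed_proj H q x))"
      using bop_hlim[OF firm_bop[OF q] l[OF x]] by simp
    show "hlim H (\<lambda>n. (q ^^ Suc n) x) (fixed_proj H q x)"
      using l[OF x] unfolding hlim_def by (auto intro: LIMSEQ_Suc simp del: funpow.simps)
  qed
  show "fixed_proj H q x = x" if x: "x \<in> \<H>" "q x = x" for x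
  proof -
    have "(q ^^ n) x = x" for n using x(2) by (induction n) auto
    then show ?thesis unfolding fixed_proj_def using x by (intro hlim_of_eqI) simp
  qed
qed

section \<open>Polar decomposition of bounded operators\<close>

text \<open>Here \<open>C\<close> plays the role of \<open>|B|\<close>.\<close>

context
  fixes B C :: "'a \<Rightarrow> 'a"
  assumes B: "bop H B" and C: "firm H C" and BC: "\<And>x. x \<in> \<H> \<Longrightarrow> nm (B x) = nm (C x)"
begin

abbreviation (input) "null_proj \<equiv> fixed_proj H (hcompl H C)"

lemma null_proj_null:
  assumes x: "x \<in> \<H>" shows "C (null_proj x) = \<zero>"
proof -
  have m: "null_proj x \<in> \<H>" using firmD(1)[OF firm_fixed_proj[OF firm_compl[OF C]] x] .
  have "null_proj x \<ominus> C (null_proj x) = null_proj x"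
    using fixed_proj_fixed[OF firm_compl[OF C] x] by (simp add: hcompl_def)
  then have "\<langle>C (null_proj x), z\<rangle> = 0" if "z \<in> \<H>" for z
    using inner_minus_left[OF m firmD(1)[OF C m] that] by simp
  then show ?thesis using firmD(1)[OF C m] by (intro vec_eqI) auto
qed

lemma null_proj_of_null: "x \<in> \<H> \<Longrightarrow> C x = \<zero> \<Longrightarrow> null_proj x = x"
  using fixed_proj_of_fixed[OF firm_compl[OF C]] by (simp add: hcompl_def)

lemma compl_compl: "x \<in> \<H> \<Longrightarrow> hcompl H (hcompl H C) x = C x"
  unfolding hcompl_def using firmD(1)[OF C] by (intro vec_eqI) (simp_all add: inner_simps)

lemma C_neumann_sum: "x \<in> \<H> \<Longrightarrow> C (neumann_sum H (hcompl H C) n x) = x \<ominus> (hcompl H C ^^ n) x"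
  using neumann_sum_telescope[OF firm_compl[OF C]] compl_compl by metis

text \<open>Applied to a difference of two partial sums, \<open>\<parallel>B x\<parallel> = \<parallel>C x\<parallel>\<close> and the telescoping identity turn it
  into a difference of powers of \<open>1 - C\<close>, and these converge.\<close>

lemma bounded_polar_lim:
  assumes x: "x \<in> \<H>"
  shows "hlim H (\<lambda>n. B (neumann_sum H (hcompl H C) n x)) (bounded_polar H B C x)"
proof -
  let ?q = "hcompl H C" let ?g = "neumann_sum H ?q"
  have q: "firm H ?q" by (rule firm_compl[OF C])
  have m: "?g n x \<in> \<H>" for n using bopD(1)[OF bop_neumann_sum[OF q]] x by blast
  have qm: "(?q ^^ n) x \<in> \<H>" for n using firmD(1)[OF firm_pow[OF q] x] .
  have d: "nm (B (?g i x) \<ominus> B (?g j x)) = nm ((?q ^^ i) x \<ominus> (?q ^^ j) x)" for i j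
  proof -
    have "nm (B (?g i x) \<ominus> B (?g j x)) = nm (C (?g i x \<ominus> ?g j x))"
      using BC[of "?g i x \<ominus> ?g j x"] m by (simp add: bopD(4)[OF B])
    also have "C (?g i x \<ominus> ?g j x) = (x \<ominus> (?q ^^ i) x) \<ominus> (x \<ominus> (?q ^^ j) x)"
      using m C_neumann_sum[OF x] by (simp add: bopD(4)[OF firm_bop[OF C]])
    also have "\<dots> = (?q ^^ j) x \<ominus> (?q ^^ i) x"
      using x qm by (intro vec_eqI) (simp_all add: inner_simps)
    finally show ?thesis using norm_minus_commute qm by simp
  qed
  have p: "hlim H (\<lambda>n. (?q ^^ n) x) (null_proj x)" by (rule fixed_proj_lim[OF q x])
  have km: "null_proj x \<in> \<H>" using hlim_in p by blast
  have "hcauchy (\<lambda>n. B (?g n x))"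
  proof (rule hcauchyI)
    show "nm (B (?g i x) \<ominus> B (?g j x)) \<le> nm ((?q ^^ i) x \<ominus> null_proj x) + nm ((?q ^^ j) x \<ominus> null_proj x)" for i j
      unfolding d using norm_triangle_minus[OF qm[of i] km qm[of j]] norm_minus_commute[OF km qm[of j]] by simp
    show "(\<lambda>n. nm ((?q ^^ n) x \<ominus> null_proj x)) \<longlonglongrightarrow> 0" using p by (simp add: hlim_def)
  qed (use m bopD(1)[OF B] in simp)
  then show ?thesis unfolding bounded_polar_def using hcauchy_lim hlim_of_eqI by metis
qed

text \<open>The uniform bound that allows dominated convergence when the approximants are integrated.\<close>

lemma bounded_polar_approx_bound:
  assumes x: "x \<in> \<H>" shows "nm (B (neumann_sum H (hcompl H C) n x)) \<le> nm x"
proof -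
  have "nm (B (neumann_sum H (hcompl H C) n x)) = nm (hcompl H (hcompl H C ^^ n) x)"
    using C_neumann_sum[OF x] BC bopD(1)[OF bop_neumann_sum[OF firm_compl[OF C]] x] by (simp add: hcompl_def)
  also have "\<dots> \<le> nm x" by (intro firm_contraction firm_compl firm_pow C x)
  finally show ?thesis .
qed

lemma bounded_polar_norm:
  assumes x: "x \<in> \<H>" shows "nm (bounded_polar H B C x) = nm (x \<ominus> null_proj x)"
proof (rule LIMSEQ_unique)
  show "(\<lambda>n. nm (B (neumann_sum H (hcompl H C) n x))) \<longlonglongrightarrow> nm (bounded_polar H B C x)"
    by (rule hlim_norm[OF bounded_polar_lim[OF x]])
  have "nm (B (neumann_sum H (hcompl H C) n x)) = nm (x \<ominus> (hcompl H C ^^ n) x)" for n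
    using C_neumann_sum[OF x] BC bopD(1)[OF bop_neumann_sum[OF firm_compl[OF C]] x] by metis
  then show "(\<lambda>n. nm (B (neumann_sum H (hcompl H C) n x))) \<longlonglongrightarrow> nm (x \<ominus> null_proj x)"
    using hlim_norm[OF hlim_minus[OF hlim_const[THEN iffD2, OF x] fixed_proj_lim[OF firm_compl[OF C] x]]] by simp
qed

lemma null_proj_norm:
  assumes x: "x \<in> \<H>" shows "nm (x \<ominus> null_proj x) \<le> nm x"
  using firm_contraction[OF firm_compl[OF firm_fixed_proj[OF firm_compl[OF C]]] x]
  by (simp add: hcompl_def)

lemma bounded_polar_bop: "bop H (bounded_polar H B C)"
proof -
  note l = bounded_polar_lim
  have m: "bounded_polar H B C x \<in> \<H>" if "x \<in> \<H>" for x using l[OF that] hlim_in by blast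
  note G = bopD[OF bop_comp[OF B bop_neumann_sum[OF firm_compl[OF C]]]]
  have "bounded_polar H B C (x \<oplus> y) = bounded_polar H B C x \<oplus> bounded_polar H B C y" if "x \<in> \<H>" "y \<in> \<H>" for x y
    using l[OF add_closed[OF that]] hlim_add[OF l[OF that(1)] l[OF that(2)]] G(2)[OF that] hlim_unique
    by simp
  moreover have "bounded_polar H B C (k \<odot> x) = k \<odot> bounded_polar H B C x" if "x \<in> \<H>" for x k
    using l[OF scale_closed[OF that], of k] hlim_scale[OF l[OF that]] G(3)[OF that] hlim_unique
    by simp
  moreover have "nm (bounded_polar H B C x) \<le> 1 * nm x" if x: "x \<in> \<H>" for x
    using bounded_polar_norm[OF x] null_proj_norm[OF x] by simp
  ultimately show ?thesis using m unfolding bop_def by blast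
qed

lemma bounded_polar_contraction: "x \<in> \<H> \<Longrightarrow> nm (bounded_polar H B C x) \<le> nm x"
  using bounded_polar_norm null_proj_norm by simp

lemma bounded_polar_C:
  assumes x: "x \<in> \<H>" shows "bounded_polar H B C (C x) = B x"
proof (rule hlim_unique)
  let ?q = "hcompl H C"
  have cx: "C x \<in> \<H>" using firmD(1)[OF C x] .
  have p: "null_proj x \<in> \<H>" using firmD(1)[OF firm_fixed_proj[OF firm_compl[OF C]] x] .
  show "hlim H (\<lambda>n. B (neumann_sum H ?q n (C x))) (bounded_polar H B C (C x))" by (rule bounded_polar_lim[OF cx])
  have "C (?q y) = ?q (C y)" if "y \<in> \<H>" for y
    using that firmD(1)[OF C] by (simp add: hcompl_def bopD(4)[OF firm_bop[OF C]])
  then have "C (neumann_sum H ?q n x) = neumann_sum H ?q n (C x)" for n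
    by (intro commute_neumann_sum firm_compl firm_bop C x)
  then have e: "B (neumann_sum H ?q n (C x)) = B (x \<ominus> (?q ^^ n) x)" for n using C_neumann_sum[OF x] by metis
  have "hlim H (\<lambda>n. B (x \<ominus> (?q ^^ n) x)) (B (x \<ominus> null_proj x))"
    by (intro bop_hlim[OF B] hlim_minus fixed_proj_lim firm_compl C x) (use x in simp)
  moreover have "B (null_proj x) = \<zero>"
    using BC[OF p] null_proj_null[OF x] bopD(1)[OF B p] by simp
  ultimately show "hlim H (\<lambda>n. B (neumann_sum H ?q n (C x))) (B x)"
    unfolding e using x p bopD(1,4)[OF B] by simp
qed

lemma bounded_polar_null_iff:
  assumes x: "x \<in> \<H>" shows "bounded_polar H B C x = \<zero> \<longleftrightarrow> C x = \<zero>"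
proof -
  have p: "null_proj x \<in> \<H>" using firmD(1)[OF firm_fixed_proj[OF firm_compl[OF C]] x] .
  have "bounded_polar H B C x = \<zero> \<longleftrightarrow> nm (bounded_polar H B C x) = 0" using bopD(1)[OF bounded_polar_bop x] by simp
  also have "\<dots> \<longleftrightarrow> x = null_proj x" using x p by (simp add: bounded_polar_norm)
  also have "\<dots> \<longleftrightarrow> C x = \<zero>" using null_proj_null[OF x] null_proj_of_null[OF x] by metis
  finally show ?thesis .
qed

end

end

section \<open>The graph projection of a closed operator\<close>

definition graph_of :: "'a hilbert \<Rightarrow> ('a \<Rightarrow> 'a) \<Rightarrow> ('a \<times> 'a) set" where
  "graph_of H f = {(x, f x) | x. x \<in> hcarrier H}"

text \<open>For densely defined closed \<open>T\<close> this is \<open>(1 + T\<^sup>*T)\<inverse>\<close>: the orthogonal decomposition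
  \<open>(x, 0) = (u, T u) + (h, k)\<close> along the graph says \<open>T u = - k\<close> and \<open>h = - T\<^sup>* k\<close>, hence
  \<open>u + T\<^sup>*T u = x\<close>.\<close>

definition resolvent :: "'a hilbert \<Rightarrow> ('a \<times> 'a) set \<Rightarrow> 'a \<Rightarrow> 'a" where
  "resolvent H T x = fst (hproj (hsum H H) T (x, hzero H))"

text \<open>The operator \<open>T (1 + T\<^sup>*T)\<inverse>\<close>.\<close>

definition op_resolvent :: "'a hilbert \<Rightarrow> ('a \<times> 'a) set \<Rightarrow> 'a \<Rightarrow> 'a" where
  "op_resolvent H T x = snd (hproj (hsum H H) T (x, hzero H))"

text \<open>With \<open>R = (1 + T\<^sup>*T)\<inverse>\<close> this is \<open>|T| (1 + T\<^sup>*T)\<inverse>\<close>, written as \<open>R\<^sup>1\<^sup>/\<^sup>2 (1 - R)\<^sup>1\<^sup>/\<^sup>2\<close>.\<close>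

definition abs_resolvent :: "'a hilbert \<Rightarrow> ('a \<Rightarrow> 'a) \<Rightarrow> 'a \<Rightarrow> 'a" where
  "abs_resolvent H R x = hsqrt H R (hsqrt H (hcompl H R) x)"

definition polar_map :: "'a hilbert \<Rightarrow> ('a \<times> 'a) set \<Rightarrow> 'a \<Rightarrow> 'a" where
  "polar_map H T = bounded_polar H (op_resolvent H T) (abs_resolvent H (resolvent H T))"

text \<open>With \<open>R = (1 + T\<^sup>*T)\<inverse>\<close> this is the graph of \<open>T\<^sup>*T\<close>.\<close>

definition square_of :: "'a hilbert \<Rightarrow> ('a \<Rightarrow> 'a) \<Rightarrow> ('a \<times> 'a) set" where
  "square_of H R = {(u, w). u \<in> hcarrier H \<and> w \<in> hcarrier H \<and> R (hadd H u w) = u}"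

text \<open>With \<open>R = (1 + T\<^sup>*T)\<inverse>\<close> this is the graph of \<open>|T|\<close>: formally \<open>|T| = R\<^sup>-\<^sup>1\<^sup>/\<^sup>2 (1 - R)\<^sup>1\<^sup>/\<^sup>2\<close>.\<close>

definition abs_graph :: "'a hilbert \<Rightarrow> ('a \<Rightarrow> 'a) \<Rightarrow> ('a \<times> 'a) set" where
  "abs_graph H R = {(u, v). u \<in> hcarrier H \<and> v \<in> hcarrier H
     \<and> hsqrt H (hcompl H R) u = hsqrt H R v}"

context inner_space
begin

lemma graph_of_iff [simp]: "(x, y) \<in> graph_of H f \<longleftrightarrow> x \<in> \<H> \<and> y = f x"
  by (auto simp: graph_of_def)

lemma linear_opD:
  assumes "linear_op H T"
  shows "(x, y) \<in> T \<Longrightarrow> x \<in> \<H>" "(x, y) \<in> T \<Longrightarrow> y \<in> \<H>"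
    "(x, y) \<in> T \<Longrightarrow> (x', y') \<in> T \<Longrightarrow> (x \<oplus> x', y \<oplus> y') \<in> T"
    "(x, y) \<in> T \<Longrightarrow> (c \<odot> x, c \<odot> y) \<in> T" "(\<zero>, \<zero>) \<in> T"
    "(x, y) \<in> T \<Longrightarrow> (x', y') \<in> T \<Longrightarrow> (x \<ominus> x', y \<ominus> y') \<in> T"
    "(x, y) \<in> T \<Longrightarrow> (x, y') \<in> T \<Longrightarrow> y = y'"
proof -
  have s: "hsubspace (hsum H H) T" and v: "single_valued T" using assms by (auto simp: linear_op_def)
  show "(x, y) \<in> T \<Longrightarrow> x \<in> \<H>" "(x, y) \<in> T \<Longrightarrow> y \<in> \<H>" using s by (auto simp: hsubspace_def)
  show a: "(x, y) \<in> T \<Longrightarrow> (x', y') \<in> T \<Longrightarrow> (x \<oplus> x', y \<oplus> y') \<in> T" for x y x' y'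
    using s unfolding hsubspace_def by (metis hsum_simps(3))
  show c: "(x, y) \<in> T \<Longrightarrow> (c \<odot> x, c \<odot> y) \<in> T" for c x y
    using s unfolding hsubspace_def by (metis hsum_simps(4))
  show "(\<zero>, \<zero>) \<in> T" using s by (simp add: hsubspace_def)
  show "(x, y) \<in> T \<Longrightarrow> (x', y') \<in> T \<Longrightarrow> (x \<ominus> x', y \<ominus> y') \<in> T"
    unfolding hminus_def by (intro a c)
  show "(x, y) \<in> T \<Longrightarrow> (x, y') \<in> T \<Longrightarrow> y = y'" using v by (simp add: single_valued_def)
qed

lemma linear_opI:
  assumes "\<And>x y. (x, y) \<in> T \<Longrightarrow> x \<in> \<H> \<and> y \<in> \<H>" "(\<zero>, \<zero>) \<in> T"
    "\<And>x y x' y'. (x, y) \<in> T \<Longrightarrow> (x', y') \<in> T \<Longrightarrow> (x \<oplus> x', y \<oplus> y') \<in> T"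
    "\<And>c x y. (x, y) \<in> T \<Longrightarrow> (c \<odot> x, c \<odot> y) \<in> T"
    "\<And>x y y'. (x, y) \<in> T \<Longrightarrow> (x, y') \<in> T \<Longrightarrow> y = y'"
  shows "linear_op H T"
  unfolding linear_op_def hsubspace_def single_valued_def using assms by fastforce

lemma bounded_op_graph_of:
  assumes "bop H f" shows "bounded_op H (graph_of H f)"
proof -
  note F = bopD[OF assms]
  have "linear_op H (graph_of H f)" by (rule linear_opI) (auto simp: F)
  moreover obtain K where "\<And>x. x \<in> \<H> \<Longrightarrow> nm (f x) \<le> K * nm x" using bop_boundE[OF assms] by blast
  ultimately show ?thesis by (auto simp: bounded_op_def Domain_iff intro!: exI[of _ K])
qed

lemma bounded_opE:
  assumes V: "bounded_op H V"
  shows "bop H (op_app V)" "V = graph_of H (op_app V)"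
proof -
  have l: "linear_op H V" and d: "Domain V = \<H>" using V by (auto simp: bounded_op_def)
  note L = linear_opD[OF l]
  have app: "op_app V x = y" if "(x, y) \<in> V" for x y
    unfolding op_app_def using that L(7) by (intro the_equality) blast+
  have mem: "(x, op_app V x) \<in> V" if "x \<in> \<H>" for x using that d app by blast
  then show "V = graph_of H (op_app V)" using app L(1) by (auto simp: graph_of_def)
  obtain C where C: "\<forall>(x, y)\<in>V. nm y \<le> C * nm x" using V by (auto simp: bounded_op_def)
  show "bop H (op_app V)"
    unfolding bop_def
  proof (intro conjI ballI allI exI[of _ C])
    fix x assume x: "x \<in> \<H>"
    show "op_app V x \<in> \<H>" using L(2) mem[OF x] by blast
    show "op_app V (k \<odot> x) = k \<odot> op_app V x" for k by (intro app L mem x)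
    show "nm (op_app V x) \<le> C * nm x" using C mem[OF x] by blast
    fix y assume y: "y \<in> \<H>"
    show "op_app V (x \<oplus> y) = op_app V x \<oplus> op_app V y" by (intro app L mem x y)
  qed
qed

lemma op_app_graph_of: "x \<in> \<H> \<Longrightarrow> op_app (graph_of H f) x = f x"
  by (simp add: op_app_def)

lemma densely_defined_orth:
  assumes d: "hdense H A" and A: "A \<subseteq> \<H>" and z: "z \<in> \<H>" and o: "\<And>a. a \<in> A \<Longrightarrow> \<langle>a, z\<rangle> = 0"
  shows "z = \<zero>"
proof -
  obtain f where f: "\<And>n. f n \<in> A" "hlim H f z" using d z hdense_iff[OF A] by blast
  have "(\<lambda>n. \<langle>f n, z\<rangle>) \<longlonglongrightarrow> \<langle>z, z\<rangle>" using f(2) z by (intro hlim_inner) auto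
  then have "\<langle>z, z\<rangle> = 0" using f(1) o LIMSEQ_unique by (metis (no_types, lifting) ext tendsto_const)
  then show ?thesis using inner_definite z by blast
qed

lemma adjoint_opD: "(y, z) \<in> adjoint_op H T \<Longrightarrow> (x, w) \<in> T \<Longrightarrow> \<langle>w, y\<rangle> = \<langle>x, z\<rangle>"
  by (auto simp: adjoint_op_def)

lemma polarization:
  assumes f: "bop H f" and g: "bop H g" and n: "\<And>x. x \<in> \<H> \<Longrightarrow> nm (f x) = nm (g x)"
    and x: "x \<in> \<H>" and y: "y \<in> \<H>"
  shows "\<langle>f x, f y\<rangle> = \<langle>g x, g y\<rangle>"
proof -
  note F = bopD[OF f] and G = bopD[OF g]
  have re: "Re \<langle>f x, f y\<rangle> = Re \<langle>g x, g y\<rangle>" if x: "x \<in> \<H>" for x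
    using n[OF add_closed[OF x y]] n[OF x] n[OF y] norm_add_sq[of "f x" "f y"] norm_add_sq[of "g x" "g y"]
      x y F G by simp
  have "Im \<langle>f x, f y\<rangle> = Im \<langle>g x, g y\<rangle>"
    using re[of "(- \<i>) \<odot> x"] x y F G by (simp add: inner_scale_left)
  then show ?thesis using re[OF x] by (simp add: complex_eq_iff)
qed

lemma limit_of_firm_range:
  assumes a: "firm H a" and x: "hlim H (\<lambda>n. (hcompl H a ^^ n) x) p" and xm: "x \<in> \<H>"
  shows "hlim H (\<lambda>n. a (neumann_sum H (hcompl H a) n x)) (x \<ominus> p)"
proof -
  have "hcompl H (hcompl H a) y = a y" if "y \<in> \<H>" for y
    unfolding hcompl_def using firmD(1)[OF a] that by (intro vec_eqI) (simp_all add: inner_simps)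
  then have "a (neumann_sum H (hcompl H a) n x) = x \<ominus> (hcompl H a ^^ n) x" for n
    using neumann_sum_telescope[OF firm_compl[OF a] xm] by metis
  then show ?thesis using hlim_minus[of "\<lambda>_. x" x, OF _ x] xm by simp
qed

end

context hilbert_space
begin

lemma adjoint_ex:
  assumes f: "bop H f"
  obtains d where "\<And>y. y \<in> \<H> \<Longrightarrow> d y \<in> \<H>" "\<And>x y. x \<in> \<H> \<Longrightarrow> y \<in> \<H> \<Longrightarrow> \<langle>f x, y\<rangle> = \<langle>x, d y\<rangle>"
proof -
  note F = bopD[OF f]
  obtain K where K: "\<And>x. x \<in> \<H> \<Longrightarrow> nm (f x) \<le> K * nm x" using bop_boundE[OF f] by blast
  have "\<exists>z\<in>\<H>. \<forall>x\<in>\<H>. \<langle>f x, y\<rangle> = \<langle>x, z\<rangle>" if y: "y \<in> \<H>" for y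
  proof (rule riesz[of "\<lambda>x. \<langle>f x, y\<rangle>" "K * nm y"])
    fix x assume x: "x \<in> \<H>"
    have "cmod \<langle>f x, y\<rangle> \<le> nm (f x) * nm y" by (rule cauchy_schwarz[OF F(1)[OF x] y])
    also have "\<dots> \<le> (K * nm x) * nm y" using K[OF x] y by (intro mult_right_mono) auto
    finally show "cmod \<langle>f x, y\<rangle> \<le> K * nm y * nm x" by (simp add: algebra_simps)
  qed (use F y in \<open>auto simp: inner_simps\<close>)
  then show thesis using that by metis
qed

lemma firm_range_limit:
  assumes a: "firm H a" and x: "x \<in> \<H>"
  shows "hlim H (\<lambda>n. a (neumann_sum H (hcompl H a) n x)) (x \<ominus> fixed_proj H (hcompl H a) x)"
  by (rule limit_of_firm_range[OF a fixed_proj_lim[OF firm_compl[OF a] x] x])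

lemma firm_fixed_proj_null:
  assumes a: "firm H a" and x: "x \<in> \<H>"
  shows "a (fixed_proj H (hcompl H a) x) = \<zero>"
  by (rule null_proj_null[OF firm_bop[OF a] a refl x])

lemma firm_hproj:
  assumes K: "closed_subspace H K" shows "firm H (hproj H K)"
proof -
  note P = hproj[OF K]
  have m: "\<And>y. y \<in> K \<Longrightarrow> y \<in> \<H>" using K by (auto simp: closed_subspace_def hsubspace_def)
  have o: "\<langle>y, k\<rangle> = \<langle>hproj H K y, k\<rangle>" if y: "y \<in> \<H>" and k: "k \<in> K" for y k
    using orth_complD[OF P(2)[OF y] k] m[OF P(1)[OF y]] m[OF k] y by (simp add: inner_simps)
  have "\<langle>hproj H K x, y\<rangle> = \<langle>x, hproj H K y\<rangle>" if x: "x \<in> \<H>" and y: "y \<in> \<H>" for x y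
  proof -
    have "\<langle>hproj H K x, y\<rangle> = cnj \<langle>y, hproj H K x\<rangle>" using inner_commute m P x y by blast
    also have "\<dots> = \<langle>hproj H K x, hproj H K y\<rangle>"
      using o[OF y P(1)[OF x]] inner_commute[of "hproj H K y" "hproj H K x"] m P x y by simp
    also have "\<dots> = \<langle>x, hproj H K y\<rangle>" using o[OF x P(1)[OF y]] by simp
    finally show ?thesis .
  qed
  moreover have "(nm (hproj H K x))\<^sup>2 \<le> Re \<langle>hproj H K x, x\<rangle>" if x: "x \<in> \<H>" for x
    using o[OF x P(1)[OF x]] norm_sq[OF m[OF P(1)[OF x]]] Re_inner_commute[OF x m[OF P(1)[OF x]]] by simp
  ultimately show ?thesis using m P by (simp add: firm_def)
qed

section \<open>Square roots of unbounded positive operators\<close>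

lemma firm_abs_resolvent: 
  assumes R: "firm H R"
  shows "firm H (abs_resolvent H R)"
    and abs_resolvent_square: "x \<in> \<H> \<Longrightarrow> abs_resolvent H R (abs_resolvent H R x) = R (x \<ominus> R x)"
    and abs_resolvent_commute: "bop H c \<Longrightarrow> (\<And>x. x \<in> \<H> \<Longrightarrow> c (R x) = R (c x)) \<Longrightarrow> x \<in> \<H> \<Longrightarrow>
        c (abs_resolvent H R x) = abs_resolvent H R (c x)"
    and abs_resolvent_swap: "x \<in> \<H> \<Longrightarrow> abs_resolvent H R x = hsqrt H (hcompl H R) (hsqrt H R x)"
proof -
  let ?D = "hsqrt H R" and ?E = "hsqrt H (hcompl H R)"
  have R': "firm H (hcompl H R)" by (rule firm_compl[OF R])
  have D: "firm H ?D" and E: "firm H ?E" using firm_hsqrt R R' by blast+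
  note m = firmD(1)[OF R] firmD(1)[OF R'] firmD(1)[OF D] firmD(1)[OF E]
  have comm: "c (hcompl H R x) = hcompl H R (c x)"
    if "bop H c" "\<And>x. x \<in> \<H> \<Longrightarrow> c (R x) = R (c x)" "x \<in> \<H>" for c x
    using that m by (simp add: hcompl_def bopD(4)[OF that(1)])
  have ED: "?E (?D x) = ?D (?E x)" if x: "x \<in> \<H>" for x
  proof (rule hsqrt_commute[OF R firm_bop[OF E] _ x])
    fix x assume x: "x \<in> \<H>"
    show "?E (R x) = R (?E x)"
      by (rule hsqrt_commute[OF R' firm_bop[OF R] comm[OF firm_bop[OF R] refl], symmetric]) (use x in auto)
  qed
  then show swap: "x \<in> \<H> \<Longrightarrow> abs_resolvent H R x = ?E (?D x)" for x by (simp add: abs_resolvent_def)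
  show "firm H (abs_resolvent H R)" unfolding abs_resolvent_def by (rule firm_mult[OF D E ED[symmetric]])
  show "abs_resolvent H R (abs_resolvent H R x) = R (x \<ominus> R x)" if x: "x \<in> \<H>" for x
  proof -
    have "abs_resolvent H R (abs_resolvent H R x) = ?D (?E (?E (?D x)))" using x m by (simp add: abs_resolvent_def ED)
    also have "\<dots> = ?D (hcompl H R (?D x))" using x m hsqrt_square[OF R'] by simp
    also have "\<dots> = hcompl H R (?D (?D x))"
      by (rule comm[OF firm_bop[OF D]]) (use x m hsqrt_commute[OF R firm_bop[OF R] refl] in auto)
    also have "\<dots> = R x \<ominus> R (R x)" using x hsqrt_square[OF R] by (simp add: hcompl_def)
    finally show ?thesis using x m by (simp add: bopD(4)[OF firm_bop[OF R]])
  qed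
  show "c (abs_resolvent H R x) = abs_resolvent H R (c x)"
    if c: "bop H c" and cR: "\<And>x. x \<in> \<H> \<Longrightarrow> c (R x) = R (c x)" and x: "x \<in> \<H>" for c x
    using hsqrt_commute[OF R c cR m(4)[OF x]] hsqrt_commute[OF R' c comm[OF c cR] x]
    by (simp add: abs_resolvent_def)
qed

context
  fixes R :: "'a \<Rightarrow> 'a"
  assumes R: "firm H R" and R_inj: "\<forall>x\<in>\<H>. R x = \<zero> \<longrightarrow> x = \<zero>"
begin

abbreviation (input) "D \<equiv> hsqrt H R"
abbreviation (input) "E \<equiv> hsqrt H (hcompl H R)"

lemma firm_D: "firm H D" and firm_E: "firm H E"
  using firm_hsqrt R firm_compl by blast+

lemma DE_mem: "x \<in> \<H> \<Longrightarrow> D x \<in> \<H>" "x \<in> \<H> \<Longrightarrow> E x \<in> \<H>" "x \<in> \<H> \<Longrightarrow> R x \<in> \<H>"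
  using firmD(1) firm_D firm_E R by blast+

lemma DE_swap: "x \<in> \<H> \<Longrightarrow> D (E x) = E (D x)"
  using abs_resolvent_swap[OF R] by (simp add: abs_resolvent_def)

lemma DD: "x \<in> \<H> \<Longrightarrow> D (D x) = R x" and EE: "x \<in> \<H> \<Longrightarrow> E (E x) = x \<ominus> R x"
  using hsqrt_square[OF R] hsqrt_square[OF firm_compl[OF R]] by (simp_all add: hcompl_def)

lemma D_inj: "x \<in> \<H> \<Longrightarrow> D x = \<zero> \<Longrightarrow> x = \<zero>"
  using DD[of x] R_inj bopD(5)[OF firm_bop[OF firm_D]] by simp

lemma D_cancel: "x \<in> \<H> \<Longrightarrow> y \<in> \<H> \<Longrightarrow> D x = D y \<Longrightarrow> x = y"
  using D_inj[of "x \<ominus> y"] bopD(4)[OF firm_bop[OF firm_D], of x y] DE_mem by simp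

lemma DDEE: "x \<in> \<H> \<Longrightarrow> D (D x) \<oplus> E (E x) = x"
  using DE_mem by (intro vec_eqI) (simp_all add: DD EE inner_simps)

text \<open>Both inclusions rest on \<open>D\<^sup>2 + E\<^sup>2 = 1\<close>: if \<open>E u = D v\<close>, the parameter is \<open>x = D u + E v\<close>. Passing
  to the adjoint turns the parametric form of the graph into the equational one, so that their
  equality amounts to self-adjointness.\<close>

lemma abs_graph_param: "(u, v) \<in> abs_graph H R \<longleftrightarrow> (\<exists>x\<in>\<H>. u = D x \<and> v = E x)"
proof
  assume "(u, v) \<in> abs_graph H R"
  then have m: "u \<in> \<H>" "v \<in> \<H>" and e: "E u = D v" by (auto simp: abs_graph_def)
  let ?x = "D u \<oplus> E v"
  have "D ?x = D (D u) \<oplus> E (E u)" "E ?x = D (D v) \<oplus> E (E v)"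
    using m e DE_mem DE_swap bopD(2)[OF firm_bop[OF firm_D]] bopD(2)[OF firm_bop[OF firm_E]]
    by (metis, metis)
  then show "\<exists>x\<in>\<H>. u = D x \<and> v = E x" using m DDEE DE_mem by (intro bexI[of _ ?x]) auto
next
  assume "\<exists>x\<in>\<H>. u = D x \<and> v = E x"
  then show "(u, v) \<in> abs_graph H R" using DE_mem DE_swap by (auto simp: abs_graph_def)
qed

lemma D_dense:
  assumes x: "x \<in> \<H>" shows "hlim H (\<lambda>n. D (neumann_sum H (hcompl H D) n x)) x"
proof -
  have p: "fixed_proj H (hcompl H D) x \<in> \<H>"
    using firmD(1)[OF firm_fixed_proj[OF firm_compl[OF firm_D]] x] .
  have "fixed_proj H (hcompl H D) x = \<zero>"
    by (rule D_inj[OF p firm_fixed_proj_null[OF firm_D x]])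
  then show ?thesis using firm_range_limit[OF firm_D x] x by simp
qed

lemma neumann_sum_D_mem: "x \<in> \<H> \<Longrightarrow> neumann_sum H (hcompl H D) n x \<in> \<H>"
  using bopD(1)[OF bop_neumann_sum[OF firm_compl[OF firm_D]]] .

lemma abs_graph_linear: "linear_op H (abs_graph H R)"
proof (rule linear_opI)
  note d = bopD[OF firm_bop[OF firm_D]] and e = bopD[OF firm_bop[OF firm_E]]
  fix x y assume xy: "(x, y) \<in> abs_graph H R"
  then show "x \<in> \<H> \<and> y \<in> \<H>" by (simp add: abs_graph_def)
  show "(c \<odot> x, c \<odot> y) \<in> abs_graph H R" for c
    using xy d e by (simp add: abs_graph_def)
  show "y = y'" if "(x, y') \<in> abs_graph H R" for y'
    using xy that D_cancel by (simp add: abs_graph_def)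
  fix x' y' assume "(x', y') \<in> abs_graph H R"
  then show "(x \<oplus> x', y \<oplus> y') \<in> abs_graph H R" using xy d e by (simp add: abs_graph_def)
next
  show "(\<zero>, \<zero>) \<in> abs_graph H R"
    using bopD(5)[OF firm_bop[OF firm_D]] bopD(5)[OF firm_bop[OF firm_E]] by (simp add: abs_graph_def)
qed

lemma abs_graph_self_adjoint: "adjoint_op H (abs_graph H R) = abs_graph H R"
proof -
  have "(y, z) \<in> adjoint_op H (abs_graph H R) \<longleftrightarrow> (y, z) \<in> abs_graph H R" for y z
  proof (cases "y \<in> \<H> \<and> z \<in> \<H>")
    case True
    then have y: "y \<in> \<H>" and z: "z \<in> \<H>" by auto
    have "(y, z) \<in> adjoint_op H (abs_graph H R) \<longleftrightarrow> (\<forall>x\<in>\<H>. \<langle>E x, y\<rangle> = \<langle>D x, z\<rangle>)"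
    proof
      assume a: "(y, z) \<in> adjoint_op H (abs_graph H R)"
      show "\<forall>x\<in>\<H>. \<langle>E x, y\<rangle> = \<langle>D x, z\<rangle>"
        by (intro ballI adjoint_opD[OF a]) (auto simp: abs_graph_param)
    qed (use y z in \<open>auto simp: adjoint_op_def abs_graph_param\<close>)
    also have "\<dots> \<longleftrightarrow> (\<forall>x\<in>\<H>. \<langle>x, E y\<rangle> = \<langle>x, D z\<rangle>)"
      using y z firmD(2)[OF firm_D] firmD(2)[OF firm_E] by simp
    also have "\<dots> \<longleftrightarrow> E y = D z"
    proof
      assume a: "\<forall>x\<in>\<H>. \<langle>x, E y\<rangle> = \<langle>x, D z\<rangle>"
      show "E y = D z"
      proof (rule vec_eqI)
        fix x assume x: "x \<in> \<H>"
        show "\<langle>E y, x\<rangle> = \<langle>D z, x\<rangle>"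
          using a x inner_commute[OF x DE_mem(2)[OF y]] inner_commute[OF x DE_mem(1)[OF z]] by simp
      qed (use y z DE_mem in auto)
    qed simp
    finally show ?thesis using y z by (simp add: abs_graph_def)
  qed (auto simp: adjoint_op_def abs_graph_def)
  then show ?thesis by auto
qed

lemma abs_graph_positive: "positive_self_adjoint H (abs_graph H R)"
proof -
  have dom: "Domain (abs_graph H R) \<subseteq> \<H>" by (auto simp: abs_graph_def)
  have "hdense H (Domain (abs_graph H R))"
    unfolding hdense_iff[OF dom]
  proof
    fix x assume x: "x \<in> \<H>"
    have "D (neumann_sum H (hcompl H D) n x) \<in> Domain (abs_graph H R)" for n
      using neumann_sum_D_mem[OF x] by (auto simp: Domain_iff abs_graph_param)
    then show "\<exists>f. (\<forall>n. f n \<in> Domain (abs_graph H R)) \<and> hlim H f x"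
      using D_dense[OF x] by (intro exI[of _ "\<lambda>n. D (neumann_sum H (hcompl H D) n x)"]) blast
  qed
  moreover have "0 \<le> Re \<langle>v, u\<rangle>" if uv: "(u, v) \<in> abs_graph H R" for u v
  proof -
    obtain x where x: "x \<in> \<H>" "u = D x" "v = E x" using uv abs_graph_param by blast
    have "\<langle>v, u\<rangle> = \<langle>abs_resolvent H R x, x\<rangle>" using x DE_mem firmD(2)[OF firm_D] by (simp add: abs_resolvent_def)
    then show ?thesis using firm_nonneg[OF firm_abs_resolvent(1)[OF R] x(1)] by simp
  qed
  ultimately show ?thesis
    using abs_graph_linear abs_graph_self_adjoint
    by (auto simp: positive_self_adjoint_def self_adjoint_def densely_defined_def)
qed

text \<open>If \<open>u = D x\<close>, \<open>E x = D y\<close> and \<open>w = E y\<close>, then \<open>R (u + w) = D (D\<^sup>2 x + E\<^sup>2 x) = u\<close>. Conversely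
  \<open>u = D\<^sup>2 x\<close> and \<open>w = E\<^sup>2 x\<close> for \<open>x = u + w\<close>, with \<open>E D x\<close> as intermediate vector.\<close>

lemma abs_graph_square: "abs_graph H R O abs_graph H R = square_of H R"
proof -
  note d = bopD[OF firm_bop[OF firm_D]] and e = bopD[OF firm_bop[OF firm_E]]
  have "(u, w) \<in> abs_graph H R O abs_graph H R \<longleftrightarrow> (u, w) \<in> square_of H R" for u w
  proof
    assume "(u, w) \<in> abs_graph H R O abs_graph H R"
    then obtain x y where xy: "x \<in> \<H>" "y \<in> \<H>" "u = D x" "E x = D y" "w = E y"
      by (auto simp: abs_graph_param relcomp_unfold)
    have Dw: "D w = E (E x)" using xy DE_swap by simp
    have "R (u \<oplus> w) = D (D u \<oplus> D w)" using xy DE_mem d by (simp add: DD[symmetric])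
    also have "\<dots> = u" unfolding Dw using xy(1,3) DDEE by simp
    finally have "R (u \<oplus> w) = u" .
    then show "(u, w) \<in> square_of H R" using xy DE_mem by (simp add: square_of_def)
  next
    assume "(u, w) \<in> square_of H R"
    then have m: "u \<in> \<H>" "w \<in> \<H>" and e1: "R (u \<oplus> w) = u" by (auto simp: square_of_def)
    define x where "x = u \<oplus> w"
    have x: "x \<in> \<H>" using m by (simp add: x_def)
    have u: "u = D (D x)" using e1 x DD by (simp add: x_def)
    have "w = x \<ominus> u" unfolding x_def using m by (intro vec_eqI) (simp_all add: inner_simps)
    then have w: "w = E (E x)" using EE[OF x] u DD[OF x] by simp
    have "(u, E (D x)) \<in> abs_graph H R" using u x DE_mem by (auto simp: abs_graph_param)
    moreover have "(E (D x), w) \<in> abs_graph H R"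
      unfolding abs_graph_param using w x DE_mem DE_swap by (intro bexI[of _ "E x"]) auto
    ultimately show "(u, w) \<in> abs_graph H R O abs_graph H R" by blast
  qed
  then show ?thesis by auto
qed

end

context
  fixes T :: "('a \<times> 'a) set"
  assumes T: "closed_op H T"
begin

lemma T_linear: "linear_op H T" using T by (simp add: closed_op_def)

lemma T_closed_subspace: "closed_subspace (hsum H H) T" using T closed_op_closed_subspace by blast

lemma hilbert_space_graph_sum: "hilbert_space (hsum H H)" "inner_space H"
  by (intro hilbert_space_hsum hilbert_space_axioms) (rule inner_space_axioms)

lemma graph_proj_eq: "x \<in> \<H> \<Longrightarrow> hproj (hsum H H) T (x, \<zero>) = (resolvent H T x, op_resolvent H T x)"
  by (simp add: resolvent_def op_resolvent_def)

lemma resolvent_pair_mem: "x \<in> \<H> \<Longrightarrow> (resolvent H T x, op_resolvent H T x) \<in> T"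
  using hilbert_space.hproj(1)[OF hilbert_space_graph_sum(1) T_closed_subspace, of "(x, \<zero>)"] by (simp add: graph_proj_eq)

lemma resolvent_closed: "x \<in> \<H> \<Longrightarrow> resolvent H T x \<in> \<H>" and op_resolvent_closed: "x \<in> \<H> \<Longrightarrow> op_resolvent H T x \<in> \<H>"
  using linear_opD(1,2)[OF T_linear resolvent_pair_mem] by blast+

lemma resolvent_pair_orth:
  assumes x: "x \<in> \<H>" and uv: "(u, v) \<in> T"
  shows "\<langle>x \<ominus> resolvent H T x, u\<rangle> = \<langle>op_resolvent H T x, v\<rangle>"
proof -
  interpret HH: hilbert_space "hsum H H" by (rule hilbert_space_graph_sum)
  have "hinner (hsum H H) (hminus (hsum H H) (x, \<zero>) (resolvent H T x, op_resolvent H T x)) (u, v) = 0"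
    using HH.hproj(2)[OF T_closed_subspace, of "(x, \<zero>)"] x uv
    by (intro HH.orth_complD[of _ T]) (auto simp: graph_proj_eq)
  then show ?thesis using x linear_opD(2)[OF T_linear uv] op_resolvent_closed[OF x] by (simp add: inner_simps)
qed

lemma resolvent_eqI:
  assumes "x \<in> \<H>" "(u, v) \<in> T" "\<And>a b. (a, b) \<in> T \<Longrightarrow> \<langle>x \<ominus> u, a\<rangle> = \<langle>v, b\<rangle>"
  shows "resolvent H T x = u" "op_resolvent H T x = v"
proof -
  interpret HH: hilbert_space "hsum H H" by (rule hilbert_space_graph_sum)
  note L = linear_opD[OF T_linear]
  have "hproj (hsum H H) T (x, \<zero>) = (u, v)"
  proof (rule HH.hproj_eqI)
    show "hsubspace (hsum H H) T" using T_linear by (simp add: linear_op_def)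
    show "hminus (hsum H H) (x, \<zero>) (u, v) \<in> orth_compl (hsum H H) T"
      using assms L(1,2) by (auto simp: orth_compl_def inner_simps)
  qed (use assms in auto)
  then show "resolvent H T x = u" "op_resolvent H T x = v" by (simp_all add: resolvent_def op_resolvent_def)
qed

text \<open>The resolvent is a compression of the graph projection, and Pythagoras for \<open>P(x, 0) = (R x, B x)\<close>
  gives the norm of \<open>B x\<close>.\<close>

lemma firm_resolvent: "firm H (resolvent H T)"
  and bop_op_resolvent: "bop H (op_resolvent H T)"
  and op_resolvent_norm: "x \<in> \<H> \<Longrightarrow> (nm (op_resolvent H T x))\<^sup>2 = Re \<langle>resolvent H T x, x\<rangle> - (nm (resolvent H T x))\<^sup>2"
proof -
  interpret HH: hilbert_space "hsum H H" by (rule hilbert_space_graph_sum)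
  have P: "firm (hsum H H) (hproj (hsum H H) T)" by (rule HH.firm_hproj[OF T_closed_subspace])
  note D = HH.firmD(2)[OF P] and L = HH.bopD[OF HH.firm_bop[OF P]]
  have nn: "(HH.nm (resolvent H T x, op_resolvent H T x))\<^sup>2 = (nm (resolvent H T x))\<^sup>2 + (nm (op_resolvent H T x))\<^sup>2" if x: "x \<in> \<H>" for x
    by (rule hsum_norm_sq[OF hilbert_space_graph_sum(2) hilbert_space_graph_sum(2) resolvent_closed[OF x] op_resolvent_closed[OF x]])
  have e: "(nm (resolvent H T x))\<^sup>2 + (nm (op_resolvent H T x))\<^sup>2 = Re \<langle>resolvent H T x, x\<rangle>" if x: "x \<in> \<H>" for x
  proof -
    have "\<langle>x \<ominus> resolvent H T x, resolvent H T x\<rangle> = \<langle>op_resolvent H T x, op_resolvent H T x\<rangle>" by (rule resolvent_pair_orth[OF x resolvent_pair_mem[OF x]])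
    then have "\<langle>x, resolvent H T x\<rangle> - complex_of_real ((nm (resolvent H T x))\<^sup>2) = complex_of_real ((nm (op_resolvent H T x))\<^sup>2)"
      using x resolvent_closed[OF x] op_resolvent_closed[OF x] by (simp add: inner_simps inner_self)
    then have "Re \<langle>x, resolvent H T x\<rangle> - (nm (resolvent H T x))\<^sup>2 = (nm (op_resolvent H T x))\<^sup>2"
      by (metis Re_complex_of_real minus_complex.sel(1))
    then show ?thesis using Re_inner_commute[OF x resolvent_closed[OF x]] by simp
  qed
  then show "x \<in> \<H> \<Longrightarrow> (nm (op_resolvent H T x))\<^sup>2 = Re \<langle>resolvent H T x, x\<rangle> - (nm (resolvent H T x))\<^sup>2" for x
    by (metis add_diff_cancel_left')
  have "\<langle>resolvent H T x, y\<rangle> = \<langle>x, resolvent H T y\<rangle>" if "x \<in> \<H>" "y \<in> \<H>" for x y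
    using D[of "(x, \<zero>)" "(y, \<zero>)"] that resolvent_closed op_resolvent_closed by (simp add: graph_proj_eq)
  moreover have "(nm (resolvent H T x))\<^sup>2 \<le> Re \<langle>resolvent H T x, x\<rangle>" if x: "x \<in> \<H>" for x
    using e[OF x] zero_le_power2[of "nm (op_resolvent H T x)"] by linarith
  ultimately show r: "firm H (resolvent H T)" using resolvent_closed by (simp add: firm_def)
  have "op_resolvent H T (x \<oplus> y) = op_resolvent H T x \<oplus> op_resolvent H T y" if "x \<in> \<H>" "y \<in> \<H>" for x y
    using L(2)[of "(x, \<zero>)" "(y, \<zero>)"] that by (simp add: graph_proj_eq)
  moreover have "op_resolvent H T (k \<odot> x) = k \<odot> op_resolvent H T x" if "x \<in> \<H>" for k x
    using L(3)[of "(x, \<zero>)" k] that by (simp add: graph_proj_eq)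
  moreover have "nm (op_resolvent H T x) \<le> 1 * nm x" if x: "x \<in> \<H>" for x
  proof -
    have "(nm (op_resolvent H T x))\<^sup>2 \<le> (nm x)\<^sup>2"
      using e[OF x] firm_le_one[OF r x] zero_le_power2[of "nm (resolvent H T x)"] by linarith
    then have "nm (op_resolvent H T x) \<le> nm x" by (rule power2_le_imp_le) (use x in simp)
    then show ?thesis by simp
  qed
  ultimately show "bop H (op_resolvent H T)" unfolding bop_def using op_resolvent_closed by blast
qed

lemma abs_resolvent_norm:
  assumes x: "x \<in> \<H>" shows "nm (op_resolvent H T x) = nm (abs_resolvent H (resolvent H T) x)"
proof -
  note C = firm_abs_resolvent[OF firm_resolvent]
  have "(nm (abs_resolvent H (resolvent H T) x))\<^sup>2 = Re \<langle>abs_resolvent H (resolvent H T) (abs_resolvent H (resolvent H T) x), x\<rangle>"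
    using firmD(1,2)[OF C(1)] x by (simp add: norm_sq)
  also have "\<dots> = Re \<langle>x \<ominus> resolvent H T x, resolvent H T x\<rangle>"
    unfolding C(2)[OF x] using x resolvent_closed by (simp add: firmD(2)[OF firm_resolvent])
  also have "\<dots> = (nm (op_resolvent H T x))\<^sup>2"
    using x resolvent_closed[OF x] Re_inner_commute[OF x resolvent_closed[OF x]]
    by (simp add: op_resolvent_norm inner_simps norm_sq)
  finally show ?thesis
    by (rule power2_eq_imp_eq[OF sym]) (use x op_resolvent_closed firmD(1)[OF C(1)] in auto)
qed

lemma polar_map_bop: "bop H (polar_map H T)"
  unfolding polar_map_def by (rule bounded_polar_bop[OF bop_op_resolvent firm_abs_resolvent(1)[OF firm_resolvent] abs_resolvent_norm])

lemma polar_map_contraction: "x \<in> \<H> \<Longrightarrow> nm (polar_map H T x) \<le> nm x"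
  unfolding polar_map_def by (rule bounded_polar_contraction[OF bop_op_resolvent firm_abs_resolvent(1)[OF firm_resolvent] abs_resolvent_norm])

lemma polar_map_norm: "x \<in> \<H> \<Longrightarrow> nm (polar_map H T x) = nm (x \<ominus> fixed_proj H (hcompl H (abs_resolvent H (resolvent H T))) x)"
  unfolding polar_map_def by (rule bounded_polar_norm[OF bop_op_resolvent firm_abs_resolvent(1)[OF firm_resolvent] abs_resolvent_norm])

lemma polar_map_abs_resolvent: "x \<in> \<H> \<Longrightarrow> polar_map H T (abs_resolvent H (resolvent H T) x) = op_resolvent H T x"
  unfolding polar_map_def by (rule bounded_polar_C[OF bop_op_resolvent firm_abs_resolvent(1)[OF firm_resolvent] abs_resolvent_norm])

lemma polar_map_null_iff: "x \<in> \<H> \<Longrightarrow> polar_map H T x = \<zero> \<longleftrightarrow> abs_resolvent H (resolvent H T) x = \<zero>"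
  unfolding polar_map_def by (rule bounded_polar_null_iff[OF bop_op_resolvent firm_abs_resolvent(1)[OF firm_resolvent] abs_resolvent_norm])

text \<open>The vectors orthogonal to the domain are exactly those \<open>x\<close> for which \<open>(x, 0)\<close> is orthogonal to the
  graph, that is, those with \<open>R x = 0\<close>. That no such vector exists makes the domain dense because
  every \<open>x\<close> is a limit of vectors in the range of \<open>R\<close>, up to its component in the kernel.\<close>

lemma dense_iff_resolvent_injective:
  "densely_defined H T \<longleftrightarrow> (\<forall>x\<in>\<H>. resolvent H T x = \<zero> \<longrightarrow> x = \<zero>)"
proof
  note L = linear_opD[OF T_linear]
  have dom: "Domain T \<subseteq> \<H>" using L(1) by blast
  {
    assume d: "densely_defined H T"
    show "\<forall>x\<in>\<H>. resolvent H T x = \<zero> \<longrightarrow> x = \<zero>"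
    proof (intro ballI impI)
      fix x assume x: "x \<in> \<H>" "resolvent H T x = \<zero>"
      have b: "op_resolvent H T x = \<zero>" using resolvent_pair_mem[OF x(1)] x(2) L(5,7) by metis
      have "\<langle>u, x\<rangle> = 0" if "u \<in> Domain T" for u
      proof -
        obtain v where uv: "(u, v) \<in> T" using \<open>u \<in> Domain T\<close> by blast
        have "\<langle>x, u\<rangle> = 0" using resolvent_pair_orth[OF x(1) uv] x b L(2)[OF uv] by simp
        then show ?thesis using inner_commute[OF x(1) L(1)[OF uv]] by simp
      qed
      then show "x = \<zero>" using d dom x densely_defined_orth by (auto simp: densely_defined_def)
    qed
  }
  {
    assume inj: "\<forall>x\<in>\<H>. resolvent H T x = \<zero> \<longrightarrow> x = \<zero>"
    show "densely_defined H T"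
      unfolding densely_defined_def hdense_iff[OF dom]
    proof
      fix x assume x: "x \<in> \<H>"
      have inj': "\<And>x. x \<in> \<H> \<Longrightarrow> resolvent H T x = \<zero> \<Longrightarrow> x = \<zero>" using inj by blast
      define p where "p = fixed_proj H (hcompl H (resolvent H T)) x"
      have pm: "p \<in> \<H>" unfolding p_def using firmD(1)[OF firm_fixed_proj[OF firm_compl[OF firm_resolvent]] x] .
      have "p = \<zero>" using firm_fixed_proj_null[OF firm_resolvent x] pm inj' by (simp add: p_def)
      then have "hlim H (\<lambda>n. resolvent H T (neumann_sum H (hcompl H (resolvent H T)) n x)) x"
        using firm_range_limit[OF firm_resolvent x] x by (simp add: p_def)
      moreover have "resolvent H T (neumann_sum H (hcompl H (resolvent H T)) n x) \<in> Domain T" for n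
        using resolvent_pair_mem[OF bopD(1)[OF bop_neumann_sum[OF firm_compl[OF firm_resolvent]] x]] by blast
      ultimately show "\<exists>f. (\<forall>n. f n \<in> Domain T) \<and> hlim H f x"
        by (intro exI[of _ "\<lambda>n. resolvent H T (neumann_sum H (hcompl H (resolvent H T)) n x)"]) blast
    qed
  }
qed

context
  assumes dense: "densely_defined H T"
begin

lemma resolvent_inj: "\<forall>x\<in>\<H>. resolvent H T x = \<zero> \<longrightarrow> x = \<zero>"
  using dense dense_iff_resolvent_injective by blast

lemma op_resolvent_adjoint: 
  assumes x: "x \<in> \<H>" shows "(op_resolvent H T x, x \<ominus> resolvent H T x) \<in> adjoint_op H T"
proof -
  note L = linear_opD[OF T_linear]
  have "\<langle>v, op_resolvent H T x\<rangle> = \<langle>u, x \<ominus> resolvent H T x\<rangle>" if uv: "(u, v) \<in> T" for u v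
    using resolvent_pair_orth[OF x uv] inner_commute[of "op_resolvent H T x" v] inner_commute[of "x \<ominus> resolvent H T x" u]
      x L(1,2)[OF uv] resolvent_closed[OF x] op_resolvent_closed[OF x] by simp
  then show ?thesis using x resolvent_closed op_resolvent_closed by (auto simp: adjoint_op_def)
qed

text \<open>The projection of \<open>(u + w, 0)\<close> is \<open>(u, T u)\<close> iff \<open>(w, - T u)\<close> is orthogonal to the graph, that is,
  iff \<open>T\<^sup>*T u = w\<close>.\<close>

lemma TstarT: "T O adjoint_op H T = square_of H (resolvent H T)"
proof -
  note L = linear_opD[OF T_linear]
  have "(u, w) \<in> T O adjoint_op H T \<longleftrightarrow> (u, w) \<in> square_of H (resolvent H T)" for u w
  proof
    assume "(u, w) \<in> T O adjoint_op H T"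
    then obtain v where uv: "(u, v) \<in> T" and vw: "(v, w) \<in> adjoint_op H T" by blast
    have m: "u \<in> \<H>" "v \<in> \<H>" "w \<in> \<H>" using L uv vw by (auto simp: adjoint_op_def)
    have e: "(u \<oplus> w) \<ominus> u = w" using m by (intro vec_eqI) (simp_all add: inner_simps)
    have "resolvent H T (u \<oplus> w) = u"
    proof (rule resolvent_eqI(1)[OF _ uv])
      fix a b assume ab: "(a, b) \<in> T"
      have "\<langle>w, a\<rangle> = \<langle>v, b\<rangle>"
        using adjoint_opD[OF vw ab] inner_commute[of a w] inner_commute[of b v] L(1,2)[OF ab] m by simp
      then show "\<langle>u \<oplus> w \<ominus> u, a\<rangle> = \<langle>v, b\<rangle>" by (simp add: e)
    qed (use m in simp)
    then show "(u, w) \<in> square_of H (resolvent H T)" using m by (simp add: square_of_def)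
  next
    assume "(u, w) \<in> square_of H (resolvent H T)"
    then have m: "u \<in> \<H>" "w \<in> \<H>" and e: "resolvent H T (u \<oplus> w) = u" by (auto simp: square_of_def)
    have e2: "(u \<oplus> w) \<ominus> u = w" using m by (intro vec_eqI) (simp_all add: inner_simps)
    have "u \<oplus> w \<in> \<H>" using m by simp
    from resolvent_pair_mem[OF this] op_resolvent_adjoint[OF this] show "(u, w) \<in> T O adjoint_op H T"
      unfolding e e2 by blast
  qed
  then show ?thesis by auto
qed

end

end

text \<open>Let \<open>A\<close> be a positive root. Its own resolvent is \<open>R\<close>, because \<open>A\<^sup>*A = A\<^sup>2\<close>. So \<open>A R\<close> is bounded; it is
  a positive contraction with square \<open>R - R\<^sup>2\<close> commuting with \<open>R\<close>, which forces \<open>A R = D E\<close>. For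
  \<open>(u, v) \<in> A\<close> it follows that \<open>D E u = A R u = R v = D\<^sup>2 v\<close>, so \<open>E u = D v\<close>. Thus \<open>A\<close> is contained
  in the canonical root, and self-adjoint operators have no proper self-adjoint extensions.\<close>

lemma positive_root_unique:
  assumes R: "firm H R" and inj: "\<forall>x\<in>\<H>. R x = \<zero> \<longrightarrow> x = \<zero>"
    and A: "positive_self_adjoint H A" and sq: "A O A = square_of H R"
  shows "A = abs_graph H R"
proof -
  have lin: "linear_op H A" and dense: "densely_defined H A" and adj: "adjoint_op H A = A"
    and pos: "\<And>x y. (x, y) \<in> A \<Longrightarrow> 0 \<le> Re \<langle>y, x\<rangle>"
    using A by (auto simp: positive_self_adjoint_def self_adjoint_def)
  note L = linear_opD[OF lin]
  have sym: "\<langle>b, c\<rangle> = \<langle>a, d\<rangle>" if "(a, b) \<in> A" "(c, d) \<in> A" for a b c d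
    using adjoint_opD[of c d A a b] that adj by simp
  have cl: "closed_op H A"
    unfolding closed_op_iff
  proof (intro conjI allI impI)
    show "single_valued A" "hsubspace (hsum H H) A" using lin by (auto simp: linear_op_def)
    fix f g x y assume fg: "(\<forall>n. (f n, g n) \<in> A) \<and> hlim H f x \<and> hlim H g y"
    then have m: "x \<in> \<H>" "y \<in> \<H>" using hlim_in by blast+
    have "\<langle>w, x\<rangle> = \<langle>u, y\<rangle>" if uw: "(u, w) \<in> A" for u w
    proof (rule LIMSEQ_unique)
      have um: "u \<in> \<H>" "w \<in> \<H>" using L uw by blast+
      show "(\<lambda>n. \<langle>w, f n\<rangle>) \<longlonglongrightarrow> \<langle>w, x\<rangle>" using fg um by (intro hlim_inner) auto
      have "(\<lambda>n. \<langle>u, g n\<rangle>) \<longlonglongrightarrow> \<langle>u, y\<rangle>" using fg um by (intro hlim_inner) auto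
      moreover have "\<langle>w, f n\<rangle> = \<langle>u, g n\<rangle>" for n using sym[OF uw] fg by blast
      ultimately show "(\<lambda>n. \<langle>w, f n\<rangle>) \<longlonglongrightarrow> \<langle>u, y\<rangle>" by simp
    qed
    then have "(x, y) \<in> adjoint_op H A" using m by (auto simp: adjoint_op_def)
    then show "(x, y) \<in> A" using adj by simp
  qed
  let ?C = "op_resolvent H A"
  note m = firmD(1)[OF R] op_resolvent_closed[OF cl]
  have resR: "resolvent H A x = R x" if x: "x \<in> \<H>" for x
  proof -
    have e: "R x \<oplus> (x \<ominus> R x) = x" using x m by (intro vec_eqI) (simp_all add: inner_simps)
    have "(R x, x \<ominus> R x) \<in> square_of H R" using x m e by (simp add: square_of_def)
    then have "(R x, x \<ominus> R x) \<in> square_of H (resolvent H A)"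
      using TstarT[OF cl dense] adj sq by simp
    then show ?thesis using e by (simp add: square_of_def)
  qed
  have RC: "(R x, ?C x) \<in> A" "(?C x, x \<ominus> R x) \<in> A" if x: "x \<in> \<H>" for x
    using resolvent_pair_mem[OF cl x] op_resolvent_adjoint[OF cl dense x] resR[OF x] adj by simp_all
  have AC: "?C u = R v" if uv: "(u, v) \<in> A" for u v
  proof -
    have um: "u \<in> \<H>" "v \<in> \<H>" using L uv by blast+
    have "(u \<ominus> R u, v \<ominus> ?C u) \<in> A" by (rule L(6)[OF uv RC(1)[OF um(1)]])
    then have "(?C u, v \<ominus> ?C u) \<in> A O A" using RC(2)[OF um(1)] by blast
    then have "R (?C u \<oplus> (v \<ominus> ?C u)) = ?C u" unfolding sq by (simp add: square_of_def)
    moreover have "?C u \<oplus> (v \<ominus> ?C u) = v" using um m by (intro vec_eqI) (simp_all add: inner_simps)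
    ultimately show ?thesis by simp
  qed
  have C: "firm H ?C"
    unfolding firm_def
  proof (intro conjI ballI)
    fix x assume x: "x \<in> \<H>"
    show "?C x \<in> \<H>" using m x by blast
    have x1: "x = R x \<oplus> (x \<ominus> R x)" if "x \<in> \<H>" for x
      using that m by (intro vec_eqI) (simp_all add: inner_simps)
    \<comment> \<open>Positivity of \<open>A\<close> at \<open>R x - A R x\<close> bounds \<open>2 \<parallel>A R x\<parallel>\<^sup>2\<close> by the form of \<open>A R\<close>.\<close>
    have "0 \<le> Re \<langle>?C x \<ominus> (x \<ominus> R x), R x \<ominus> ?C x\<rangle>" by (intro pos L(6) RC x)
    moreover have "\<langle>?C x, ?C x\<rangle> = \<langle>R x, x \<ominus> R x\<rangle>" by (rule sym[OF RC[OF x]])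
    moreover have "\<langle>x \<ominus> R x, ?C x\<rangle> = \<langle>?C x, x \<ominus> R x\<rangle>" by (rule sym[OF RC(2)[OF x] RC(2)[OF x]])
    moreover have "Re \<langle>x \<ominus> R x, R x\<rangle> = Re \<langle>R x, x \<ominus> R x\<rangle>"
      using Re_inner_commute[of "R x" "x \<ominus> R x"] m x by simp
    ultimately have "2 * (nm (?C x))\<^sup>2 \<le> Re \<langle>?C x, R x\<rangle> + Re \<langle>?C x, x \<ominus> R x\<rangle>"
      using m x by (simp add: norm_sq inner_simps)
    also have "\<dots> = Re \<langle>?C x, x\<rangle>" using m x by (simp add: inner_simps)
    finally show "(nm (?C x))\<^sup>2 \<le> Re \<langle>?C x, x\<rangle>" using zero_le_power2[of "nm (?C x)"] by linarith
    fix y assume y: "y \<in> \<H>"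
    have "\<langle>?C x, y\<rangle> = \<langle>?C x, R y\<rangle> + \<langle>?C x, y \<ominus> R y\<rangle>" using m x y by (simp add: inner_simps)
    also have "\<dots> = \<langle>R x, ?C y\<rangle> + \<langle>x \<ominus> R x, ?C y\<rangle>"
      using sym[OF RC(1)[OF x] RC(1)[OF y]] sym[OF RC(2)[OF x] RC(2)[OF y]] by simp
    also have "\<dots> = \<langle>x, ?C y\<rangle>" using m x y by (simp add: inner_simps)
    finally show "\<langle>?C x, y\<rangle> = \<langle>x, ?C y\<rangle>" .
  qed
  have CR: "?C (R x) = R (?C x)" if "x \<in> \<H>" for x using AC[OF RC(1)[OF that]] .
  have CC: "?C x = abs_resolvent H R x" if x: "x \<in> \<H>" for x
  proof (rule square_root_unique[OF C firm_abs_resolvent(1)[OF R] _ _ x])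
    fix x assume x: "x \<in> \<H>"
    show "?C (abs_resolvent H R x) = abs_resolvent H R (?C x)" by (rule firm_abs_resolvent(3)[OF R firm_bop[OF C] CR x])
    show "?C (?C x) = abs_resolvent H R (abs_resolvent H R x)" using AC[OF RC(2)[OF x]] firm_abs_resolvent(2)[OF R x] by simp
  qed
  have sub: "A \<subseteq> abs_graph H R"
  proof
    fix p assume "p \<in> A"
    then obtain u v where p: "p = (u, v)" and uv: "(u, v) \<in> A" by (cases p) auto
    have um: "u \<in> \<H>" "v \<in> \<H>" using L uv by blast+
    have "hsqrt H R (hsqrt H (hcompl H R) u) = hsqrt H R (hsqrt H R v)"
      using AC[OF uv] CC[OF um(1)] DD[OF R inj um(2)] by (simp add: abs_resolvent_def)
    then have "hsqrt H (hcompl H R) u = hsqrt H R v"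
      using D_cancel[OF R inj] um DE_mem[OF R inj] by blast
    then show "p \<in> abs_graph H R" using um by (simp add: abs_graph_def p)
  qed
  have "abs_graph H R \<subseteq> adjoint_op H A"
    using abs_graph_self_adjoint[OF R inj] sub unfolding adjoint_op_def by blast
  then show ?thesis using sub adj by blast
qed

lemma op_abs_eq:
  assumes T: "closed_op H T" and d: "densely_defined H T"
  shows "op_abs H T = abs_graph H (resolvent H T)"
  unfolding op_abs_def op_sqrt_def TstarT[OF T d]
proof (rule the_equality)
  note r = firm_resolvent[OF T] resolvent_inj[OF T d]
  show "positive_self_adjoint H (abs_graph H (resolvent H T)) \<and>
    abs_graph H (resolvent H T) O abs_graph H (resolvent H T) = square_of H (resolvent H T)"
    using abs_graph_positive[OF r] abs_graph_square[OF r] by simp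
  show "A = abs_graph H (resolvent H T)"
    if "positive_self_adjoint H A \<and> A O A = square_of H (resolvent H T)" for A
    using positive_root_unique[OF r] that by blast
qed

end

section \<open>Polar decomposition of closed operators\<close>

context hilbert_space
begin

context
  fixes T :: "('a \<times> 'a) set"
  assumes T: "closed_op H T"
begin

abbreviation (input) "V \<equiv> polar_map H T"
abbreviation (input) "C \<equiv> abs_resolvent H (resolvent H T)"
abbreviation (input) "ker_proj \<equiv> fixed_proj H (hcompl H C)"

lemma firm_C: "firm H C" by (rule firm_abs_resolvent(1)[OF firm_resolvent[OF T]])

lemma firm_ker_proj: "firm H ker_proj" by (rule firm_fixed_proj[OF firm_compl[OF firm_C]])

lemma ker_proj_idem: "x \<in> \<H> \<Longrightarrow> ker_proj (ker_proj x) = ker_proj x"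
  by (intro fixed_proj_of_fixed fixed_proj_fixed firm_compl firm_C firmD(1)[OF firm_ker_proj])

lemma ker_proj_null: "x \<in> \<H> \<Longrightarrow> C (ker_proj x) = \<zero>"
  by (rule firm_fixed_proj_null[OF firm_C])

lemma ker_proj_of_null: "x \<in> \<H> \<Longrightarrow> C x = \<zero> \<Longrightarrow> ker_proj x = x"
  using fixed_proj_of_fixed[OF firm_compl[OF firm_C]] by (simp add: hcompl_def)

text \<open>The map \<open>ker_proj\<close> is the projection onto the kernel of \<open>C\<close>, which is also the kernel of the polar
  part; so its kernel is the initial space.\<close>

lemma ker_proj_zero_iff:
  assumes x: "x \<in> \<H>"
  shows "ker_proj x = \<zero> \<longleftrightarrow> (\<forall>y\<in>\<H>. C y = \<zero> \<longrightarrow> \<langle>x, y\<rangle> = 0)"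
proof
  assume k: "ker_proj x = \<zero>"
  show "\<forall>y\<in>\<H>. C y = \<zero> \<longrightarrow> \<langle>x, y\<rangle> = 0"
  proof (intro ballI impI)
    fix y assume y: "y \<in> \<H>" "C y = \<zero>"
    then have "\<langle>x, y\<rangle> = \<langle>ker_proj x, y\<rangle>" using ker_proj_of_null firmD(2)[OF firm_ker_proj x y(1)] by simp
    then show "\<langle>x, y\<rangle> = 0" using k y by simp
  qed
next
  assume "\<forall>y\<in>\<H>. C y = \<zero> \<longrightarrow> \<langle>x, y\<rangle> = 0"
  then have "\<langle>x, ker_proj x\<rangle> = 0" using ker_proj_null[OF x] firmD(1)[OF firm_ker_proj x] by blast
  then have "\<langle>ker_proj x, ker_proj x\<rangle> = 0"
    using firmD(2)[OF firm_ker_proj x firmD(1)[OF firm_ker_proj x]] ker_proj_idem[OF x] by simp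
  then show "ker_proj x = \<zero>" using inner_definite firmD(1)[OF firm_ker_proj x] by blast
qed

lemma polar_map_mem: "x \<in> \<H> \<Longrightarrow> V x \<in> \<H>"
  by (rule bopD(1)[OF polar_map_bop[OF T]])

text \<open>Polarisation of \<open>\<parallel>V x\<parallel> = \<parallel>x - ker_proj x\<parallel>\<close>.\<close>

lemma polar_map_inner:
  assumes x: "x \<in> \<H>" and y: "y \<in> \<H>"
  shows "\<langle>V x, V y\<rangle> = \<langle>x \<ominus> ker_proj x, y\<rangle>"
proof -
  have "\<langle>V x, V y\<rangle> = \<langle>hcompl H ker_proj x, hcompl H ker_proj y\<rangle>"
    by (rule polarization[OF polar_map_bop[OF T] firm_bop[OF firm_compl[OF firm_ker_proj]] _ x y])
      (use polar_map_norm[OF T] in \<open>simp add: hcompl_def\<close>)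
  also have "\<dots> = \<langle>x \<ominus> ker_proj x, y\<rangle>"
    using x y firmD(1)[OF firm_ker_proj] firmD(2)[OF firm_ker_proj x firmD(1)[OF firm_ker_proj y]] ker_proj_idem[OF y]
      firmD(2)[OF firm_ker_proj firmD(1)[OF firm_ker_proj x] y] ker_proj_idem[OF x] firmD(2)[OF firm_ker_proj x y]
      firmD(2)[OF firm_ker_proj firmD(1)[OF firm_ker_proj x] firmD(1)[OF firm_ker_proj y]]
    by (simp add: hcompl_def inner_simps)
  finally show ?thesis .
qed

lemma polar_map_initial_space:
  "initial_space H (graph_of H V) = {x \<in> \<H>. ker_proj x = \<zero>}"
proof -
  have "{x. (x, \<zero>) \<in> graph_of H V} = {x \<in> \<H>. C x = \<zero>}"
    using polar_map_null_iff[OF T] by (auto simp: eq_commute[of "\<zero>"])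
  then show ?thesis using ker_proj_zero_iff by (auto simp: initial_space_def orth_compl_def)
qed

lemma polar_map_partial_isometry: "partial_isometry H (graph_of H V)"
  unfolding partial_isometry_def polar_map_initial_space
  using bounded_op_graph_of[OF polar_map_bop[OF T]] polar_map_norm[OF T] by auto

context
  assumes dense: "densely_defined H T"
begin

lemmas resolvent_facts = firm_resolvent[OF T] resolvent_inj[OF T dense]
abbreviation (input) "DT \<equiv> hsqrt H (resolvent H T)"
abbreviation (input) "ET \<equiv> hsqrt H (hcompl H (resolvent H T))"

lemmas fD = firm_D[OF resolvent_facts] and fE = firm_E[OF resolvent_facts]
lemmas polar_closed = DE_mem[OF resolvent_facts] polar_map_mem firmD(1)[OF firm_ker_proj] firmD(1)[OF firm_C]

lemma kernel_ET: "x \<in> \<H> \<Longrightarrow> C x = \<zero> \<Longrightarrow> ET x = \<zero>"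
  using D_inj[OF resolvent_facts, of "ET x"] polar_closed by (simp add: abs_resolvent_def)

lemma ker_proj_ET:
  assumes x: "x \<in> \<H>" shows "ker_proj (ET x) = \<zero>"
proof -
  have "\<langle>ET x, y\<rangle> = 0" if "y \<in> \<H>" "C y = \<zero>" for y
    using firmD(2)[OF fE x that(1)] kernel_ET[OF that] x by simp
  then show ?thesis using ker_proj_zero_iff[OF polar_closed(2)[OF x]] by blast
qed

text \<open>The range of \<open>|T|\<close> is that of \<open>E\<close>. Its closure contains \<open>x - ker_proj x = lim C (1 + q + \<dots> + q\<^sup>n) x\<close>
  with \<open>q = 1 - C\<close>, and \<open>C = E D\<close>.\<close>

lemma closure_range:
  "htopology H closure_of (Range (abs_graph H (resolvent H T))) = {x \<in> \<H>. ker_proj x = \<zero>}"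
proof -
  have R: "Range (abs_graph H (resolvent H T)) = ET ` \<H>"
    using abs_graph_param[OF resolvent_facts] by (fastforce simp: Range_iff image_iff)
  have sub: "ET ` \<H> \<subseteq> \<H>" using polar_closed by blast
  show ?thesis
    unfolding R
  proof (intro set_eqI iffI)
    fix x assume "x \<in> htopology H closure_of (ET ` \<H>)"
    then obtain f where f: "\<And>n. f n \<in> ET ` \<H>" "hlim H f x" using closure_iff_hlim[OF sub] by blast
    have "hlim H (\<lambda>n. ker_proj (f n)) (ker_proj x)" by (rule bop_hlim[OF firm_bop[OF firm_ker_proj] f(2)])
    moreover have "ker_proj (f n) = \<zero>" for n using f(1)[of n] ker_proj_ET by auto
    ultimately have "hlim H (\<lambda>n. \<zero>) (ker_proj x)" by simp
    then show "x \<in> {x \<in> \<H>. ker_proj x = \<zero>}"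
      using hlim_unique[OF _ hlim_const[THEN iffD2, OF zero_closed]] hlim_in(2)[OF f(2)] by simp
  next
    fix x assume "x \<in> {x \<in> \<H>. ker_proj x = \<zero>}"
    then have x: "x \<in> \<H>" and k: "ker_proj x = \<zero>" by auto
    let ?g = "\<lambda>n. neumann_sum H (hcompl H C) n x"
    have g: "?g n \<in> \<H>" for n using bopD(1)[OF bop_neumann_sum[OF firm_compl[OF firm_C]] x] .
    have l: "hlim H (\<lambda>n. C (?g n)) x" using firm_range_limit[OF firm_C x] k x by simp
    have r: "C (?g n) \<in> ET ` \<H>" for n
      unfolding abs_resolvent_swap[OF firm_resolvent[OF T] g] by (rule imageI) (rule polar_closed(1)[OF g])
    show "x \<in> htopology H closure_of (ET ` \<H>)"
      unfolding closure_iff_hlim[OF sub] by (intro exI[of _ "\<lambda>n. C (?g n)"] conjI allI l r)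
  qed
qed

text \<open>On the dense range of \<open>D\<close> the claim reads \<open>(R z, V C z) = (R z, B z) \<in> T\<close>, and \<open>T\<close> is closed.\<close>

lemma factor_mem:
  assumes x: "x \<in> \<H>" shows "(DT x, V (ET x)) \<in> T"
proof -
  let ?g = "\<lambda>n. neumann_sum H (hcompl H DT) n x"
  have g: "?g n \<in> \<H>" for n by (rule neumann_sum_D_mem[OF resolvent_facts x])
  have l: "hlim H (\<lambda>n. DT (?g n)) x" by (rule D_dense[OF resolvent_facts x])
  have "(DT (DT z), V (ET (DT z))) \<in> T" if z: "z \<in> \<H>" for z
    using resolvent_pair_mem[OF T z] polar_map_abs_resolvent[OF T z] abs_resolvent_swap[OF firm_resolvent[OF T] z] DD[OF resolvent_facts z] by simp
  then have "\<forall>n. (DT (DT (?g n)), V (ET (DT (?g n)))) \<in> T" using g by blast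
  moreover have "hlim H (\<lambda>n. DT (DT (?g n))) (DT x)" "hlim H (\<lambda>n. V (ET (DT (?g n)))) (V (ET x))"
    using bop_hlim[OF firm_bop[OF fD] l]
      bop_hlim[OF polar_map_bop[OF T] bop_hlim[OF firm_bop[OF fE] l]] by auto
  ultimately show ?thesis
    using T[unfolded closed_op_iff, THEN conjunct2, THEN conjunct2, rule_format,
        of "\<lambda>n. DT (DT (?g n))" "\<lambda>n. V (ET (DT (?g n)))"] by blast
qed

text \<open>One inclusion is \<open>factor_mem\<close>. For the other, write \<open>W = V E\<close>. The map \<open>x \<mapsto> (D x, W x)\<close> is
  isometric, so its range is closed with projection \<open>(u, v) \<mapsto> (D x, W x)\<close> for \<open>x = D u + W\<^sup>* v\<close>. A
  vector of \<open>T\<close> orthogonal to this range is in particular orthogonal to all \<open>(R z, B z)\<close>, the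
  projections of \<open>(z, 0)\<close>, hence to all \<open>(z, 0)\<close>; its first component vanishes, and so does the
  second.\<close>

lemma factorization: "T = abs_graph H (resolvent H T) O graph_of H V"
proof
  note L = linear_opD[OF T_linear[OF T]]
  note d = bopD(4)[OF firm_bop[OF fD]] and e = bopD(4)[OF firm_bop[OF fE]]
  show "abs_graph H (resolvent H T) O graph_of H V \<subseteq> T"
    using factor_mem by (auto simp: abs_graph_param[OF resolvent_facts])
  let ?W = "\<lambda>x. V (ET x)"
  have bW: "bop H ?W" by (rule bop_comp[OF polar_map_bop[OF T] firm_bop[OF fE]])
  obtain W' where W': "\<And>y. y \<in> \<H> \<Longrightarrow> W' y \<in> \<H>" "\<And>x y. x \<in> \<H> \<Longrightarrow> y \<in> \<H> \<Longrightarrow> \<langle>?W x, y\<rangle> = \<langle>x, W' y\<rangle>"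
    using adjoint_ex[OF bW] by metis
  have WW: "\<langle>?W x, ?W z\<rangle> = \<langle>ET x, ET z\<rangle>" if "x \<in> \<H>" "z \<in> \<H>" for x z
    using polar_map_inner[of "ET x" "ET z"] that polar_closed ker_proj_ET by simp
  show "T \<subseteq> abs_graph H (resolvent H T) O graph_of H V"
  proof
    fix p assume "p \<in> T"
    then obtain u v where p: "p = (u, v)" and uv: "(u, v) \<in> T" by (cases p) auto
    have um: "u \<in> \<H>" "v \<in> \<H>" using L uv by blast+
    define x where "x = DT u \<oplus> W' v"
    have x: "x \<in> \<H>" using um W' polar_closed by (simp add: x_def)
    have Tx: "(u \<ominus> DT x, v \<ominus> ?W x) \<in> T" by (rule L(6)[OF uv factor_mem[OF x]])
    \<comment> \<open>The difference of \<open>(u, v)\<close> and its projection is orthogonal to the range of \<open>(D, W)\<close>.\<close>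
    have o: "\<langle>DT z, u \<ominus> DT x\<rangle> + \<langle>?W z, v \<ominus> ?W x\<rangle> = 0" if z: "z \<in> \<H>" for z
    proof -
      have zx: "\<langle>z, x\<rangle> = \<langle>z, DT u\<rangle> + \<langle>z, W' v\<rangle>" using um z polar_closed W' by (simp add: x_def inner_simps)
      have "\<langle>DT z, u \<ominus> DT x\<rangle> + \<langle>?W z, v \<ominus> ?W x\<rangle>
          = \<langle>z, DT u\<rangle> - \<langle>z, DT (DT x)\<rangle> + \<langle>z, W' v\<rangle> - \<langle>z, ET (ET x)\<rangle>"
        using um x z polar_closed W'(2)[OF z um(2)] WW[OF z x] firmD(2)[OF fD z] firmD(2)[OF fE z]
        by (simp add: inner_simps)
      also have "\<dots> = \<langle>z, x\<rangle> - \<langle>z, DT (DT x) \<oplus> ET (ET x)\<rangle>"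
        using um x z polar_closed W' zx by (simp add: inner_simps)
      finally show ?thesis using DDEE[OF resolvent_facts x] by simp
    qed
    have zero: "u \<ominus> DT x = \<zero>"
    proof (rule vec_eqI)
      fix z assume z: "z \<in> \<H>"
      have m: "u \<ominus> DT x \<in> \<H>" "v \<ominus> ?W x \<in> \<H>" using um x polar_closed by auto
      have "\<langle>resolvent H T z, u \<ominus> DT x\<rangle> + \<langle>op_resolvent H T z, v \<ominus> ?W x\<rangle> = 0"
        using o[of "DT z"] z polar_closed DD[OF resolvent_facts z] polar_map_abs_resolvent[OF T z] abs_resolvent_swap[OF firm_resolvent[OF T] z] by simp
      moreover have "\<langle>z \<ominus> resolvent H T z, u \<ominus> DT x\<rangle> = \<langle>op_resolvent H T z, v \<ominus> ?W x\<rangle>"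
        by (rule resolvent_pair_orth[OF T z Tx])
      ultimately have "\<langle>z, u \<ominus> DT x\<rangle> = 0"
        using z m polar_closed(3)[OF z] by (simp add: inner_minus_left diff_eq_eq add.commute)
      then show "\<langle>u \<ominus> DT x, z\<rangle> = \<langle>\<zero>, z\<rangle>"
        using inner_commute[OF z m(1)] z by simp
    qed (use um x polar_closed in auto)
    then have "v \<ominus> ?W x = \<zero>" using Tx L(5,7) by metis
    then have "u = DT x" "v = ?W x" using zero um x polar_closed by auto
    then show "p \<in> abs_graph H (resolvent H T) O graph_of H V"
      unfolding p using x polar_closed by (intro relcompI[of _ "ET x"]) (auto simp: abs_graph_param[OF resolvent_facts])
  qed
qed

text \<open>On the range of \<open>|T|\<close> both partial isometries are determined by \<open>T\<close>, by continuity also on its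
  closure, the common initial space; on the orthogonal complement of the latter both vanish.\<close>

lemma polar_unique:
  assumes V': "partial_isometry H V'"
    and i: "initial_space H V' = {x \<in> \<H>. ker_proj x = \<zero>}"
    and t: "T = abs_graph H (resolvent H T) O V'"
  shows "V' = graph_of H V"
proof -
  note L = linear_opD[OF T_linear[OF T]]
  have b: "bounded_op H V'" using V' by (simp add: partial_isometry_def)
  let ?f = "op_app V'"
  have f: "bop H ?f" and Vf: "V' = graph_of H ?f" using bounded_opE[OF b] by blast+
  note F = bopD[OF f] and VB = bopD[OF polar_map_bop[OF T]]
  have eqE: "?f (ET x) = V (ET x)" if x: "x \<in> \<H>" for x
  proof -
    have "(DT x, ET x) \<in> abs_graph H (resolvent H T)" using x by (auto simp: abs_graph_param[OF resolvent_facts])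
    moreover have "(ET x, ?f (ET x)) \<in> V'" using x polar_closed by (subst Vf) simp
    ultimately have "(DT x, ?f (ET x)) \<in> T" by (subst t) blast
    then show ?thesis using factor_mem[OF x] L(7) by blast
  qed
  have eqI: "?f x = V x" if x: "x \<in> \<H>" "ker_proj x = \<zero>" for x
  proof -
    let ?g = "\<lambda>n. neumann_sum H (hcompl H C) n x"
    have g: "?g n \<in> \<H>" for n using bopD(1)[OF bop_neumann_sum[OF firm_compl[OF firm_C]] x(1)] .
    have l: "hlim H (\<lambda>n. C (?g n)) x" using firm_range_limit[OF firm_C x(1)] x by simp
    have "?f (C (?g n)) = V (C (?g n))" for n
      using abs_resolvent_swap[OF firm_resolvent[OF T] g] eqE polar_closed g by simp
    then show ?thesis
      using bop_hlim[OF f l] bop_hlim[OF polar_map_bop[OF T] l] hlim_unique by simp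
  qed
  (* the kernel of V' is the orthogonal complement of the initial space *)
  define N where "N = {x \<in> \<H>. ?f x = \<zero>}"
  have N: "closed_subspace H N"
    unfolding closed_subspace_def
  proof (intro conjI allI impI)
    show "hsubspace H N" by (rule hsubspaceI) (auto simp: N_def F)
    fix h x assume h: "(\<forall>n. h n \<in> N) \<and> hlim H h x"
    then have "hlim H (\<lambda>n. ?f (h n)) (?f x)" using bop_hlim[OF f] by blast
    then have "hlim H (\<lambda>n. \<zero>) (?f x)" using h by (simp add: N_def)
    then have "?f x = \<zero>" using hlim_unique hlim_const[THEN iffD2, OF zero_closed] by blast
    then show "x \<in> N" using h hlim_in(2) by (auto simp: N_def)
  qed
  have iN: "initial_space H V' = orth_compl H N"
    unfolding initial_space_def by (subst Vf) (simp add: N_def conj_commute eq_commute)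
  have "?f x = V x" if x: "x \<in> \<H>" for x
  proof -
    define n where "n = hproj H N x"
    define m where "m = x \<ominus> n"
    have n: "n \<in> N" and mo: "m \<in> orth_compl H N"
      using hproj[OF N x] by (simp_all add: n_def m_def)
    have nm: "n \<in> \<H>" "?f n = \<zero>" using n by (auto simp: N_def)
    have m0: "m \<in> \<H>" "ker_proj m = \<zero>" using mo iN i by auto
    have xe: "x = n \<oplus> m" unfolding m_def using x nm by (intro vec_eqI) (simp_all add: inner_simps)
    have kn: "ker_proj n \<in> \<H>" using polar_closed(5)[OF nm(1)] .
    have "ker_proj (n \<ominus> ker_proj n) = \<zero>"
      using bopD(4)[OF firm_bop[OF firm_ker_proj] nm(1) kn] ker_proj_idem[OF nm(1)] kn by simp
    then have "n \<ominus> ker_proj n \<in> orth_compl H N" using iN i nm kn by auto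
    then have 1: "\<langle>n \<ominus> ker_proj n, n\<rangle> = 0" using n orth_complD by blast
    have "\<langle>V n, V n\<rangle> = 0" using polar_map_inner[OF nm(1) nm(1)] 1 by simp
    then have "V n = \<zero>" using inner_definite[OF polar_closed(4)[OF nm(1)]] by blast
    then show ?thesis
      using xe nm m0 eqI[OF m0] F(2)[OF nm(1) m0(1)] VB(2)[OF nm(1) m0(1)] by simp
  qed
  then have "graph_of H ?f = graph_of H V" by (auto simp: graph_of_def)
  then show ?thesis using Vf by simp
qed

theorem polar_part_eq: "polar_part H T = graph_of H V"
  unfolding polar_part_def op_abs_eq[OF T dense] closure_range
proof (rule the_equality)
  show "partial_isometry H (graph_of H V) \<and> initial_space H (graph_of H V) = {x \<in> \<H>. ker_proj x = \<zero>} \<and>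
    T = abs_graph H (resolvent H T) O graph_of H V"
    using polar_map_partial_isometry polar_map_initial_space factorization by blast
  show "V' = graph_of H V"
    if "partial_isometry H V' \<and> initial_space H V' = {x \<in> \<H>. ker_proj x = \<zero>} \<and>
      T = abs_graph H (resolvent H T) O V'" for V'
    using polar_unique that by blast
qed

end

end

end

section \<open>Measurable vector fields\<close>

sublocale measurable_hilbert_field \<subseteq> fib: hilbert_space "H \<zeta>" for \<zeta>
  by (rule fibre)

context measurable_hilbert_field
begin

abbreviation L2 where "L2 \<equiv> square_integrable \<omega> H S"
abbreviation cls where "cls \<equiv> field_class \<omega> H S"
abbreviation DI where "DI \<equiv> direct_integral \<omega> H S"

lemma S_mem [simp]: "x \<in> S \<Longrightarrow> x \<zeta> \<in> hcarrier (H \<zeta>)"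
  using fields by auto

text \<open>By maximality, measurability of a field is tested against the fields in \<open>S\<close>. All closure properties
  of \<open>S\<close> reduce to those of measurable scalar functions in this way.\<close>

lemma S_I:
  assumes "\<And>\<zeta>. v \<zeta> \<in> hcarrier (H \<zeta>)"
    "\<And>x. x \<in> S \<Longrightarrow> (\<lambda>\<zeta>. hinner (H \<zeta>) (x \<zeta>) (v \<zeta>)) \<in> borel_measurable \<omega>"
  shows "v \<in> S"
  using assms by (intro maximal) auto

lemma S_zero: "(\<lambda>\<zeta>. hzero (H \<zeta>)) \<in> S"
  by (rule S_I) simp_all

lemma S_add: "x \<in> S \<Longrightarrow> y \<in> S \<Longrightarrow> (\<lambda>\<zeta>. hadd (H \<zeta>) (x \<zeta>) (y \<zeta>)) \<in> S"
  by (rule S_I) (auto simp: fib.inner_simps intro!: borel_measurable_add inner_measurable)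

lemma S_scale: "x \<in> S \<Longrightarrow> f \<in> borel_measurable \<omega> \<Longrightarrow> (\<lambda>\<zeta>. hscale (H \<zeta>) (f \<zeta>) (x \<zeta>)) \<in> S"
proof (rule S_I)
  fix y assume x: "x \<in> S" and f: "f \<in> borel_measurable \<omega>" and y: "y \<in> S"
  have "(\<lambda>\<zeta>. cnj (f \<zeta>)) \<in> borel_measurable \<omega>"
    using f by (intro borel_measurable_continuous_on[where f = cnj]) (auto intro: continuous_intros)
  then show "(\<lambda>\<zeta>. hinner (H \<zeta>) (y \<zeta>) (hscale (H \<zeta>) (f \<zeta>) (x \<zeta>))) \<in> borel_measurable \<omega>"
    using x y by (auto simp: fib.inner_simps intro!: borel_measurable_times inner_measurable)
qed simp

lemma S_minus: "x \<in> S \<Longrightarrow> y \<in> S \<Longrightarrow> (\<lambda>\<zeta>. hminus (H \<zeta>) (x \<zeta>) (y \<zeta>)) \<in> S"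
  unfolding hminus_def by (intro S_add S_scale) simp_all

lemma S_lim:
  assumes f: "\<And>n. f n \<in> S" and l: "\<And>\<zeta>. hlim (H \<zeta>) (\<lambda>n. f n \<zeta>) (g \<zeta>)"
  shows "g \<in> S"
proof (rule S_I)
  show "g \<zeta> \<in> hcarrier (H \<zeta>)" for \<zeta> using fib.hlim_in l by blast
  fix x assume x: "x \<in> S"
  show "(\<lambda>\<zeta>. hinner (H \<zeta>) (x \<zeta>) (g \<zeta>)) \<in> borel_measurable \<omega>"
  proof (rule borel_measurable_LIMSEQ_metric)
    show "(\<lambda>\<zeta>. hinner (H \<zeta>) (x \<zeta>) (f n \<zeta>)) \<in> borel_measurable \<omega>" for n
      using inner_measurable x f by blast
    show "(\<lambda>n. hinner (H \<zeta>) (x \<zeta>) (f n \<zeta>)) \<longlonglongrightarrow> hinner (H \<zeta>) (x \<zeta>) (g \<zeta>)" for \<zeta>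
      by (rule fib.hlim_inner[OF _ l]) (use x in simp)
  qed
qed

lemma S_if: "x \<in> S \<Longrightarrow> y \<in> S \<Longrightarrow> A \<in> sets \<omega> \<Longrightarrow> (\<lambda>\<zeta>. if \<zeta> \<in> A then x \<zeta> else y \<zeta>) \<in> S"
proof (rule S_I)
  fix z assume x: "x \<in> S" and y: "y \<in> S" and A: "A \<in> sets \<omega>" and z: "z \<in> S"
  have "(\<lambda>\<zeta>. if \<zeta> \<in> A then hinner (H \<zeta>) (z \<zeta>) (x \<zeta>) else hinner (H \<zeta>) (z \<zeta>) (y \<zeta>)) \<in> borel_measurable \<omega>"
    using A by (intro measurable_If_set inner_measurable x y z) auto
  then show "(\<lambda>\<zeta>. hinner (H \<zeta>) (z \<zeta>) (if \<zeta> \<in> A then x \<zeta> else y \<zeta>)) \<in> borel_measurable \<omega>"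
    by (simp add: if_distrib cong: if_cong)
qed simp

lemma norm_measurable: "x \<in> S \<Longrightarrow> (\<lambda>\<zeta>. hnorm (H \<zeta>) (x \<zeta>)) \<in> borel_measurable \<omega>"
  unfolding hnorm_def using inner_measurable by measurable

lemma L2_S: "x \<in> L2 \<Longrightarrow> x \<in> S"
  and L2_integrable: "x \<in> L2 \<Longrightarrow> integrable \<omega> (\<lambda>\<zeta>. (hnorm (H \<zeta>) (x \<zeta>))\<^sup>2)"
  by (auto simp: square_integrable_def)

lemma L2_mem [simp]: "x \<in> L2 \<Longrightarrow> x \<zeta> \<in> hcarrier (H \<zeta>)"
  using L2_S S_mem by blast

lemma L2_bound:
  assumes x: "x \<in> S" and g: "integrable \<omega> g"
    and le: "AE \<zeta> in \<omega>. (hnorm (H \<zeta>) (x \<zeta>))\<^sup>2 \<le> g \<zeta>"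
  shows "x \<in> L2"
  unfolding square_integrable_def
proof (intro CollectI conjI x)
  show "integrable \<omega> (\<lambda>\<zeta>. (hnorm (H \<zeta>) (x \<zeta>))\<^sup>2)"
    using le by (intro Bochner_Integration.integrable_bound[OF g] borel_measurable_power norm_measurable x)
      (auto elim!: eventually_mono)
qed

lemma L2_zero: "(\<lambda>\<zeta>. hzero (H \<zeta>)) \<in> L2"
  using S_zero by (simp add: square_integrable_def)

lemma L2_add:
  assumes x: "x \<in> L2" and y: "y \<in> L2"
  shows "(\<lambda>\<zeta>. hadd (H \<zeta>) (x \<zeta>) (y \<zeta>)) \<in> L2"
proof (rule L2_bound)
  show "(\<lambda>\<zeta>. hadd (H \<zeta>) (x \<zeta>) (y \<zeta>)) \<in> S" by (intro S_add L2_S x y)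
  show "integrable \<omega> (\<lambda>\<zeta>. 2 * (hnorm (H \<zeta>) (x \<zeta>))\<^sup>2 + 2 * (hnorm (H \<zeta>) (y \<zeta>))\<^sup>2)"
    using L2_integrable x y by simp
  have "(hnorm (H \<zeta>) (hadd (H \<zeta>) (x \<zeta>) (y \<zeta>)))\<^sup>2 \<le> 2 * (hnorm (H \<zeta>) (x \<zeta>))\<^sup>2 + 2 * (hnorm (H \<zeta>) (y \<zeta>))\<^sup>2" for \<zeta>
    using fib.norm_add_sq[OF L2_mem[OF x] L2_mem[OF y], of \<zeta>]
      fib.norm_minus_sq[OF L2_mem[OF x] L2_mem[OF y], of \<zeta>]
      zero_le_power2[of "hnorm (H \<zeta>) (hminus (H \<zeta>) (x \<zeta>) (y \<zeta>))"] by argo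
  then show "AE \<zeta> in \<omega>. (hnorm (H \<zeta>) (hadd (H \<zeta>) (x \<zeta>) (y \<zeta>)))\<^sup>2
      \<le> 2 * (hnorm (H \<zeta>) (x \<zeta>))\<^sup>2 + 2 * (hnorm (H \<zeta>) (y \<zeta>))\<^sup>2" by simp
qed

lemma L2_bounded_image:
  assumes x: "x \<in> L2" and y: "y \<in> S" and K: "\<And>\<zeta>. hnorm (H \<zeta>) (y \<zeta>) \<le> K * hnorm (H \<zeta>) (x \<zeta>)"
  shows "y \<in> L2"
proof (rule L2_bound[OF y])
  show "integrable \<omega> (\<lambda>\<zeta>. K\<^sup>2 * (hnorm (H \<zeta>) (x \<zeta>))\<^sup>2)"
    using L2_integrable[OF x] by simp
  have "(hnorm (H \<zeta>) (y \<zeta>))\<^sup>2 \<le> (K * hnorm (H \<zeta>) (x \<zeta>))\<^sup>2" for \<zeta>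
    using K y by (intro power_mono) auto
  then show "AE \<zeta> in \<omega>. (hnorm (H \<zeta>) (y \<zeta>))\<^sup>2 \<le> K\<^sup>2 * (hnorm (H \<zeta>) (x \<zeta>))\<^sup>2"
    by (simp add: power_mult_distrib)
qed

lemma L2_scale: "x \<in> L2 \<Longrightarrow> (\<lambda>\<zeta>. hscale (H \<zeta>) c (x \<zeta>)) \<in> L2"
  by (rule L2_bounded_image[where x = x and K = "cmod c"]) (simp_all add: S_scale L2_S fib.norm_scale)

lemma L2_minus: "x \<in> L2 \<Longrightarrow> y \<in> L2 \<Longrightarrow> (\<lambda>\<zeta>. hminus (H \<zeta>) (x \<zeta>) (y \<zeta>)) \<in> L2"
  unfolding hminus_def by (intro L2_add L2_scale)

lemma inner_integrable:
  assumes x: "x \<in> L2" and y: "y \<in> L2"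
  shows "integrable \<omega> (\<lambda>\<zeta>. hinner (H \<zeta>) (x \<zeta>) (y \<zeta>))"
proof (rule Bochner_Integration.integrable_bound)
  show "integrable \<omega> (\<lambda>\<zeta>. (hnorm (H \<zeta>) (x \<zeta>))\<^sup>2 + (hnorm (H \<zeta>) (y \<zeta>))\<^sup>2)"
    using L2_integrable x y by simp
  have "norm (hinner (H \<zeta>) (x \<zeta>) (y \<zeta>)) \<le> norm ((hnorm (H \<zeta>) (x \<zeta>))\<^sup>2 + (hnorm (H \<zeta>) (y \<zeta>))\<^sup>2)" for \<zeta>
  proof -
    have "cmod (hinner (H \<zeta>) (x \<zeta>) (y \<zeta>)) \<le> hnorm (H \<zeta>) (x \<zeta>) * hnorm (H \<zeta>) (y \<zeta>)"
      using x y by (intro fib.cauchy_schwarz) auto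
    moreover have "0 \<le> hnorm (H \<zeta>) (x \<zeta>) * hnorm (H \<zeta>) (y \<zeta>)"
      using x y by (intro mult_nonneg_nonneg) auto
    moreover have "0 \<le> (hnorm (H \<zeta>) (x \<zeta>) - hnorm (H \<zeta>) (y \<zeta>))\<^sup>2" by simp
    ultimately show ?thesis unfolding power2_diff real_norm_def by argo
  qed
  then show "AE \<zeta> in \<omega>. norm (hinner (H \<zeta>) (x \<zeta>) (y \<zeta>))
      \<le> norm ((hnorm (H \<zeta>) (x \<zeta>))\<^sup>2 + (hnorm (H \<zeta>) (y \<zeta>))\<^sup>2)" by simp
qed (intro inner_measurable L2_S x y)

section \<open>The direct integral as a Hilbert space\<close>

lemma equiv_ae_eq: "equiv L2 (ae_eq \<omega> H S)"
proof (rule equivI)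
  show "ae_eq \<omega> H S \<subseteq> L2 \<times> L2" by (auto simp: ae_eq_def)
  show "refl_on L2 (ae_eq \<omega> H S)" by (auto simp: refl_on_def ae_eq_def)
  show "sym (ae_eq \<omega> H S)" by (auto simp: sym_def ae_eq_def eq_commute elim!: eventually_mono)
  show "trans (ae_eq \<omega> H S)"
  proof (rule transI)
    fix x y z assume "(x, y) \<in> ae_eq \<omega> H S" "(y, z) \<in> ae_eq \<omega> H S"
    then have "x \<in> L2" "z \<in> L2" "AE \<zeta> in \<omega>. x \<zeta> = y \<zeta>" "AE \<zeta> in \<omega>. y \<zeta> = z \<zeta>" by (auto simp: ae_eq_def)
    moreover from this(3,4) have "AE \<zeta> in \<omega>. x \<zeta> = z \<zeta>" by eventually_elim simp
    ultimately show "(x, z) \<in> ae_eq \<omega> H S" by (simp add: ae_eq_def)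
  qed
qed

lemma carrier_DI: "X \<in> hcarrier DI \<longleftrightarrow> (\<exists>x\<in>L2. X = cls x)"
  by (auto simp: direct_integral_def quotient_def field_class_def)

lemma cls_mem [simp]: "x \<in> L2 \<Longrightarrow> cls x \<in> hcarrier DI"
  using carrier_DI by blast

lemma cls_eq_iff: "x \<in> L2 \<Longrightarrow> y \<in> L2 \<Longrightarrow> cls x = cls y \<longleftrightarrow> (AE \<zeta> in \<omega>. x \<zeta> = y \<zeta>)"
  using eq_equiv_class_iff[OF equiv_ae_eq] by (simp add: field_class_def ae_eq_def)

lemma rep_cls:
  assumes x: "x \<in> L2"
  shows "field_rep (cls x) \<in> L2" "AE \<zeta> in \<omega>. field_rep (cls x) \<zeta> = x \<zeta>"
proof -
  have "x \<in> cls x" using equiv_class_self[OF equiv_ae_eq x] by (simp add: field_class_def)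
  then have "field_rep (cls x) \<in> cls x" unfolding field_rep_def by (rule someI[of "\<lambda>y. y \<in> cls x"])
  then have "(x, field_rep (cls x)) \<in> ae_eq \<omega> H S" by (simp add: field_class_def)
  then show "field_rep (cls x) \<in> L2" "AE \<zeta> in \<omega>. field_rep (cls x) \<zeta> = x \<zeta>"
    by (auto simp: ae_eq_def elim!: eventually_mono)
qed

lemma DI_zero: "hzero DI = cls (\<lambda>\<zeta>. hzero (H \<zeta>))"
  by (simp add: direct_integral_def)

text \<open>The operations of the direct integral use chosen representatives; this rule and its
  analogues below allow arbitrary ones.\<close>

lemma DI_add:
  assumes x: "x \<in> L2" and y: "y \<in> L2"
  shows "hadd DI (cls x) (cls y) = cls (\<lambda>\<zeta>. hadd (H \<zeta>) (x \<zeta>) (y \<zeta>))"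
proof -
  have "AE \<zeta> in \<omega>. hadd (H \<zeta>) (field_rep (cls x) \<zeta>) (field_rep (cls y) \<zeta>) = hadd (H \<zeta>) (x \<zeta>) (y \<zeta>)"
    using rep_cls(2)[OF x] rep_cls(2)[OF y] by eventually_elim simp
  then show ?thesis
    unfolding direct_integral_def using rep_cls(1) x y by (simp add: cls_eq_iff L2_add)
qed

lemma DI_scale:
  assumes x: "x \<in> L2"
  shows "hscale DI c (cls x) = cls (\<lambda>\<zeta>. hscale (H \<zeta>) c (x \<zeta>))"
proof -
  have "AE \<zeta> in \<omega>. hscale (H \<zeta>) c (field_rep (cls x) \<zeta>) = hscale (H \<zeta>) c (x \<zeta>)"
    using rep_cls(2)[OF x] by eventually_elim simp
  then show ?thesis
    unfolding direct_integral_def using rep_cls(1) x by (simp add: cls_eq_iff L2_scale)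
qed

lemma DI_minus:
  assumes x: "x \<in> L2" and y: "y \<in> L2"
  shows "hminus DI (cls x) (cls y) = cls (\<lambda>\<zeta>. hminus (H \<zeta>) (x \<zeta>) (y \<zeta>))"
  using x y by (simp add: hminus_def DI_add DI_scale L2_scale)

lemma DI_inner:
  assumes x: "x \<in> L2" and y: "y \<in> L2"
  shows "hinner DI (cls x) (cls y) = (\<integral>\<zeta>. hinner (H \<zeta>) (x \<zeta>) (y \<zeta>) \<partial>\<omega>)"
proof -
  have "(\<integral>\<zeta>. hinner (H \<zeta>) (field_rep (cls x) \<zeta>) (field_rep (cls y) \<zeta>) \<partial>\<omega>) = (\<integral>\<zeta>. hinner (H \<zeta>) (x \<zeta>) (y \<zeta>) \<partial>\<omega>)"
  proof (rule integral_cong_AE)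
    show "AE \<zeta> in \<omega>. hinner (H \<zeta>) (field_rep (cls x) \<zeta>) (field_rep (cls y) \<zeta>) = hinner (H \<zeta>) (x \<zeta>) (y \<zeta>)"
      using rep_cls(2)[OF x] rep_cls(2)[OF y] by eventually_elim simp
  qed (intro inner_measurable L2_S rep_cls x y)+
  then show ?thesis by (simp add: direct_integral_def)
qed

lemma DI_inner_self:
  assumes x: "x \<in> L2"
  shows "hinner DI (cls x) (cls x) = complex_of_real (\<integral>\<zeta>. (hnorm (H \<zeta>) (x \<zeta>))\<^sup>2 \<partial>\<omega>)"
proof -
  have "hinner DI (cls x) (cls x) = (\<integral>\<zeta>. complex_of_real ((hnorm (H \<zeta>) (x \<zeta>))\<^sup>2) \<partial>\<omega>)"
    unfolding DI_inner[OF x x] using x by (simp add: fib.inner_self)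
  then show ?thesis by (simp only: integral_complex_of_real)
qed

lemma cls_zero_iff: 
  assumes x: "x \<in> L2"
  shows "(\<integral>\<zeta>. (hnorm (H \<zeta>) (x \<zeta>))\<^sup>2 \<partial>\<omega>) = 0 \<longleftrightarrow> (AE \<zeta> in \<omega>. x \<zeta> = hzero (H \<zeta>))"
proof -
  have "(\<integral>\<zeta>. (hnorm (H \<zeta>) (x \<zeta>))\<^sup>2 \<partial>\<omega>) = 0 \<longleftrightarrow> (AE \<zeta> in \<omega>. (hnorm (H \<zeta>) (x \<zeta>))\<^sup>2 = 0)"
    by (rule integral_nonneg_eq_0_iff_AE[OF L2_integrable[OF x]]) simp
  then show ?thesis using x by simp
qed

lemma inner_space_DI: "inner_space DI"
proof
  note simps = DI_add DI_scale DI_minus DI_zero L2_add L2_scale L2_zero L2_minus cls_eq_iff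
  show "hzero DI \<in> hcarrier DI" by (simp add: simps)
  fix X Y Z c d assume "X \<in> hcarrier DI"
  then obtain x where x: "x \<in> L2" "X = cls x" using carrier_DI by blast
  show "hscale DI c X \<in> hcarrier DI" using x by (simp add: simps)
  show "hadd DI X (hzero DI) = X" using x by (simp add: simps)
  show "hminus DI X X = hzero DI" using x by (simp add: simps)
  show "hscale DI (c + d) X = hadd DI (hscale DI c X) (hscale DI d X)"
    using x by (simp add: simps fib.scale_add_left)
  show "hscale DI c (hscale DI d X) = hscale DI (c * d) X"
    using x by (simp add: simps fib.scale_scale)
  show "hscale DI 1 X = X" using x by (simp add: simps fib.scale_one)
  show "0 \<le> Re (hinner DI X X)" using x by (simp add: DI_inner_self)
  show "hinner DI X X = 0 \<Longrightarrow> X = hzero DI"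
    using x by (simp add: DI_inner_self cls_zero_iff simps)
  assume "Y \<in> hcarrier DI"
  then obtain y where y: "y \<in> L2" "Y = cls y" using carrier_DI by blast
  show "hadd DI X Y \<in> hcarrier DI" using x y by (simp add: simps)
  show "hadd DI X Y = hadd DI Y X" using x y by (simp add: simps fib.add_commute)
  show "hscale DI c (hadd DI X Y) = hadd DI (hscale DI c X) (hscale DI c Y)"
    using x y by (simp add: simps fib.scale_add_right)
  show "hinner DI Y X = cnj (hinner DI X Y)"
  proof -
    have "(\<integral>\<zeta>. hinner (H \<zeta>) (y \<zeta>) (x \<zeta>) \<partial>\<omega>) = (\<integral>\<zeta>. cnj (hinner (H \<zeta>) (x \<zeta>) (y \<zeta>)) \<partial>\<omega>)"
      by (intro Bochner_Integration.integral_cong refl fib.inner_commute) (use x y in auto)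
    then show ?thesis using x y by (simp add: DI_inner integral_cnj)
  qed
  show "hinner DI (hscale DI c X) Y = c * hinner DI X Y"
    using x y by (simp add: DI_inner simps fib.inner_scale_left)
  assume "Z \<in> hcarrier DI"
  then obtain z where z: "z \<in> L2" "Z = cls z" using carrier_DI by blast
  show "hadd DI (hadd DI X Y) Z = hadd DI X (hadd DI Y Z)"
    using x y z by (simp add: simps fib.add_assoc)
  show "hinner DI (hadd DI X Y) Z = hinner DI X Z + hinner DI Y Z"
    using x y z by (simp add: DI_inner simps fib.inner_add_left inner_integrable)
qed

lemma DI_norm_sq: "x \<in> L2 \<Longrightarrow> (hnorm DI (cls x))\<^sup>2 = (\<integral>\<zeta>. (hnorm (H \<zeta>) (x \<zeta>))\<^sup>2 \<partial>\<omega>)"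
  using inner_space.norm_sq[OF inner_space_DI, of "cls x"] by (simp add: DI_inner_self)

lemma DI_hlimI:
  assumes f: "\<And>n. f n \<in> L2" and g: "g \<in> L2"
    and l: "(\<lambda>n. \<integral>\<zeta>. (hnorm (H \<zeta>) (hminus (H \<zeta>) (f n \<zeta>) (g \<zeta>)))\<^sup>2 \<partial>\<omega>) \<longlonglongrightarrow> 0"
  shows "hlim DI (\<lambda>n. cls (f n)) (cls g)"
proof -
  interpret I: inner_space DI by (rule inner_space_DI)
  have "(\<lambda>n. sqrt ((I.nm (hminus DI (cls (f n)) (cls g)))\<^sup>2)) \<longlonglongrightarrow> sqrt 0"
    using l f g by (intro tendsto_real_sqrt) (simp add: DI_norm_sq DI_minus L2_minus)
  moreover have "sqrt ((I.nm (hminus DI (cls (f n)) (cls g)))\<^sup>2) = I.nm (hminus DI (cls (f n)) (cls g))" for n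
    using f g by (intro real_sqrt_unique) auto
  ultimately show ?thesis using f g by (simp add: hlim_def)
qed

text \<open>Riesz-Fischer. Along a subsequence \<open>g\<close> with \<open>\<parallel>g\<^sub>j\<^sub>+\<^sub>1 - g\<^sub>j\<parallel>\<^sup>2 \<le> 8\<^sup>-\<^sup>j\<close> the function
  \<open>h = \<Sum> 4\<^sup>j \<parallel>g\<^sub>j\<^sub>+\<^sub>1(\<zeta>) - g\<^sub>j(\<zeta>)\<parallel>\<^sup>2\<close> is integrable. Where it is finite, single steps are at most
  \<open>h\<^sup>1\<^sup>/\<^sup>2 2\<^sup>-\<^sup>j\<close>, so the fields converge pointwise, and the squared distance to the limit has the
  integrable bound \<open>4 h 4\<^sup>-\<^sup>j\<close>, which also gives convergence in the direct integral.\<close>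

theorem hilbert_space_DI: "hilbert_space DI"
proof -
  interpret I: inner_space DI by (rule inner_space_DI)
  show ?thesis
  proof (rule I.hilbert_spaceI)
    fix F assume F: "I.hcauchy F"
    then have Fm: "F n \<in> hcarrier DI" for n by (simp add: I.hcauchy_def)
    then have "\<forall>n. \<exists>x\<in>L2. F n = cls x" using carrier_DI by blast
    then obtain f where f: "\<And>n. f n \<in> L2" "\<And>n. F n = cls (f n)" by metis
    have "\<exists>N. \<forall>m\<ge>N. \<forall>n\<ge>N. I.nm (hminus DI (F m) (F n)) < sqrt ((1/8)^j)" for j
      using F by (auto simp: I.hcauchy_def)
    then obtain N where N: "\<And>j m n. m \<ge> N j \<Longrightarrow> n \<ge> N j \<Longrightarrow> I.nm (hminus DI (F m) (F n)) < sqrt ((1/8)^j)"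
      by metis
    \<comment> \<open>Partial sums turn the thresholds \<open>N j\<close> into an increasing sequence above them.\<close>
    define k where "k j = (\<Sum>i\<le>j. N i)" for j
    have kN': "N i \<le> k j" if "i \<le> j" for i j
      unfolding k_def using that by (intro member_le_sum) auto
    have kN: "N j \<le> k j" "N j \<le> k (Suc j)" for j by (auto intro: kN')
    define g where "g j = f (k j)" for j
    have g: "g j \<in> L2" for j using f by (simp add: g_def)
    define d where "d j \<zeta> = (hnorm (H \<zeta>) (hminus (H \<zeta>) (g (Suc j) \<zeta>) (g j \<zeta>)))\<^sup>2" for j \<zeta>
    have dint: "integrable \<omega> (d j)" for j
      unfolding d_def by (intro L2_integrable[OF L2_minus] g)
    have dn: "0 \<le> d j \<zeta>" for j \<zeta> by (simp add: d_def)
    have "(\<integral>\<zeta>. d j \<zeta> \<partial>\<omega>) \<le> (1/8)^j" for j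
    proof -
      have "(\<integral>\<zeta>. d j \<zeta> \<partial>\<omega>) = (I.nm (hminus DI (F (k (Suc j))) (F (k j))))\<^sup>2"
        using f by (simp add: d_def g_def DI_minus DI_norm_sq L2_minus)
      also have "\<dots> \<le> (sqrt ((1/8)^j))\<^sup>2"
        using N[OF kN(2) kN(1)] Fm by (intro power_mono) (auto intro: less_imp_le)
      finally show ?thesis by simp
    qed
    then have dle: "(\<integral>\<^sup>+\<zeta>. ennreal (d j \<zeta>) \<partial>\<omega>) \<le> ennreal ((1/8)^j)" for j
      using dint dn by (subst nn_integral_eq_integral) (auto intro: ennreal_leI)
    define h where "h \<zeta> = (\<Sum>j. ennreal (4^j * d j \<zeta>))" for \<zeta>
    have dm: "d j \<in> borel_measurable \<omega>" for j using dint by blast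
    have hm: "h \<in> borel_measurable \<omega>" unfolding h_def using dm by measurable
    have "(\<integral>\<^sup>+\<zeta>. h \<zeta> \<partial>\<omega>) = (\<Sum>j. \<integral>\<^sup>+\<zeta>. ennreal (4^j * d j \<zeta>) \<partial>\<omega>)"
      unfolding h_def using dm by (intro nn_integral_suminf) measurable
    also have "\<dots> \<le> (\<Sum>j. ennreal ((1/2)^j))"
    proof (rule suminf_le)
      fix j
      have "(\<integral>\<^sup>+\<zeta>. ennreal (4^j * d j \<zeta>) \<partial>\<omega>) = ennreal (4^j) * (\<integral>\<^sup>+\<zeta>. ennreal (d j \<zeta>) \<partial>\<omega>)"
        using dm dn by (subst nn_integral_cmult[symmetric]) (auto simp: ennreal_mult)
      also have "\<dots> \<le> ennreal (4^j) * ennreal ((1/8)^j)" by (intro mult_left_mono dle) simp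
      also have "\<dots> = ennreal ((1/2)^j)"
        by (simp add: ennreal_mult[symmetric] power_mult_distrib[symmetric])
      finally show "(\<integral>\<^sup>+\<zeta>. ennreal (4^j * d j \<zeta>) \<partial>\<omega>) \<le> ennreal ((1/2)^j)" .
    qed auto
    also have "\<dots> = ennreal (\<Sum>j. (1/2)^j)" by (intro suminf_ennreal2) auto
    also have "\<dots> < \<infinity>" by simp
    finally have hfin: "(\<integral>\<^sup>+\<zeta>. h \<zeta> \<partial>\<omega>) < \<infinity>" .
    then have hAE: "AE \<zeta> in \<omega>. h \<zeta> < \<infinity>"
      using nn_integral_PInf_AE[OF hm] by (auto simp: top.not_eq_extremum)
    \<comment> \<open>On the null set where \<open>h\<close> is infinite the value \<open>0\<close> is harmless.\<close>
    define h' where "h' \<zeta> = enn2real (h \<zeta>)" for \<zeta>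
    have h'int: "integrable \<omega> h'"
    proof (rule integrableI_nonneg)
      show "h' \<in> borel_measurable \<omega>" unfolding h'_def using hm by measurable
      have "(\<integral>\<^sup>+\<zeta>. ennreal (h' \<zeta>) \<partial>\<omega>) = (\<integral>\<^sup>+\<zeta>. h \<zeta> \<partial>\<omega>)"
        using hAE by (intro nn_integral_cong_AE) (auto simp: h'_def elim!: eventually_mono)
      then show "(\<integral>\<^sup>+\<zeta>. ennreal (h' \<zeta>) \<partial>\<omega>) < \<infinity>" using hfin by simp
    qed (simp add: h'_def)
    have h'n: "0 \<le> h' \<zeta>" for \<zeta> by (simp add: h'_def)
    have step: "hnorm (H \<zeta>) (hminus (H \<zeta>) (g (Suc j) \<zeta>) (g j \<zeta>)) \<le> sqrt (h' \<zeta>) * (1/2)^j" if fin: "h \<zeta> < \<infinity>" for j \<zeta>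
    proof -
      have "ennreal (4^j * d j \<zeta>) \<le> h \<zeta>"
        unfolding h_def using sum_le_suminf[of "\<lambda>j. ennreal (4^j * d j \<zeta>)" "{j}"] by auto
      then have "enn2real (ennreal (4^j * d j \<zeta>)) \<le> h' \<zeta>"
        unfolding h'_def using fin by (intro enn2real_mono) auto
      then have "4^j * d j \<zeta> \<le> h' \<zeta>" using dn by simp
      then have "sqrt (4^j * d j \<zeta>) \<le> sqrt (h' \<zeta>)" by simp
      moreover have "sqrt (4^j * d j \<zeta>) = 2^j * hnorm (H \<zeta>) (hminus (H \<zeta>) (g (Suc j) \<zeta>) (g j \<zeta>))"
        using g real_sqrt_power[of 4 j] unfolding d_def real_sqrt_mult by simp
      ultimately have "2^j * hnorm (H \<zeta>) (hminus (H \<zeta>) (g (Suc j) \<zeta>) (g j \<zeta>)) \<le> sqrt (h' \<zeta>)" by argo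
      then show ?thesis by (simp add: field_simps power_one_over)
    qed
    have tail: "hnorm (H \<zeta>) (hminus (H \<zeta>) (g (j + i) \<zeta>) (g j \<zeta>)) \<le> sqrt (h' \<zeta>) * (2 * (1/2)^j - 2 * (1/2)^(j + i))"
      if fin: "h \<zeta> < \<infinity>" for i j \<zeta>
    proof (induction i)
      case (Suc i)
      have "hnorm (H \<zeta>) (hminus (H \<zeta>) (g (j + Suc i) \<zeta>) (g j \<zeta>))
        \<le> hnorm (H \<zeta>) (hminus (H \<zeta>) (g (Suc (j + i)) \<zeta>) (g (j + i) \<zeta>)) + hnorm (H \<zeta>) (hminus (H \<zeta>) (g (j + i) \<zeta>) (g j \<zeta>))"
        using fib.norm_triangle_minus[of "g (Suc (j + i)) \<zeta>" \<zeta> "g (j + i) \<zeta>" "g j \<zeta>"] g by simp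
      also have "\<dots> \<le> sqrt (h' \<zeta>) * (1/2)^(j + i) + sqrt (h' \<zeta>) * (2 * (1/2)^j - 2 * (1/2)^(j + i))"
        by (intro add_mono step fin Suc)
      also have "\<dots> = sqrt (h' \<zeta>) * (2 * (1/2)^j - 2 * (1/2)^(j + Suc i))"
        by (simp add: algebra_simps)
      finally show ?case .
    qed (use g in simp)
    have tail2: "hnorm (H \<zeta>) (hminus (H \<zeta>) (g m \<zeta>) (g j \<zeta>)) \<le> sqrt (h' \<zeta>) * (2 * (1/2)^j)"
      if fin: "h \<zeta> < \<infinity>" and jm: "j \<le> m" for m j \<zeta>
    proof -
      obtain i where "m = j + i" using jm le_iff_add by blast
      then have "hnorm (H \<zeta>) (hminus (H \<zeta>) (g m \<zeta>) (g j \<zeta>)) \<le> sqrt (h' \<zeta>) * (2 * (1/2)^j - 2 * (1/2)^(j + i))"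
        using tail[OF fin] by simp
      also have "\<dots> \<le> sqrt (h' \<zeta>) * (2 * (1/2)^j)" using h'n by (intro mult_left_mono) auto
      finally show ?thesis .
    qed
    define A where "A = {\<zeta> \<in> space \<omega>. h \<zeta> < \<infinity>}"
    have A: "A \<in> sets \<omega>" unfolding A_def using hm by measurable
    define g' where "g' j \<zeta> = (if \<zeta> \<in> A then g j \<zeta> else hzero (H \<zeta>))" for j \<zeta>
    have g'S: "g' j \<in> S" for j unfolding g'_def by (intro S_if L2_S g S_zero A)
    have zero_lim: "(\<lambda>j. sqrt (h' \<zeta>) * (2 * (1/2)^j)) \<longlonglongrightarrow> 0" for \<zeta>
    proof -
      have "(\<lambda>j. sqrt (h' \<zeta>) * (2 * (1/2)^j)) \<longlonglongrightarrow> sqrt (h' \<zeta>) * (2 * 0)"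
        by (intro tendsto_intros) auto
      then show ?thesis by simp
    qed
    have "\<exists>x. hlim (H \<zeta>) (\<lambda>j. g' j \<zeta>) x" for \<zeta>
    proof (cases "\<zeta> \<in> A")
      case True
      then have fin: "h \<zeta> < \<infinity>" by (simp add: A_def)
      have "fib.hcauchy \<zeta> (\<lambda>j. g j \<zeta>)"
      proof (rule fib.hcauchyI[where r = "\<lambda>j. sqrt (h' \<zeta>) * (2 * (1/2)^j)"])
        fix m n
        have nn: "0 \<le> sqrt (h' \<zeta>) * (2 * (1/2)^j)" for j :: nat using h'n by simp
        show "hnorm (H \<zeta>) (hminus (H \<zeta>) (g m \<zeta>) (g n \<zeta>)) \<le> sqrt (h' \<zeta>) * (2 * (1/2)^m) + sqrt (h' \<zeta>) * (2 * (1/2)^n)"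
        proof (cases "n \<le> m")
          case True then show ?thesis using tail2[OF fin True] nn[of m] by linarith
        next
          case False
          then have "m \<le> n" by simp
          then show ?thesis
            using tail2[OF fin \<open>m \<le> n\<close>] nn[of n] fib.norm_minus_commute[of "g m \<zeta>" \<zeta> "g n \<zeta>"] g by simp
        qed
      qed (use g zero_lim in auto)
      then show ?thesis using fib.hcauchy_lim True by (simp add: g'_def)
    next
      case False
      then have "hlim (H \<zeta>) (\<lambda>j. g' j \<zeta>) (hzero (H \<zeta>))" by (simp add: g'_def)
      then show ?thesis ..
    qed
    then obtain x where x: "\<And>\<zeta>. hlim (H \<zeta>) (\<lambda>j. g' j \<zeta>) (x \<zeta>)" by metis
    have xS: "x \<in> S" by (rule S_lim[OF g'S x])
    have err: "(hnorm (H \<zeta>) (hminus (H \<zeta>) (g j \<zeta>) (x \<zeta>)))\<^sup>2 \<le> h' \<zeta> * (4 * (1/4)^j)" if \<zeta>: "\<zeta> \<in> A" for \<zeta> j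
    proof -
      have fin: "h \<zeta> < \<infinity>" using \<zeta> by (simp add: A_def)
      have gl: "hlim (H \<zeta>) (\<lambda>m. g m \<zeta>) (x \<zeta>)" using x[of \<zeta>] \<zeta> by (simp add: g'_def)
      have "hnorm (H \<zeta>) (hminus (H \<zeta>) (x \<zeta>) (g j \<zeta>)) \<le> sqrt (h' \<zeta>) * (2 * (1/2)^j)"
      proof (rule LIMSEQ_le_const2)
        show "(\<lambda>m. hnorm (H \<zeta>) (hminus (H \<zeta>) (g m \<zeta>) (g j \<zeta>))) \<longlonglongrightarrow> hnorm (H \<zeta>) (hminus (H \<zeta>) (x \<zeta>) (g j \<zeta>))"
          using g by (intro fib.hlim_norm fib.hlim_minus gl) simp
        show "\<exists>N. \<forall>n\<ge>N. hnorm (H \<zeta>) (hminus (H \<zeta>) (g n \<zeta>) (g j \<zeta>)) \<le> sqrt (h' \<zeta>) * (2 * (1/2)^j)"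
          using tail2[OF fin] by blast
      qed
      then have "(hnorm (H \<zeta>) (hminus (H \<zeta>) (x \<zeta>) (g j \<zeta>)))\<^sup>2 \<le> (sqrt (h' \<zeta>) * (2 * (1/2)^j))\<^sup>2"
        using xS g by (intro power_mono) auto
      also have "\<dots> = h' \<zeta> * (4 * (1/4)^j)"
      proof -
        have "((1/2::real)^j)\<^sup>2 = (1/4)^j" by (simp add: power2_eq_square flip: power_mult_distrib)
        then show ?thesis using h'n by (simp only: power_mult_distrib real_sqrt_pow2) simp
      qed
      finally show ?thesis using fib.norm_minus_commute[of "x \<zeta>" \<zeta> "g j \<zeta>"] xS g by simp
    qed
    have AAE: "AE \<zeta> in \<omega>. \<zeta> \<in> A" using hAE by (auto simp: A_def)
    have diffL2: "(\<lambda>\<zeta>. hminus (H \<zeta>) (g j \<zeta>) (x \<zeta>)) \<in> L2" for j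
    proof (rule L2_bound)
      show "(\<lambda>\<zeta>. hminus (H \<zeta>) (g j \<zeta>) (x \<zeta>)) \<in> S" by (intro S_minus L2_S g xS)
      show "integrable \<omega> (\<lambda>\<zeta>. h' \<zeta> * (4 * (1/4)^j))" using h'int by simp
      show "AE \<zeta> in \<omega>. (hnorm (H \<zeta>) (hminus (H \<zeta>) (g j \<zeta>) (x \<zeta>)))\<^sup>2 \<le> h' \<zeta> * (4 * (1/4)^j)"
        using AAE by eventually_elim (rule err)
    qed
    have "x = (\<lambda>\<zeta>. hminus (H \<zeta>) (g 0 \<zeta>) (hminus (H \<zeta>) (g 0 \<zeta>) (x \<zeta>)))"
      using xS g by (intro ext fib.vec_eqI) (auto simp: fib.inner_simps)
    then have xL2: "x \<in> L2" using L2_minus[OF g diffL2, of 0 0] by simp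
    have bound: "(\<integral>\<zeta>. (hnorm (H \<zeta>) (hminus (H \<zeta>) (g j \<zeta>) (x \<zeta>)))\<^sup>2 \<partial>\<omega>) \<le> (\<integral>\<zeta>. h' \<zeta> \<partial>\<omega>) * (4 * (1/4)^j)" for j
    proof -
      have "(\<integral>\<zeta>. (hnorm (H \<zeta>) (hminus (H \<zeta>) (g j \<zeta>) (x \<zeta>)))\<^sup>2 \<partial>\<omega>) \<le> (\<integral>\<zeta>. h' \<zeta> * (4 * (1/4)^j) \<partial>\<omega>)"
        using AAE by (intro integral_mono_AE L2_integrable diffL2) (auto simp: h'int intro: err elim!: eventually_mono)
      then show ?thesis by simp
    qed
    have lim0: "(\<lambda>j. (\<integral>\<zeta>. h' \<zeta> \<partial>\<omega>) * (4 * (1/4)^j)) \<longlonglongrightarrow> 0"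
    proof -
      have "(\<lambda>j. (\<integral>\<zeta>. h' \<zeta> \<partial>\<omega>) * (4 * (1/4)^j)) \<longlonglongrightarrow> (\<integral>\<zeta>. h' \<zeta> \<partial>\<omega>) * (4 * 0)"
        by (intro tendsto_intros) auto
      then show ?thesis by simp
    qed
    have "hlim DI (\<lambda>j. cls (g j)) (cls x)"
      by (rule DI_hlimI[OF g xL2], rule tendsto_sandwich[OF _ _ tendsto_const lim0]) (auto simp: bound)
    then have sub: "(\<lambda>j. I.nm (hminus DI (F (k j)) (cls x))) \<longlonglongrightarrow> 0"
      using f by (simp add: hlim_def g_def)
    have "(\<lambda>n. I.nm (hminus DI (F n) (cls x))) \<longlonglongrightarrow> 0"
    proof (rule LIMSEQ_I)
      fix e :: real assume e: "0 < e"
      have rl: "(\<lambda>j. sqrt ((1/8)^j)) \<longlonglongrightarrow> sqrt 0" by (intro tendsto_real_sqrt LIMSEQ_realpow_zero) auto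
      have "eventually (\<lambda>j. I.nm (hminus DI (F (k j)) (cls x)) < e / 2) sequentially"
        using e by (intro order_tendstoD(2)[OF sub]) simp
      moreover have "eventually (\<lambda>j. sqrt ((1/8)^j) < e / 2) sequentially"
        using e by (intro order_tendstoD(2)[OF rl]) simp
      ultimately obtain j where j: "I.nm (hminus DI (F (k j)) (cls x)) < e / 2" "sqrt ((1/8)^j) < e / 2"
        using eventually_happens'[OF sequentially_bot eventually_conj] by blast
      have "norm (I.nm (hminus DI (F n) (cls x)) - 0) < e" if n: "n \<ge> N j" for n
        using I.norm_triangle_minus[of "F n" "F (k j)" "cls x"] Fm xL2 N[OF n kN(1)] j by simp
      then show "\<exists>no. \<forall>n\<ge>no. norm (I.nm (hminus DI (F n) (cls x)) - 0) < e" by blast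
    qed
    then have "hlim DI F (cls x)" using Fm xL2 by (simp add: hlim_def)
    then show "\<exists>X. hlim DI F X" ..
  qed
qed

end

context measurable_hilbert_field
begin

interpretation DI: hilbert_space DI
  by (rule hilbert_space_DI)

section \<open>Operators that act fibrewise\<close>

text \<open>The bounded operator \<open>b\<close> on the direct integral is the direct integral of the field \<open>bf\<close>. The
  boundedness of the field is part of the notion because it keeps \<open>bf\<close> inside the square integrable
  fields.\<close>

definition decomposes :: "(('z \<Rightarrow> 'a) set \<Rightarrow> ('z \<Rightarrow> 'a) set) \<Rightarrow> ('z \<Rightarrow> 'a \<Rightarrow> 'a) \<Rightarrow> bool" where
  "decomposes b bf \<longleftrightarrow> (\<forall>\<zeta>. \<forall>u\<in>hcarrier (H \<zeta>). bf \<zeta> u \<in> hcarrier (H \<zeta>))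
     \<and> (\<exists>K. \<forall>\<zeta>. \<forall>u\<in>hcarrier (H \<zeta>). hnorm (H \<zeta>) (bf \<zeta> u) \<le> K * hnorm (H \<zeta>) u)
     \<and> (\<forall>x\<in>S. (\<lambda>\<zeta>. bf \<zeta> (x \<zeta>)) \<in> S)
     \<and> (\<forall>x\<in>L2. b (cls x) = cls (\<lambda>\<zeta>. bf \<zeta> (x \<zeta>)))"

lemma decomposesD:
  assumes "decomposes b bf"
  shows "u \<in> hcarrier (H \<zeta>) \<Longrightarrow> bf \<zeta> u \<in> hcarrier (H \<zeta>)"
    "x \<in> S \<Longrightarrow> (\<lambda>\<zeta>. bf \<zeta> (x \<zeta>)) \<in> S"
    "x \<in> L2 \<Longrightarrow> b (cls x) = cls (\<lambda>\<zeta>. bf \<zeta> (x \<zeta>))"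
    "x \<in> L2 \<Longrightarrow> (\<lambda>\<zeta>. bf \<zeta> (x \<zeta>)) \<in> L2"
proof -
  show 1: "u \<in> hcarrier (H \<zeta>) \<Longrightarrow> bf \<zeta> u \<in> hcarrier (H \<zeta>)"
    "x \<in> S \<Longrightarrow> (\<lambda>\<zeta>. bf \<zeta> (x \<zeta>)) \<in> S"
    "x \<in> L2 \<Longrightarrow> b (cls x) = cls (\<lambda>\<zeta>. bf \<zeta> (x \<zeta>))" for u \<zeta> x
    using assms by (auto simp: decomposes_def)
  obtain K where "\<And>\<zeta> u. u \<in> hcarrier (H \<zeta>) \<Longrightarrow> hnorm (H \<zeta>) (bf \<zeta> u) \<le> K * hnorm (H \<zeta>) u"
    using assms unfolding decomposes_def by blast
  then show "(\<lambda>\<zeta>. bf \<zeta> (x \<zeta>)) \<in> L2" if x: "x \<in> L2"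
    by (rule L2_bounded_image[OF x 1(2)[OF L2_S[OF x]]]) (use x in simp)
qed

lemma decomposes_boundE:
  assumes "decomposes b bf"
  obtains K where "0 \<le> K" "\<And>\<zeta> u. u \<in> hcarrier (H \<zeta>) \<Longrightarrow> hnorm (H \<zeta>) (bf \<zeta> u) \<le> K * hnorm (H \<zeta>) u"
proof -
  obtain K where K: "\<And>\<zeta> u. u \<in> hcarrier (H \<zeta>) \<Longrightarrow> hnorm (H \<zeta>) (bf \<zeta> u) \<le> K * hnorm (H \<zeta>) u"
    using assms unfolding decomposes_def by blast
  have "hnorm (H \<zeta>) (bf \<zeta> u) \<le> \<bar>K\<bar> * hnorm (H \<zeta>) u" if u: "u \<in> hcarrier (H \<zeta>)" for u \<zeta>
  proof -
    have "K * hnorm (H \<zeta>) u \<le> \<bar>K\<bar> * hnorm (H \<zeta>) u" using u by (intro mult_right_mono) auto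
    then show ?thesis using K[OF u] by linarith
  qed
  then show thesis using that[of "\<bar>K\<bar>"] by simp
qed

lemma decomposesI:
  assumes "\<And>\<zeta> u. u \<in> hcarrier (H \<zeta>) \<Longrightarrow> bf \<zeta> u \<in> hcarrier (H \<zeta>)"
    "\<And>\<zeta> u. u \<in> hcarrier (H \<zeta>) \<Longrightarrow> hnorm (H \<zeta>) (bf \<zeta> u) \<le> K * hnorm (H \<zeta>) u"
    "\<And>x. x \<in> S \<Longrightarrow> (\<lambda>\<zeta>. bf \<zeta> (x \<zeta>)) \<in> S"
    "\<And>x. x \<in> L2 \<Longrightarrow> b (cls x) = cls (\<lambda>\<zeta>. bf \<zeta> (x \<zeta>))"
  shows "decomposes b bf"
  unfolding decomposes_def using assms by blast

lemma decomposes_zero: "decomposes (\<lambda>X. hzero DI) (\<lambda>\<zeta> u. hzero (H \<zeta>))"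
  by (rule decomposesI[where K = 0]) (auto simp: S_zero DI_zero)

lemma decomposes_id: "decomposes (\<lambda>X. X) (\<lambda>\<zeta> u. u)"
  by (rule decomposesI[where K = 1]) auto

lemma decomposes_comp:
  assumes b: "decomposes b bf" and c: "decomposes c cf"
  shows "decomposes (\<lambda>X. b (c X)) (\<lambda>\<zeta> u. bf \<zeta> (cf \<zeta> u))"
proof -
  obtain K where K: "0 \<le> K" "\<And>\<zeta> u. u \<in> hcarrier (H \<zeta>) \<Longrightarrow> hnorm (H \<zeta>) (bf \<zeta> u) \<le> K * hnorm (H \<zeta>) u"
    using decomposes_boundE[OF b] by blast
  obtain L where L: "0 \<le> L" "\<And>\<zeta> u. u \<in> hcarrier (H \<zeta>) \<Longrightarrow> hnorm (H \<zeta>) (cf \<zeta> u) \<le> L * hnorm (H \<zeta>) u"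
    using decomposes_boundE[OF c] by blast
  show ?thesis
  proof (rule decomposesI[where K = "K * L"])
    fix \<zeta> u assume u: "u \<in> hcarrier (H \<zeta>)"
    have "hnorm (H \<zeta>) (bf \<zeta> (cf \<zeta> u)) \<le> K * hnorm (H \<zeta>) (cf \<zeta> u)" by (rule K(2)[OF decomposesD(1)[OF c u]])
    also have "\<dots> \<le> K * (L * hnorm (H \<zeta>) u)" by (intro mult_left_mono L(2) u K(1))
    finally show "hnorm (H \<zeta>) (bf \<zeta> (cf \<zeta> u)) \<le> K * L * hnorm (H \<zeta>) u" by (simp add: mult.assoc)
  qed (simp_all add: decomposesD[OF b] decomposesD[OF c])
qed

lemma decomposes_add:
  assumes b: "decomposes b bf" and c: "decomposes c cf"
  shows "decomposes (\<lambda>X. hadd DI (b X) (c X)) (\<lambda>\<zeta> u. hadd (H \<zeta>) (bf \<zeta> u) (cf \<zeta> u))"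
proof -
  obtain K where K: "0 \<le> K" "\<And>\<zeta> u. u \<in> hcarrier (H \<zeta>) \<Longrightarrow> hnorm (H \<zeta>) (bf \<zeta> u) \<le> K * hnorm (H \<zeta>) u"
    using decomposes_boundE[OF b] by blast
  obtain L where L: "0 \<le> L" "\<And>\<zeta> u. u \<in> hcarrier (H \<zeta>) \<Longrightarrow> hnorm (H \<zeta>) (cf \<zeta> u) \<le> L * hnorm (H \<zeta>) u"
    using decomposes_boundE[OF c] by blast
  show ?thesis
  proof (rule decomposesI[where K = "K + L"])
    fix \<zeta> u assume u: "u \<in> hcarrier (H \<zeta>)"
    show "hnorm (H \<zeta>) (hadd (H \<zeta>) (bf \<zeta> u) (cf \<zeta> u)) \<le> (K + L) * hnorm (H \<zeta>) u"
      using fib.norm_triangle[OF decomposesD(1)[OF b u] decomposesD(1)[OF c u]] K(2)[OF u] L(2)[OF u]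
      by (simp add: distrib_right)
  qed (simp_all add: decomposesD[OF b] decomposesD[OF c] S_add DI_add)
qed

lemma decomposes_scale:
  assumes b: "decomposes b bf"
  shows "decomposes (\<lambda>X. hscale DI k (b X)) (\<lambda>\<zeta> u. hscale (H \<zeta>) k (bf \<zeta> u))"
proof -
  obtain K where K: "0 \<le> K" "\<And>\<zeta> u. u \<in> hcarrier (H \<zeta>) \<Longrightarrow> hnorm (H \<zeta>) (bf \<zeta> u) \<le> K * hnorm (H \<zeta>) u"
    using decomposes_boundE[OF b] by blast
  show ?thesis
  proof (rule decomposesI[where K = "cmod k * K"])
    fix \<zeta> u assume u: "u \<in> hcarrier (H \<zeta>)"
    show "hnorm (H \<zeta>) (hscale (H \<zeta>) k (bf \<zeta> u)) \<le> cmod k * K * hnorm (H \<zeta>) u"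
      using K(2)[OF u] decomposesD(1)[OF b u] by (simp add: fib.norm_scale mult.assoc mult_left_mono)
  qed (simp_all add: decomposesD[OF b] S_scale DI_scale)
qed

lemma decomposes_compl:
  assumes b: "decomposes b bf"
  shows "decomposes (hcompl DI b) (\<lambda>\<zeta>. hcompl (H \<zeta>) (bf \<zeta>))"
  unfolding hcompl_def[abs_def] hminus_def[abs_def] by (intro decomposes_add decomposes_scale decomposes_id b)

text \<open>If contractions converge strongly both in every fibre and on the direct integral, the two limits
  agree: for square integrable \<open>x\<close> the fibrewise images converge in the direct integral by dominated
  convergence with majorant \<open>4 \<parallel>x(\<zeta>)\<parallel>\<^sup>2\<close>, and limits there are unique.\<close>

lemma decomposes_limit:
  assumes b: "\<And>n. decomposes (b n) (bf n)"
    and K: "\<And>n \<zeta> u. u \<in> hcarrier (H \<zeta>) \<Longrightarrow> hnorm (H \<zeta>) (bf n \<zeta> u) \<le> hnorm (H \<zeta>) u"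
    and l: "\<And>X. X \<in> hcarrier DI \<Longrightarrow> hlim DI (\<lambda>n. b n X) (c X)"
    and lf: "\<And>\<zeta> u. u \<in> hcarrier (H \<zeta>) \<Longrightarrow> hlim (H \<zeta>) (\<lambda>n. bf n \<zeta> u) (cf \<zeta> u)"
  shows "decomposes c cf"
proof (rule decomposesI[where K = 1])
  show cm: "cf \<zeta> u \<in> hcarrier (H \<zeta>)" if "u \<in> hcarrier (H \<zeta>)" for \<zeta> u
    using fib.hlim_in(2)[OF lf[OF that]] .
  show K': "hnorm (H \<zeta>) (cf \<zeta> u) \<le> 1 * hnorm (H \<zeta>) u" if u: "u \<in> hcarrier (H \<zeta>)" for \<zeta> u
    using LIMSEQ_le_const2[OF fib.hlim_norm[OF lf[OF u]]] K[OF u] by auto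
  show cS: "(\<lambda>\<zeta>. cf \<zeta> (x \<zeta>)) \<in> S" if x: "x \<in> S" for x
    by (rule S_lim[where f = "\<lambda>n \<zeta>. bf n \<zeta> (x \<zeta>)"]) (use decomposesD(2)[OF b x] lf x in auto)
  show "c (cls x) = cls (\<lambda>\<zeta>. cf \<zeta> (x \<zeta>))" if x: "x \<in> L2" for x
  proof (rule DI.hlim_unique)
    let ?y = "\<lambda>\<zeta>. cf \<zeta> (x \<zeta>)" and ?x = "\<lambda>n \<zeta>. bf n \<zeta> (x \<zeta>)"
    show "hlim DI (\<lambda>n. cls (?x n)) (c (cls x))" using l[of "cls x"] x by (simp add: decomposesD(3)[OF b])
    have xn: "?x n \<in> L2" for n by (rule decomposesD(4)[OF b x])
    have y: "?y \<in> L2" by (rule L2_bounded_image[OF x cS[OF L2_S[OF x]], of 1]) (use K' x in auto)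
    show "hlim DI (\<lambda>n. cls (?x n)) (cls ?y)"
    proof (rule DI_hlimI[OF xn y])
      have "(\<lambda>n. \<integral>\<zeta>. (hnorm (H \<zeta>) (hminus (H \<zeta>) (?x n \<zeta>) (?y \<zeta>)))\<^sup>2 \<partial>\<omega>) \<longlonglongrightarrow> (\<integral>\<zeta>. 0 \<partial>\<omega>)"
      proof (rule integral_dominated_convergence[where w = "\<lambda>\<zeta>. 4 * (hnorm (H \<zeta>) (x \<zeta>))\<^sup>2"])
        show "integrable \<omega> (\<lambda>\<zeta>. 4 * (hnorm (H \<zeta>) (x \<zeta>))\<^sup>2)" using L2_integrable[OF x] by simp
        show "(\<lambda>\<zeta>. (hnorm (H \<zeta>) (hminus (H \<zeta>) (?x n \<zeta>) (?y \<zeta>)))\<^sup>2) \<in> borel_measurable \<omega>" for n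
          by (intro borel_measurable_power norm_measurable L2_S L2_minus xn y)
        have "(\<lambda>n. (hnorm (H \<zeta>) (hminus (H \<zeta>) (?x n \<zeta>) (?y \<zeta>)))\<^sup>2) \<longlonglongrightarrow> 0\<^sup>2" for \<zeta>
          using lf[of "x \<zeta>" \<zeta>] x by (intro tendsto_intros) (simp add: hlim_def)
        then show "AE \<zeta> in \<omega>. (\<lambda>n. (hnorm (H \<zeta>) (hminus (H \<zeta>) (?x n \<zeta>) (?y \<zeta>)))\<^sup>2) \<longlonglongrightarrow> 0" by simp
        have "norm ((hnorm (H \<zeta>) (hminus (H \<zeta>) (?x n \<zeta>) (?y \<zeta>)))\<^sup>2) \<le> 4 * (hnorm (H \<zeta>) (x \<zeta>))\<^sup>2" for n \<zeta>
        proof -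
          have m: "x \<zeta> \<in> hcarrier (H \<zeta>)" "?x n \<zeta> \<in> hcarrier (H \<zeta>)" "?y \<zeta> \<in> hcarrier (H \<zeta>)"
            using x cm[of "x \<zeta>"] decomposesD(1)[OF b, of "x \<zeta>"] by auto
          have "hnorm (H \<zeta>) (hminus (H \<zeta>) (?x n \<zeta>) (?y \<zeta>)) \<le> hnorm (H \<zeta>) (?x n \<zeta>) + hnorm (H \<zeta>) (?y \<zeta>)"
            using fib.norm_triangle_minus[OF m(2) fib.zero_closed m(3)] fib.norm_minus_commute[OF fib.zero_closed m(3)] m
            by simp
          also have "\<dots> \<le> 2 * hnorm (H \<zeta>) (x \<zeta>)" using K[OF m(1), of n] K'[OF m(1)] by simp
          finally have "(hnorm (H \<zeta>) (hminus (H \<zeta>) (?x n \<zeta>) (?y \<zeta>)))\<^sup>2 \<le> (2 * hnorm (H \<zeta>) (x \<zeta>))\<^sup>2"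
            using m by (intro power_mono) auto
          then show ?thesis by (simp add: power_mult_distrib)
        qed
        then show "AE \<zeta> in \<omega>. norm ((hnorm (H \<zeta>) (hminus (H \<zeta>) (?x n \<zeta>) (?y \<zeta>)))\<^sup>2) \<le> 4 * (hnorm (H \<zeta>) (x \<zeta>))\<^sup>2" for n
          by simp
      qed simp
      then show "(\<lambda>n. \<integral>\<zeta>. (hnorm (H \<zeta>) (hminus (H \<zeta>) (?x n \<zeta>) (?y \<zeta>)))\<^sup>2 \<partial>\<omega>) \<longlonglongrightarrow> 0" by simp
    qed
  qed
qed

lemma decomposes_sqrt_iter:
  assumes b: "decomposes b bf"
  shows "decomposes (sqrt_iter DI b n) (\<lambda>\<zeta>. sqrt_iter (H \<zeta>) (bf \<zeta>) n)"
proof (induction n)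
  case 0 show ?case using decomposes_zero by (simp add: decomposes_def)
next
  case (Suc n)
  have "decomposes (\<lambda>X. sqrt_iter DI b (Suc n) X) (\<lambda>\<zeta> u. sqrt_iter (H \<zeta>) (bf \<zeta>) (Suc n) u)"
    unfolding sqrt_iter.simps by (rule decomposes_scale[OF decomposes_add[OF b decomposes_comp[OF Suc Suc]]])
  then show ?case .
qed

lemma decomposes_hsqrt:
  assumes b: "decomposes b bf" and f: "firm DI b" and ff: "\<And>\<zeta>. firm (H \<zeta>) (bf \<zeta>)"
  shows "decomposes (hsqrt DI b) (\<lambda>\<zeta>. hsqrt (H \<zeta>) (bf \<zeta>))"
  unfolding hsqrt_def
proof (rule decomposes_compl, rule decomposes_limit[where b = "\<lambda>n. sqrt_iter DI (hcompl DI b) n"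
      and bf = "\<lambda>n \<zeta>. sqrt_iter (H \<zeta>) (hcompl (H \<zeta>) (bf \<zeta>)) n"])
  show "decomposes (sqrt_iter DI (hcompl DI b) n) (\<lambda>\<zeta>. sqrt_iter (H \<zeta>) (hcompl (H \<zeta>) (bf \<zeta>)) n)" for n
    by (rule decomposes_sqrt_iter[OF decomposes_compl[OF b]])
next
  fix n \<zeta> u assume u: "u \<in> hcarrier (H \<zeta>)"
  show "hnorm (H \<zeta>) (sqrt_iter (H \<zeta>) (hcompl (H \<zeta>) (bf \<zeta>)) n u) \<le> hnorm (H \<zeta>) u"
    by (intro fib.firm_contraction fib.firm_sqrt_iter fib.firm_compl ff u)
qed (intro DI.sqrt_iter_lim DI.firm_compl f fib.sqrt_iter_lim fib.firm_compl ff; assumption)+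

lemma decomposes_pow:
  assumes b: "decomposes b bf" shows "decomposes (b ^^ n) (\<lambda>\<zeta>. bf \<zeta> ^^ n)"
proof (induction n)
  case 0 show ?case using decomposes_id by (simp add: id_def)
next
  case (Suc n) then show ?case using decomposes_comp[OF b Suc] by (simp add: o_def)
qed

lemma decomposes_fixed_proj:
  assumes b: "decomposes b bf" and f: "firm DI b" and ff: "\<And>\<zeta>. firm (H \<zeta>) (bf \<zeta>)"
  shows "decomposes (fixed_proj DI b) (\<lambda>\<zeta>. fixed_proj (H \<zeta>) (bf \<zeta>))"
proof (rule decomposes_limit[where b = "\<lambda>n. b ^^ n" and bf = "\<lambda>n \<zeta>. bf \<zeta> ^^ n"])
  show "decomposes (b ^^ n) (\<lambda>\<zeta>. bf \<zeta> ^^ n)" for n by (rule decomposes_pow[OF b])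
next
  fix n \<zeta> u assume u: "u \<in> hcarrier (H \<zeta>)"
  show "hnorm (H \<zeta>) ((bf \<zeta> ^^ n) u) \<le> hnorm (H \<zeta>) u"
    by (intro fib.firm_contraction fib.firm_pow ff u)
qed (intro DI.fixed_proj_lim f fib.fixed_proj_lim ff; assumption)+

lemma decomposes_neumann_sum:
  assumes b: "decomposes b bf" shows "decomposes (neumann_sum DI b n) (\<lambda>\<zeta>. neumann_sum (H \<zeta>) (bf \<zeta>) n)"
proof (induction n)
  case 0 show ?case using decomposes_zero by (simp add: decomposes_def)
next
  case (Suc n)
  have "decomposes (\<lambda>X. neumann_sum DI b (Suc n) X) (\<lambda>\<zeta> u. neumann_sum (H \<zeta>) (bf \<zeta>) (Suc n) u)"
    unfolding neumann_sum.simps by (intro decomposes_add decomposes_id decomposes_comp[OF b Suc])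
  then show ?case .
qed

lemma decomposes_bounded_polar:
  assumes b: "decomposes b bf" and c: "decomposes c cf"
    and b1: "bop DI b" and c1: "firm DI c" and bc: "\<And>X. X \<in> hcarrier DI \<Longrightarrow> hnorm DI (b X) = hnorm DI (c X)"
    and b2: "\<And>\<zeta>. bop (H \<zeta>) (bf \<zeta>)" and c2: "\<And>\<zeta>. firm (H \<zeta>) (cf \<zeta>)"
    and bc2: "\<And>\<zeta> u. u \<in> hcarrier (H \<zeta>) \<Longrightarrow> hnorm (H \<zeta>) (bf \<zeta> u) = hnorm (H \<zeta>) (cf \<zeta> u)"
  shows "decomposes (bounded_polar DI b c) (\<lambda>\<zeta>. bounded_polar (H \<zeta>) (bf \<zeta>) (cf \<zeta>))"
proof (rule decomposes_limit[where b = "\<lambda>n X. b (neumann_sum DI (hcompl DI c) n X)"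
      and bf = "\<lambda>n \<zeta> u. bf \<zeta> (neumann_sum (H \<zeta>) (hcompl (H \<zeta>) (cf \<zeta>)) n u)"])
  show "decomposes (\<lambda>X. b (neumann_sum DI (hcompl DI c) n X))
      (\<lambda>\<zeta> u. bf \<zeta> (neumann_sum (H \<zeta>) (hcompl (H \<zeta>) (cf \<zeta>)) n u))" for n
    by (rule decomposes_comp[OF b decomposes_neumann_sum[OF decomposes_compl[OF c]]])
next
  fix n \<zeta> u assume u: "u \<in> hcarrier (H \<zeta>)"
  show "hnorm (H \<zeta>) (bf \<zeta> (neumann_sum (H \<zeta>) (hcompl (H \<zeta>) (cf \<zeta>)) n u)) \<le> hnorm (H \<zeta>) u"
    by (rule fib.bounded_polar_approx_bound[OF b2 c2 bc2 u])
next
  show "hlim DI (\<lambda>n. b (neumann_sum DI (hcompl DI c) n X)) (bounded_polar DI b c X)" if "X \<in> hcarrier DI" for X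
    by (rule DI.bounded_polar_lim[OF b1 c1 bc that])
  show "hlim (H \<zeta>) (\<lambda>n. bf \<zeta> (neumann_sum (H \<zeta>) (hcompl (H \<zeta>) (cf \<zeta>)) n u)) (bounded_polar (H \<zeta>) (bf \<zeta>) (cf \<zeta>) u)"
    if "u \<in> hcarrier (H \<zeta>)" for \<zeta> u
    by (rule fib.bounded_polar_lim[OF b2 c2 bc2 that])
qed

end

section \<open>Entries of graph projections\<close>

definition adj_map :: "'a hilbert \<Rightarrow> ('a \<Rightarrow> 'a) \<Rightarrow> 'a \<Rightarrow> 'a" where
  "adj_map H f y = (SOME z. z \<in> hcarrier H \<and> (\<forall>x\<in>hcarrier H. hinner H (f x) y = hinner H x z))"

text \<open>The matrix entry \<^const>\<open>op_entry\<close> of the graph projection, as a function instead of a graph; see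
  \<open>op_entry_orth_proj\<close>.\<close>

definition graph_entry :: "'a hilbert \<Rightarrow> ('a \<times> 'a) set \<Rightarrow> nat \<Rightarrow> nat \<Rightarrow> 'a \<Rightarrow> 'a" where
  "graph_entry H T i j x = (if i = 1 then fst else snd)
     (hproj (hsum H H) T (if j = 1 then (x, hzero H) else (hzero H, x)))"

context hilbert_space
begin

lemma adj_map:
  assumes "bop H f" "y \<in> \<H>"
  shows adj_map_mem: "adj_map H f y \<in> \<H>" and adj_map_inner: "x \<in> \<H> \<Longrightarrow> \<langle>f x, y\<rangle> = \<langle>x, adj_map H f y\<rangle>"
proof -
  obtain d where "\<And>y. y \<in> \<H> \<Longrightarrow> d y \<in> \<H>" "\<And>x y. x \<in> \<H> \<Longrightarrow> y \<in> \<H> \<Longrightarrow> \<langle>f x, y\<rangle> = \<langle>x, d y\<rangle>"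
    using adjoint_ex[OF assms(1)] by metis
  then have "\<exists>z. z \<in> \<H> \<and> (\<forall>x\<in>\<H>. \<langle>f x, y\<rangle> = \<langle>x, z\<rangle>)" using assms(2) by blast
  from someI_ex[OF this] have *: "adj_map H f y \<in> \<H> \<and> (\<forall>x\<in>\<H>. \<langle>f x, y\<rangle> = \<langle>x, adj_map H f y\<rangle>)"
    unfolding adj_map_def .
  then show "adj_map H f y \<in> \<H>" "x \<in> \<H> \<Longrightarrow> \<langle>f x, y\<rangle> = \<langle>x, adj_map H f y\<rangle>" by auto
qed

lemma closed_op_graph_of:
  assumes f: "bop H f" shows "closed_op H (graph_of H f)"
  unfolding closed_op_iff
proof (intro conjI allI impI)
  show "single_valued (graph_of H f)" "hsubspace (hsum H H) (graph_of H f)"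
    using bounded_op_graph_of[OF f] by (auto simp: bounded_op_def linear_op_def)
  fix g h x y assume a: "(\<forall>n. (g n, h n) \<in> graph_of H f) \<and> hlim H g x \<and> hlim H h y"
  then have "h = (\<lambda>n. f (g n))" by auto
  then have "hlim H h (f x)" using bop_hlim[OF f, of g x] a by simp
  then show "(x, y) \<in> graph_of H f" using a hlim_unique[of h "f x" y] hlim_in(2)[of g x] by simp
qed

context
  fixes T :: "('a \<times> 'a) set"
  assumes T: "closed_op H T"
begin

lemma graph_proj_facts:
  assumes x: "x \<in> \<H>" "y \<in> \<H>"
  defines "p \<equiv> hproj (hsum H H) T (x, y)"
  shows "p \<in> T" "fst p \<in> \<H>" "snd p \<in> \<H>"
    "(a, b) \<in> T \<Longrightarrow> \<langle>x \<ominus> fst p, a\<rangle> + \<langle>y \<ominus> snd p, b\<rangle> = 0"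
    "(nm (fst p))\<^sup>2 + (nm (snd p))\<^sup>2 \<le> (nm x)\<^sup>2 + (nm y)\<^sup>2"
proof -
  interpret HH: hilbert_space "hsum H H" by (rule hilbert_space_graph_sum(1)[OF T])
  note P = HH.hproj[OF T_closed_subspace[OF T], of "(x, y)"]
  show p: "p \<in> T" using P(1) x by (simp add: p_def)
  obtain u v where uv: "p = (u, v)" by (cases p)
  show m: "fst p \<in> \<H>" "snd p \<in> \<H>"
    using linear_opD(1,2)[OF T_linear[OF T], of u v] p by (simp_all add: uv)
  show "\<langle>x \<ominus> fst p, a\<rangle> + \<langle>y \<ominus> snd p, b\<rangle> = 0" if ab: "(a, b) \<in> T"
    using HH.orth_complD[OF P(2) ab] x unfolding p_def[symmetric] uv by simp
  have "HH.nm p \<le> HH.nm (x, y)"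
    unfolding p_def by (rule HH.firm_contraction[OF HH.firm_hproj[OF T_closed_subspace[OF T]]]) (use x in simp)
  then have "(HH.nm p)\<^sup>2 \<le> (HH.nm (x, y))\<^sup>2"
    using p HH.norm_nonneg[of p] m by (intro power_mono) (auto simp: uv)
  then show "(nm (fst p))\<^sup>2 + (nm (snd p))\<^sup>2 \<le> (nm x)\<^sup>2 + (nm y)\<^sup>2"
    using m x hsum_norm_sq[OF inner_space_axioms inner_space_axioms] by (simp add: uv)
qed

lemma graph_entry_bop: "bop H (graph_entry H T i j)"
proof -
  interpret HH: hilbert_space "hsum H H" by (rule hilbert_space_graph_sum(1)[OF T])
  note L = HH.bopD[OF HH.firm_bop[OF HH.firm_hproj[OF T_closed_subspace[OF T]]]]
  define e where "e x = (if j = 1 then (x, \<zero>) else (\<zero>, x))" for x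
  define s :: "'a \<times> 'a \<Rightarrow> 'a" where "s = (if i = 1 then fst else snd)"
  have E: "graph_entry H T i j x = s (hproj (hsum H H) T (e x))" for x
    by (simp add: graph_entry_def e_def s_def)
  have em: "e x \<in> HH.carr" if "x \<in> \<H>" for x using that by (simp add: e_def)
  have ea: "e (x \<oplus> y) = hadd (hsum H H) (e x) (e y)" if "x \<in> \<H>" "y \<in> \<H>" for x y
    using that by (simp add: e_def)
  have es: "e (k \<odot> x) = hscale (hsum H H) k (e x)" for k x by (simp add: e_def)
  have sa: "s (hadd (hsum H H) u v) = s u \<oplus> s v" for u v by (cases u; cases v) (simp add: s_def)
  have ss: "s (hscale (hsum H H) k u) = k \<odot> s u" for u k by (cases u) (simp add: s_def)
  have bound: "nm (graph_entry H T i j x) \<le> 1 * nm x \<and> graph_entry H T i j x \<in> \<H>" if x: "x \<in> \<H>" for x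
  proof -
    have "\<exists>a b. e x = (a, b) \<and> a \<in> \<H> \<and> b \<in> \<H> \<and> (nm a)\<^sup>2 + (nm b)\<^sup>2 = (nm x)\<^sup>2"
      using x by (cases "j = 1") (simp_all add: e_def)
    then obtain a b where ab: "e x = (a, b)" "a \<in> \<H>" "b \<in> \<H>" "(nm a)\<^sup>2 + (nm b)\<^sup>2 = (nm x)\<^sup>2"
      by blast
    note F = graph_proj_facts[OF ab(2,3)]
    have "(nm (fst (hproj (hsum H H) T (a, b))))\<^sup>2 \<le> (nm x)\<^sup>2"
      "(nm (snd (hproj (hsum H H) T (a, b))))\<^sup>2 \<le> (nm x)\<^sup>2"
      using F(5) ab(4) zero_le_power2[of "nm (fst (hproj (hsum H H) T (a, b)))"]
        zero_le_power2[of "nm (snd (hproj (hsum H H) T (a, b)))"] by linarith+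
    then have "(nm (graph_entry H T i j x))\<^sup>2 \<le> (nm x)\<^sup>2"
      unfolding E ab(1) s_def by simp
    moreover have "graph_entry H T i j x \<in> \<H>" unfolding E ab(1) s_def using F(2,3) by simp
    ultimately show ?thesis using x by (auto intro: power2_le_imp_le)
  qed
  show ?thesis
    unfolding bop_def
  proof (intro conjI ballI allI exI[of _ 1])
    fix x k assume x: "x \<in> \<H>"
    show "graph_entry H T i j x \<in> \<H>" "nm (graph_entry H T i j x) \<le> 1 * nm x" using bound[OF x] by auto
    show "graph_entry H T i j (k \<odot> x) = k \<odot> graph_entry H T i j x"
      unfolding E es L(3)[OF em[OF x]] ss ..
    fix y assume y: "y \<in> \<H>"
    show "graph_entry H T i j (x \<oplus> y) = graph_entry H T i j x \<oplus> graph_entry H T i j y"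
      unfolding E ea[OF x y] L(2)[OF em[OF x] em[OF y]] sa ..
  qed
qed

lemma op_entry_orth_proj: "op_entry H (orth_proj (hsum H H) T) i j = graph_of H (graph_entry H T i j)"
proof -
  interpret HH: hilbert_space "hsum H H" by (rule hilbert_space_graph_sum(1)[OF T])
  have sub: "hsubspace (hsum H H) T" using T_closed_subspace[OF T] by (simp add: closed_subspace_def)
  have o: "orth_proj (hsum H H) T = graph_of (hsum H H) (hproj (hsum H H) T)"
    using HH.hproj[OF T_closed_subspace[OF T]] HH.hproj_eqI[OF sub]
    unfolding orth_proj_def graph_of_def by blast
  let ?e = "\<lambda>x. if j = 1 then (x, \<zero>) else (\<zero>, x)" and ?Q = "hproj (hsum H H) T"
  have Q: "(?e x, u) \<in> graph_of (hsum H H) ?Q \<longleftrightarrow> u = ?Q (?e x)" if "x \<in> \<H>" for x u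
    using that by (cases "j = 1") simp_all
  show ?thesis
  proof (intro set_eqI iffI)
    fix p assume "p \<in> op_entry H (orth_proj (hsum H H) T) i j"
    then obtain x u where "p = (x, if i = 1 then fst u else snd u)" "x \<in> \<H>" "(?e x, u) \<in> graph_of (hsum H H) ?Q"
      unfolding op_entry_def o by blast
    then show "p \<in> graph_of H (graph_entry H T i j)" unfolding Q[OF \<open>x \<in> \<H>\<close>] by (simp add: graph_entry_def)
  next
    fix p assume "p \<in> graph_of H (graph_entry H T i j)"
    then obtain x where x: "x \<in> \<H>" "p = (x, graph_entry H T i j x)" unfolding graph_of_def by blast
    have "p = (x, if i = 1 then fst (?Q (?e x)) else snd (?Q (?e x)))"
      using x by (simp add: graph_entry_def)
    moreover have "(?e x, ?Q (?e x)) \<in> graph_of (hsum H H) ?Q" using Q[OF x(1)] by blast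
    ultimately show "p \<in> op_entry H (orth_proj (hsum H H) T) i j"
      unfolding op_entry_def o using x(1) by blast
  qed
qed

lemma graph_entry_add:
  assumes "x \<in> \<H>" "y \<in> \<H>"
  shows "hproj (hsum H H) T (x, y) =
    (graph_entry H T 1 1 x \<oplus> graph_entry H T 1 2 y, graph_entry H T 2 1 x \<oplus> graph_entry H T 2 2 y)"
proof -
  interpret HH: hilbert_space "hsum H H" by (rule hilbert_space_graph_sum(1)[OF T])
  have "hproj (hsum H H) T (hadd (hsum H H) (x, \<zero>) (\<zero>, y)) =
      hadd (hsum H H) (hproj (hsum H H) T (x, \<zero>)) (hproj (hsum H H) T (\<zero>, y))"
    using assms by (intro HH.bopD(2)[OF HH.firm_bop[OF HH.firm_hproj[OF T_closed_subspace[OF T]]]]) auto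
  then show ?thesis using assms
    by (cases "hproj (hsum H H) T (x, \<zero>)"; cases "hproj (hsum H H) T (\<zero>, y)") (simp add: graph_entry_def)
qed

text \<open>Let \<open>k\<close> be the projection onto the kernel of \<open>V\<close>, so \<open>V\<^sup>*V = 1 - k\<close>. The foot \<open>(w, V w)\<close> of the
  perpendicular from \<open>(x, y)\<close> is determined by \<open>(1 + V\<^sup>*V) w = x + V\<^sup>* y\<close>, and
  \<open>(2 - k)\<inverse> = (1 + k) / 2\<close>.\<close>

lemma graph_proj_polar_map:
  fixes x y
  assumes x: "x \<in> \<H>" and y: "y \<in> \<H>"
  defines "s \<equiv> x \<oplus> adj_map H (polar_map H T) y"
  defines "w \<equiv> (1/2) \<odot> (s \<oplus> fixed_proj H (hcompl H (abs_resolvent H (resolvent H T))) s)"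
  shows "hproj (hsum H H) (graph_of H (polar_map H T)) (x, y) = (w, polar_map H T w)"
proof -
  interpret HH: hilbert_space "hsum H H" by (rule hilbert_space_graph_sum(1)[OF T])
  let ?k = "fixed_proj H (hcompl H (abs_resolvent H (resolvent H T)))"
  note b = polar_map_bop[OF T]
  have a: "adj_map H (polar_map H T) y \<in> \<H>" by (rule adj_map_mem[OF b y])
  have s: "s \<in> \<H>" using x a by (simp add: s_def)
  have km: "?k u \<in> \<H>" if "u \<in> \<H>" for u using firmD(1)[OF firm_ker_proj[OF T] that] .
  have w: "w \<in> \<H>" using s km by (simp add: w_def)
  have kw: "?k w = ?k s"
    unfolding w_def using s km ker_proj_idem[OF T s] bopD[OF firm_bop[OF firm_ker_proj[OF T]]]
    by (intro vec_eqI) (simp_all add: inner_simps)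
  have orth: "\<langle>x \<ominus> w, z\<rangle> + \<langle>y \<ominus> polar_map H T w, polar_map H T z\<rangle> = 0" if z: "z \<in> \<H>" for z
  proof -
    have "\<langle>y, polar_map H T z\<rangle> = \<langle>adj_map H (polar_map H T) y, z\<rangle>"
      using adj_map_inner[OF b y z] inner_commute[of z "adj_map H (polar_map H T) y"]
        inner_commute[of "polar_map H T z" y] a y z bopD(1)[OF b] by simp
    then have "\<langle>x \<ominus> w, z\<rangle> + \<langle>y \<ominus> polar_map H T w, polar_map H T z\<rangle> = \<langle>s \<ominus> w \<ominus> (w \<ominus> ?k w), z\<rangle>"
      using x y z w a s km bopD(1)[OF b] polar_map_inner[OF T w z]
      by (simp add: inner_minus_left s_def inner_add_left)
    also have "s \<ominus> w \<ominus> (w \<ominus> ?k w) = \<zero>"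
    proof (rule vec_eqI)
      fix v assume v: "v \<in> \<H>"
      have "2 * \<langle>w, v\<rangle> = \<langle>s, v\<rangle> + \<langle>?k s, v\<rangle>"
        unfolding w_def using s km v by (simp add: inner_simps)
      then show "\<langle>s \<ominus> w \<ominus> (w \<ominus> ?k w), v\<rangle> = \<langle>\<zero>, v\<rangle>"
        unfolding kw using s w km v by (simp add: inner_minus_left)
    qed (use s w km in auto)
    finally show ?thesis using z by simp
  qed
  show ?thesis
  proof (rule HH.hproj_eqI)
    show "hsubspace (hsum H H) (graph_of H (polar_map H T))"
      using closed_op_graph_of[OF b] by (simp add: closed_op_iff)
    show "hminus (hsum H H) (x, y) (w, polar_map H T w) \<in> orth_compl (hsum H H) (graph_of H (polar_map H T))"
      unfolding orth_compl_def
    proof (intro CollectI conjI ballI)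
      fix p assume "p \<in> graph_of H (polar_map H T)"
      then obtain z where z: "z \<in> \<H>" "p = (z, polar_map H T z)" by (auto simp: graph_of_def)
      show "HH.ip (HH.vminus (x, y) (w, polar_map H T w)) p = 0"
        unfolding z(2) hsum_simps by (rule orth[OF z(1)])
    qed (use x y w bopD(1)[OF b] in simp)
  qed (use x y w in auto)
qed

end

end

section \<open>Direct integrals of closed operators\<close>

context measurable_hilbert_field
begin

interpretation DI: hilbert_space DI
  by (rule hilbert_space_DI)

lemma op_integral_iff:
  "(X, Y) \<in> op_integral \<omega> H S T \<longleftrightarrow>
     (\<exists>x\<in>L2. \<exists>y\<in>L2. X = cls x \<and> Y = cls y \<and> (\<forall>\<zeta>. (x \<zeta>, y \<zeta>) \<in> T \<zeta>))"
  unfolding op_integral_def by blast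

lemma op_integralI:
  "x \<in> L2 \<Longrightarrow> y \<in> L2 \<Longrightarrow> (\<And>\<zeta>. (x \<zeta>, y \<zeta>) \<in> T \<zeta>) \<Longrightarrow> (cls x, cls y) \<in> op_integral \<omega> H S T"
  unfolding op_integral_iff by blast

lemma op_integral_graph_of:
  assumes d: "decomposes b bf"
  shows "op_integral \<omega> H S (\<lambda>\<zeta>. graph_of (H \<zeta>) (bf \<zeta>)) = graph_of DI b"
proof -
  have "(X, Y) \<in> op_integral \<omega> H S (\<lambda>\<zeta>. graph_of (H \<zeta>) (bf \<zeta>)) \<longleftrightarrow> (X, Y) \<in> graph_of DI b" for X Y
  proof
    assume "(X, Y) \<in> op_integral \<omega> H S (\<lambda>\<zeta>. graph_of (H \<zeta>) (bf \<zeta>))"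
    then obtain x y where xy: "x \<in> L2" "y \<in> L2" "X = cls x" "Y = cls y" "\<And>\<zeta>. y \<zeta> = bf \<zeta> (x \<zeta>)"
      unfolding op_integral_iff by auto
    then have "y = (\<lambda>\<zeta>. bf \<zeta> (x \<zeta>))" by auto
    then show "(X, Y) \<in> graph_of DI b" using xy decomposesD(3)[OF d xy(1)] by simp
  next
    assume "(X, Y) \<in> graph_of DI b"
    then obtain x where x: "x \<in> L2" "X = cls x" "Y = b (cls x)" using carrier_DI by auto
    show "(X, Y) \<in> op_integral \<omega> H S (\<lambda>\<zeta>. graph_of (H \<zeta>) (bf \<zeta>))"
      unfolding x(2,3) decomposesD(3)[OF d x(1)]
      by (rule op_integralI[OF x(1) decomposesD(4)[OF d x(1)]]) (use x(1) in simp)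
  qed
  then show ?thesis by auto
qed

context
  fixes T :: "'z \<Rightarrow> ('a \<times> 'a) set"
  assumes T: "measurable_closed_field H S T"
begin

lemma T_closed: "closed_op (H \<zeta>) (T \<zeta>)"
  using T by (simp add: measurable_closed_field_def)

lemma graph_entry_S:
  assumes "x \<in> S" "i \<in> {1, 2}" "j \<in> {1, 2}"
  shows "(\<lambda>\<zeta>. graph_entry (H \<zeta>) (T \<zeta>) i j (x \<zeta>)) \<in> S"
proof -
  have "(\<lambda>\<zeta>. op_app (op_entry (H \<zeta>) (orth_proj (hsum (H \<zeta>) (H \<zeta>)) (T \<zeta>)) i j) (x \<zeta>)) \<in> S"
    using T assms unfolding measurable_closed_field_def measurable_bounded_field_def by blast
  then show ?thesis
    using assms(1) by (simp add: fib.op_entry_orth_proj[OF T_closed] fib.op_app_graph_of)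
qed

text \<open>This is where all four entries of the graph projections are needed: they make the fibrewise
  projection of a pair of square integrable fields measurable.\<close>

lemma graph_proj_L2:
  assumes x: "x \<in> L2" and y: "y \<in> L2"
  shows "(\<lambda>\<zeta>. fst (hproj (hsum (H \<zeta>) (H \<zeta>)) (T \<zeta>) (x \<zeta>, y \<zeta>))) \<in> L2"
    "(\<lambda>\<zeta>. snd (hproj (hsum (H \<zeta>) (H \<zeta>)) (T \<zeta>) (x \<zeta>, y \<zeta>))) \<in> L2"
proof -
  have int: "integrable \<omega> (\<lambda>\<zeta>. (hnorm (H \<zeta>) (x \<zeta>))\<^sup>2 + (hnorm (H \<zeta>) (y \<zeta>))\<^sup>2)"
    using L2_integrable x y by simp
  have e: "hproj (hsum (H \<zeta>) (H \<zeta>)) (T \<zeta>) (x \<zeta>, y \<zeta>) =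
      (hadd (H \<zeta>) (graph_entry (H \<zeta>) (T \<zeta>) 1 1 (x \<zeta>)) (graph_entry (H \<zeta>) (T \<zeta>) 1 2 (y \<zeta>)),
       hadd (H \<zeta>) (graph_entry (H \<zeta>) (T \<zeta>) 2 1 (x \<zeta>)) (graph_entry (H \<zeta>) (T \<zeta>) 2 2 (y \<zeta>)))" for \<zeta>
    using x y by (intro fib.graph_entry_add[OF T_closed]) auto
  have b: "(hnorm (H \<zeta>) (fst (hproj (hsum (H \<zeta>) (H \<zeta>)) (T \<zeta>) (x \<zeta>, y \<zeta>))))\<^sup>2 +
      (hnorm (H \<zeta>) (snd (hproj (hsum (H \<zeta>) (H \<zeta>)) (T \<zeta>) (x \<zeta>, y \<zeta>))))\<^sup>2
      \<le> (hnorm (H \<zeta>) (x \<zeta>))\<^sup>2 + (hnorm (H \<zeta>) (y \<zeta>))\<^sup>2" for \<zeta>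
    using x y by (intro fib.graph_proj_facts(5)[OF T_closed]) auto
  show "(\<lambda>\<zeta>. fst (hproj (hsum (H \<zeta>) (H \<zeta>)) (T \<zeta>) (x \<zeta>, y \<zeta>))) \<in> L2"
  proof (rule L2_bound[OF _ int])
    show "(\<lambda>\<zeta>. fst (hproj (hsum (H \<zeta>) (H \<zeta>)) (T \<zeta>) (x \<zeta>, y \<zeta>))) \<in> S"
      unfolding e fst_conv by (intro S_add graph_entry_S L2_S x y) auto
    show "AE \<zeta> in \<omega>. (hnorm (H \<zeta>) (fst (hproj (hsum (H \<zeta>) (H \<zeta>)) (T \<zeta>) (x \<zeta>, y \<zeta>))))\<^sup>2
        \<le> (hnorm (H \<zeta>) (x \<zeta>))\<^sup>2 + (hnorm (H \<zeta>) (y \<zeta>))\<^sup>2"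
      by (intro always_eventually allI order_trans[OF _ b]) simp
  qed
  show "(\<lambda>\<zeta>. snd (hproj (hsum (H \<zeta>) (H \<zeta>)) (T \<zeta>) (x \<zeta>, y \<zeta>))) \<in> L2"
  proof (rule L2_bound[OF _ int])
    show "(\<lambda>\<zeta>. snd (hproj (hsum (H \<zeta>) (H \<zeta>)) (T \<zeta>) (x \<zeta>, y \<zeta>))) \<in> S"
      unfolding e snd_conv by (intro S_add graph_entry_S L2_S x y) auto
    show "AE \<zeta> in \<omega>. (hnorm (H \<zeta>) (snd (hproj (hsum (H \<zeta>) (H \<zeta>)) (T \<zeta>) (x \<zeta>, y \<zeta>))))\<^sup>2
        \<le> (hnorm (H \<zeta>) (x \<zeta>))\<^sup>2 + (hnorm (H \<zeta>) (y \<zeta>))\<^sup>2"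
      by (intro always_eventually allI order_trans[OF _ b]) simp
  qed
qed

abbreviation (input) "TI \<equiv> op_integral \<omega> H S T"

text \<open>If \<open>(X, Y)\<close> is a limit of elements of the graph, represented by \<open>(x, y)\<close>, let \<open>(p, q)\<close> be its fibrewise
  distance vector from the graphs \<open>T(\<zeta>)\<close>. It is orthogonal to the graph of the integral, hence to
  \<open>(X, Y)\<close>, but the inner product of \<open>(p, q)\<close> with \<open>(x, y)\<close> is \<open>\<parallel>p(\<zeta>)\<parallel>\<^sup>2 + \<parallel>q(\<zeta>)\<parallel>\<^sup>2\<close> in each
  fibre. So \<open>p\<close> and \<open>q\<close> vanish almost everywhere, and the fibrewise projections of \<open>(x, y)\<close> are
  representatives of \<open>(X, Y)\<close> that lie in the graphs for every \<open>\<zeta>\<close>.\<close>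

lemma closed_op_integral: "closed_op DI TI"
  unfolding DI.closed_op_iff
proof (intro conjI allI impI)
  note L = fib.linear_opD[OF fib.T_linear[OF T_closed]]
  show "single_valued TI"
  proof (rule single_valuedI)
    fix X Y Z assume "(X, Y) \<in> TI" "(X, Z) \<in> TI"
    then obtain x y x' z where *: "x \<in> L2" "y \<in> L2" "X = cls x" "Y = cls y" "\<And>\<zeta>. (x \<zeta>, y \<zeta>) \<in> T \<zeta>"
      "x' \<in> L2" "z \<in> L2" "X = cls x'" "Z = cls z" "\<And>\<zeta>. (x' \<zeta>, z \<zeta>) \<in> T \<zeta>"
      unfolding op_integral_iff by blast
    have "AE \<zeta> in \<omega>. x \<zeta> = x' \<zeta>" using * cls_eq_iff by metis
    then have "AE \<zeta> in \<omega>. y \<zeta> = z \<zeta>"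
    proof eventually_elim
      case (elim \<zeta>) then show ?case using L(7)[of "x \<zeta>" "y \<zeta>" \<zeta> "z \<zeta>"] *(5)[of \<zeta>] *(10)[of \<zeta>] by simp
    qed
    then show "Y = Z" using * cls_eq_iff by metis
  qed
  show "hsubspace (hsum DI DI) TI"
    unfolding hsubspace_def
  proof (intro conjI ballI allI)
    show "TI \<subseteq> hcarrier (hsum DI DI)" by (auto simp: op_integral_def)
    show "hzero (hsum DI DI) \<in> TI"
      unfolding hsum_simps DI_zero by (intro op_integralI L2_zero L)
    fix p c assume "p \<in> TI"
    then obtain x y where p: "x \<in> L2" "y \<in> L2" "p = (cls x, cls y)" "\<And>\<zeta>. (x \<zeta>, y \<zeta>) \<in> T \<zeta>"
      by (cases p) (auto simp: op_integral_iff)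
    show "hscale (hsum DI DI) c p \<in> TI"
      unfolding p(3) hsum_simps DI_scale[OF p(1)] DI_scale[OF p(2)]
      by (intro op_integralI L2_scale p L)
    fix q assume "q \<in> TI"
    then obtain x' y' where q: "x' \<in> L2" "y' \<in> L2" "q = (cls x', cls y')" "\<And>\<zeta>. (x' \<zeta>, y' \<zeta>) \<in> T \<zeta>"
      by (cases q) (auto simp: op_integral_iff)
    show "hadd (hsum DI DI) p q \<in> TI"
      unfolding p(3) q(3) hsum_simps DI_add[OF p(1) q(1)] DI_add[OF p(2) q(2)]
      by (intro op_integralI L2_add p q L)
  qed
  fix F G X Y assume FG: "(\<forall>n. (F n, G n) \<in> TI) \<and> hlim DI F X \<and> hlim DI G Y"
  obtain x where x: "x \<in> L2" "X = cls x" using FG DI.hlim_in(2) carrier_DI by blast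
  obtain y where y: "y \<in> L2" "Y = cls y" using FG DI.hlim_in(2) carrier_DI by blast
  let ?P = "\<lambda>\<zeta>. hproj (hsum (H \<zeta>) (H \<zeta>)) (T \<zeta>) (x \<zeta>, y \<zeta>)"
  define a b where "a \<zeta> = fst (?P \<zeta>)" and "b \<zeta> = snd (?P \<zeta>)" for \<zeta>
  have a: "a \<in> L2" and b: "b \<in> L2"
    unfolding a_def b_def using graph_proj_L2[OF x(1) y(1)] by auto
  define p q where "p \<zeta> = hminus (H \<zeta>) (x \<zeta>) (a \<zeta>)" and "q \<zeta> = hminus (H \<zeta>) (y \<zeta>) (b \<zeta>)" for \<zeta>
  have p: "p \<in> L2" and q: "q \<in> L2"
    unfolding p_def q_def by (intro L2_minus x y a b)+
  note F = fib.graph_proj_facts[OF T_closed L2_mem[OF x(1)] L2_mem[OF y(1)]]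
  have ab: "(a \<zeta>, b \<zeta>) \<in> T \<zeta>" for \<zeta> unfolding a_def b_def using F(1)[of \<zeta>] by simp
  have orth: "hinner (H \<zeta>) (p \<zeta>) u + hinner (H \<zeta>) (q \<zeta>) v = 0" if "(u, v) \<in> T \<zeta>" for \<zeta> u v
    unfolding p_def q_def a_def b_def using F(4)[OF that] .
  have orthI: "hinner DI (cls p) U + hinner DI (cls q) V = 0" if UV: "(U, V) \<in> TI" for U V
  proof -
    obtain u v where uv: "u \<in> L2" "v \<in> L2" "U = cls u" "V = cls v" "\<And>\<zeta>. (u \<zeta>, v \<zeta>) \<in> T \<zeta>"
      using UV[unfolded op_integral_iff] by blast
    have "hinner DI (cls p) U + hinner DI (cls q) V =
        (\<integral>\<zeta>. hinner (H \<zeta>) (p \<zeta>) (u \<zeta>) + hinner (H \<zeta>) (q \<zeta>) (v \<zeta>) \<partial>\<omega>)"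
      using uv p q inner_integrable by (simp add: DI_inner)
    also have "\<dots> = 0" using orth[OF uv(5)] by simp
    finally show ?thesis .
  qed
  have "(\<lambda>n. hinner DI (cls p) (F n) + hinner DI (cls q) (G n)) \<longlonglongrightarrow> hinner DI (cls p) X + hinner DI (cls q) Y"
    using FG p q by (intro tendsto_add DI.hlim_inner) auto
  moreover have "hinner DI (cls p) (F n) + hinner DI (cls q) (G n) = 0" for n using orthI FG by blast
  ultimately have z: "hinner DI (cls p) X + hinner DI (cls q) Y = 0" using LIMSEQ_unique[OF _ tendsto_const] by simp
  have pw: "hinner (H \<zeta>) (p \<zeta>) (x \<zeta>) + hinner (H \<zeta>) (q \<zeta>) (y \<zeta>) =
      complex_of_real ((hnorm (H \<zeta>) (p \<zeta>))\<^sup>2 + (hnorm (H \<zeta>) (q \<zeta>))\<^sup>2)" for \<zeta>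
  proof -
    have m: "x \<zeta> \<in> hcarrier (H \<zeta>)" "y \<zeta> \<in> hcarrier (H \<zeta>)" "a \<zeta> \<in> hcarrier (H \<zeta>)" "b \<zeta> \<in> hcarrier (H \<zeta>)"
      "p \<zeta> \<in> hcarrier (H \<zeta>)" "q \<zeta> \<in> hcarrier (H \<zeta>)" using x y a b p q by auto
    have "complex_of_real ((hnorm (H \<zeta>) (p \<zeta>))\<^sup>2 + (hnorm (H \<zeta>) (q \<zeta>))\<^sup>2) =
        hinner (H \<zeta>) (p \<zeta>) (p \<zeta>) + hinner (H \<zeta>) (q \<zeta>) (q \<zeta>)" using m by (simp add: fib.inner_self)
    also have "\<dots> = hinner (H \<zeta>) (p \<zeta>) (x \<zeta>) + hinner (H \<zeta>) (q \<zeta>) (y \<zeta>) -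
        (hinner (H \<zeta>) (p \<zeta>) (a \<zeta>) + hinner (H \<zeta>) (q \<zeta>) (b \<zeta>))"
      using m fib.inner_minus_right[OF m(1) m(3) m(5)] fib.inner_minus_right[OF m(2) m(4) m(6)]
      by (simp add: p_def q_def)
    finally show ?thesis using orth[OF ab] by simp
  qed
  have "hinner DI (cls p) X + hinner DI (cls q) Y =
      (\<integral>\<zeta>. hinner (H \<zeta>) (p \<zeta>) (x \<zeta>) + hinner (H \<zeta>) (q \<zeta>) (y \<zeta>) \<partial>\<omega>)"
    using x y p q inner_integrable by (simp add: DI_inner)
  also have "\<dots> = complex_of_real (\<integral>\<zeta>. (hnorm (H \<zeta>) (p \<zeta>))\<^sup>2 + (hnorm (H \<zeta>) (q \<zeta>))\<^sup>2 \<partial>\<omega>)"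
    unfolding pw by (rule integral_complex_of_real)
  finally have "(\<integral>\<zeta>. (hnorm (H \<zeta>) (p \<zeta>))\<^sup>2 + (hnorm (H \<zeta>) (q \<zeta>))\<^sup>2 \<partial>\<omega>) = 0"
    using z by simp
  then have "(\<integral>\<zeta>. (hnorm (H \<zeta>) (p \<zeta>))\<^sup>2 \<partial>\<omega>) + (\<integral>\<zeta>. (hnorm (H \<zeta>) (q \<zeta>))\<^sup>2 \<partial>\<omega>) = 0"
    using L2_integrable p q by simp
  moreover have "0 \<le> (\<integral>\<zeta>. (hnorm (H \<zeta>) (p \<zeta>))\<^sup>2 \<partial>\<omega>)" "0 \<le> (\<integral>\<zeta>. (hnorm (H \<zeta>) (q \<zeta>))\<^sup>2 \<partial>\<omega>)" by simp_all
  ultimately have "(\<integral>\<zeta>. (hnorm (H \<zeta>) (p \<zeta>))\<^sup>2 \<partial>\<omega>) = 0" "(\<integral>\<zeta>. (hnorm (H \<zeta>) (q \<zeta>))\<^sup>2 \<partial>\<omega>) = 0" by linarith+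
  then have "AE \<zeta> in \<omega>. p \<zeta> = hzero (H \<zeta>)" "AE \<zeta> in \<omega>. q \<zeta> = hzero (H \<zeta>)"
    using cls_zero_iff p q by blast+
  then have "AE \<zeta> in \<omega>. x \<zeta> = a \<zeta>" "AE \<zeta> in \<omega>. y \<zeta> = b \<zeta>"
    using x y a b by (simp_all add: p_def q_def)
  then have "X = cls a" "Y = cls b" using x y a b by (simp_all add: cls_eq_iff)
  then show "(X, Y) \<in> TI" unfolding op_integral_iff using a b ab by blast
qed

lemma resolvent_S: "x \<in> S \<Longrightarrow> (\<lambda>\<zeta>. resolvent (H \<zeta>) (T \<zeta>) (x \<zeta>)) \<in> S"
  using graph_entry_S[of x 1 1] by (simp add: graph_entry_def resolvent_def)

lemma op_resolvent_S: "x \<in> S \<Longrightarrow> (\<lambda>\<zeta>. op_resolvent (H \<zeta>) (T \<zeta>) (x \<zeta>)) \<in> S"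
  using graph_entry_S[of x 2 1] by (simp add: graph_entry_def op_resolvent_def)

lemma op_resolvent_contraction: "u \<in> hcarrier (H \<zeta>) \<Longrightarrow> hnorm (H \<zeta>) (op_resolvent (H \<zeta>) (T \<zeta>) u) \<le> hnorm (H \<zeta>) u"
  using fib.abs_resolvent_norm[OF T_closed] fib.firm_contraction[OF fib.firm_abs_resolvent(1)[OF fib.firm_resolvent[OF T_closed]]]
  by simp

text \<open>The fibrewise projection of \<open>(x, 0)\<close> lies in the graph of the integral and its difference from
  \<open>(x, 0)\<close> is orthogonal to that graph, so it is the projection in the direct integral.\<close>

lemma resolvent_pair_integral:
  assumes x: "x \<in> L2"
  shows "resolvent DI TI (cls x) = cls (\<lambda>\<zeta>. resolvent (H \<zeta>) (T \<zeta>) (x \<zeta>))"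
    "op_resolvent DI TI (cls x) = cls (\<lambda>\<zeta>. op_resolvent (H \<zeta>) (T \<zeta>) (x \<zeta>))"
proof -
  let ?r = "\<lambda>\<zeta>. resolvent (H \<zeta>) (T \<zeta>) (x \<zeta>)" and ?b = "\<lambda>\<zeta>. op_resolvent (H \<zeta>) (T \<zeta>) (x \<zeta>)"
  have r: "?r \<in> L2"
    by (rule L2_bounded_image[OF x resolvent_S[OF L2_S[OF x]], of 1])
      (use fib.firm_contraction[OF fib.firm_resolvent[OF T_closed]] x in simp)
  have b: "?b \<in> L2"
    by (rule L2_bounded_image[OF x op_resolvent_S[OF L2_S[OF x]], of 1]) (use op_resolvent_contraction x in simp)
  have mem: "(cls ?r, cls ?b) \<in> TI"
    by (rule op_integralI[OF r b]) (use x fib.resolvent_pair_mem[OF T_closed] in simp)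
  have orth: "hinner DI (hminus DI (cls x) (cls ?r)) A = hinner DI (cls ?b) B" if AB: "(A, B) \<in> TI" for A B
  proof -
    obtain u v where uv: "u \<in> L2" "v \<in> L2" "A = cls u" "B = cls v" "\<And>\<zeta>. (u \<zeta>, v \<zeta>) \<in> T \<zeta>"
      using AB[unfolded op_integral_iff] by blast
    have "hinner (H \<zeta>) (hminus (H \<zeta>) (x \<zeta>) (?r \<zeta>)) (u \<zeta>) = hinner (H \<zeta>) (?b \<zeta>) (v \<zeta>)" for \<zeta>
      using fib.resolvent_pair_orth[OF T_closed _ uv(5)] x by simp
    then show ?thesis using x r b uv by (simp add: DI_minus DI_inner L2_minus)
  qed
  show "resolvent DI TI (cls x) = cls ?r" "op_resolvent DI TI (cls x) = cls ?b"
    using DI.resolvent_eqI[OF closed_op_integral _ mem orth] x by auto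
qed

lemma decomposes_resolvent: "decomposes (resolvent DI TI) (\<lambda>\<zeta>. resolvent (H \<zeta>) (T \<zeta>))"
  by (rule decomposesI[where K = 1])
    (use fib.resolvent_closed[OF T_closed] fib.firm_contraction[OF fib.firm_resolvent[OF T_closed]] resolvent_S
      resolvent_pair_integral in simp_all)

lemma decomposes_op_resolvent: "decomposes (op_resolvent DI TI) (\<lambda>\<zeta>. op_resolvent (H \<zeta>) (T \<zeta>))"
  by (rule decomposesI[where K = 1])
    (use fib.op_resolvent_closed[OF T_closed] op_resolvent_contraction op_resolvent_S resolvent_pair_integral in simp_all)

lemma decomposes_abs_resolvent: "decomposes (abs_resolvent DI (resolvent DI TI)) (\<lambda>\<zeta>. abs_resolvent (H \<zeta>) (resolvent (H \<zeta>) (T \<zeta>)))"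
proof -
  have r: "firm DI (resolvent DI TI)" "\<And>\<zeta>. firm (H \<zeta>) (resolvent (H \<zeta>) (T \<zeta>))"
    by (intro DI.firm_resolvent fib.firm_resolvent closed_op_integral T_closed)+
  show ?thesis
    unfolding abs_resolvent_def[abs_def]
    by (rule decomposes_comp[OF decomposes_hsqrt[OF decomposes_resolvent r] decomposes_hsqrt[OF decomposes_compl[OF decomposes_resolvent]
          DI.firm_compl[OF r(1)] fib.firm_compl[OF r(2)]]])
qed

lemma decomposes_ker_proj:
  "decomposes (fixed_proj DI (hcompl DI (abs_resolvent DI (resolvent DI TI))))
    (\<lambda>\<zeta>. fixed_proj (H \<zeta>) (hcompl (H \<zeta>) (abs_resolvent (H \<zeta>) (resolvent (H \<zeta>) (T \<zeta>)))))"
  by (intro decomposes_fixed_proj decomposes_compl decomposes_abs_resolvent DI.firm_compl fib.firm_compl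
      DI.firm_abs_resolvent(1) fib.firm_abs_resolvent(1) DI.firm_resolvent fib.firm_resolvent closed_op_integral T_closed)

lemma decomposes_polar_map: "decomposes (polar_map DI TI) (\<lambda>\<zeta>. polar_map (H \<zeta>) (T \<zeta>))"
  unfolding polar_map_def
  by (intro decomposes_bounded_polar decomposes_op_resolvent decomposes_abs_resolvent DI.bop_op_resolvent fib.bop_op_resolvent DI.firm_abs_resolvent(1) fib.firm_abs_resolvent(1)
      DI.firm_resolvent fib.firm_resolvent closed_op_integral T_closed DI.abs_resolvent_norm fib.abs_resolvent_norm)

lemma polar_map_bounded_field: "measurable_bounded_field H S (\<lambda>\<zeta>. graph_of (H \<zeta>) (polar_map (H \<zeta>) (T \<zeta>)))"
  unfolding measurable_bounded_field_def
  using fib.bounded_op_graph_of[OF fib.polar_map_bop[OF T_closed]] decomposesD(2)[OF decomposes_polar_map]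
  by (simp add: fib.op_app_graph_of)

text \<open>Adjoints of measurable fields are weakly measurable, and weak measurability suffices.\<close>

lemma adj_map_polar_map_S:
  assumes y: "y \<in> S" shows "(\<lambda>\<zeta>. adj_map (H \<zeta>) (polar_map (H \<zeta>) (T \<zeta>)) (y \<zeta>)) \<in> S"
proof (rule S_I)
  fix x assume x: "x \<in> S"
  have "(\<lambda>\<zeta>. hinner (H \<zeta>) (polar_map (H \<zeta>) (T \<zeta>) (x \<zeta>)) (y \<zeta>)) \<in> borel_measurable \<omega>"
    by (intro inner_measurable decomposesD(2)[OF decomposes_polar_map] x y)
  then show "(\<lambda>\<zeta>. hinner (H \<zeta>) (x \<zeta>) (adj_map (H \<zeta>) (polar_map (H \<zeta>) (T \<zeta>)) (y \<zeta>))) \<in> borel_measurable \<omega>"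
    using fib.adj_map_inner[OF fib.polar_map_bop[OF T_closed]] x y by simp
qed (use fib.adj_map_mem[OF fib.polar_map_bop[OF T_closed]] y in simp)

lemma polar_map_closed_field: "measurable_closed_field H S (\<lambda>\<zeta>. graph_of (H \<zeta>) (polar_map (H \<zeta>) (T \<zeta>)))"
proof -
  let ?V = "\<lambda>\<zeta>. graph_of (H \<zeta>) (polar_map (H \<zeta>) (T \<zeta>))"
  have cl: "closed_op (H \<zeta>) (?V \<zeta>)" for \<zeta>
    by (rule fib.closed_op_graph_of[OF fib.polar_map_bop[OF T_closed]])
  have pS: "(\<lambda>\<zeta>. fst (hproj (hsum (H \<zeta>) (H \<zeta>)) (?V \<zeta>) (x \<zeta>, y \<zeta>))) \<in> S"
    "(\<lambda>\<zeta>. snd (hproj (hsum (H \<zeta>) (H \<zeta>)) (?V \<zeta>) (x \<zeta>, y \<zeta>))) \<in> S" if x: "x \<in> S" and y: "y \<in> S" for x y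
  proof -
    define s where "s \<zeta> = hadd (H \<zeta>) (x \<zeta>) (adj_map (H \<zeta>) (polar_map (H \<zeta>) (T \<zeta>)) (y \<zeta>))" for \<zeta>
    define w where "w \<zeta> = hscale (H \<zeta>) (1/2)
        (hadd (H \<zeta>) (s \<zeta>) (fixed_proj (H \<zeta>) (hcompl (H \<zeta>) (abs_resolvent (H \<zeta>) (resolvent (H \<zeta>) (T \<zeta>)))) (s \<zeta>)))" for \<zeta>
    have s: "s \<in> S" unfolding s_def by (intro S_add adj_map_polar_map_S x y)
    have w: "w \<in> S" unfolding w_def by (intro S_scale S_add s decomposesD(2)[OF decomposes_ker_proj]) simp
    have e: "hproj (hsum (H \<zeta>) (H \<zeta>)) (?V \<zeta>) (x \<zeta>, y \<zeta>) = (w \<zeta>, polar_map (H \<zeta>) (T \<zeta>) (w \<zeta>))" for \<zeta>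
      unfolding w_def s_def by (intro fib.graph_proj_polar_map[OF T_closed]) (use x y in simp_all)
    show "(\<lambda>\<zeta>. fst (hproj (hsum (H \<zeta>) (H \<zeta>)) (?V \<zeta>) (x \<zeta>, y \<zeta>))) \<in> S"
      "(\<lambda>\<zeta>. snd (hproj (hsum (H \<zeta>) (H \<zeta>)) (?V \<zeta>) (x \<zeta>, y \<zeta>))) \<in> S"
      unfolding e using w decomposesD(2)[OF decomposes_polar_map w] by simp_all
  qed
  have "(\<lambda>\<zeta>. graph_entry (H \<zeta>) (?V \<zeta>) i j (x \<zeta>)) \<in> S" if x: "x \<in> S" for x i j
    unfolding graph_entry_def using pS[OF x S_zero] pS[OF S_zero x] by (cases "i = 1"; cases "j = 1") simp_all
  then show ?thesis
    unfolding measurable_closed_field_def measurable_bounded_field_def fib.op_entry_orth_proj[OF cl]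
    using cl fib.bounded_op_graph_of[OF fib.graph_entry_bop[OF cl]] by (simp add: fib.op_app_graph_of)
qed

text \<open>A \<open>\<sigma>\<close>-finite measure has a strictly positive integrable function \<open>g\<close>, and the scalar
  \<open>(g / (1 + \<parallel>x\<parallel>\<^sup>2))\<^sup>1\<^sup>/\<^sup>2\<close> makes any measurable field square integrable without changing its
  direction.\<close>

lemma square_integrable_rescaling:
  assumes sf: "sigma_finite_measure \<omega>" and x: "x \<in> S"
  obtains c where "\<And>\<zeta>. \<zeta> \<in> space \<omega> \<Longrightarrow> c \<zeta> \<noteq> 0" "(\<lambda>\<zeta>. hscale (H \<zeta>) (c \<zeta>) (x \<zeta>)) \<in> L2"
proof -
  obtain h :: "'z \<Rightarrow> ennreal" where h: "h \<in> borel_measurable \<omega>" "(\<integral>\<^sup>+\<zeta>. h \<zeta> \<partial>\<omega>) \<noteq> \<infinity>"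
    "\<And>\<zeta>. \<zeta> \<in> space \<omega> \<Longrightarrow> 0 < h \<zeta> \<and> h \<zeta> < \<infinity>"
    using sigma_finite_measure.Ex_finite_integrable_function[OF sf] by blast
  define g where "g \<zeta> = enn2real (h \<zeta>)" for \<zeta>
  have gm: "g \<in> borel_measurable \<omega>" unfolding g_def using h(1) by measurable
  have gpos: "0 < g \<zeta>" if "\<zeta> \<in> space \<omega>" for \<zeta>
    using h(3)[OF that] by (simp add: g_def enn2real_positive_iff)
  have gi: "integrable \<omega> g"
  proof (rule integrableI_nonneg[OF gm])
    have "(\<integral>\<^sup>+\<zeta>. ennreal (g \<zeta>) \<partial>\<omega>) = (\<integral>\<^sup>+\<zeta>. h \<zeta> \<partial>\<omega>)"
      using h(3) by (intro nn_integral_cong) (auto simp: g_def)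
    then show "(\<integral>\<^sup>+\<zeta>. ennreal (g \<zeta>) \<partial>\<omega>) < \<infinity>" using h(2) by (simp add: top.not_eq_extremum)
  qed (simp add: g_def)
  define c where "c \<zeta> = sqrt (g \<zeta> / (1 + (hnorm (H \<zeta>) (x \<zeta>))\<^sup>2))" for \<zeta>
  have cm: "(\<lambda>\<zeta>. complex_of_real (c \<zeta>)) \<in> borel_measurable \<omega>"
    unfolding c_def using gm norm_measurable[OF x] by measurable
  have pos: "0 < 1 + (hnorm (H \<zeta>) (x \<zeta>))\<^sup>2" for \<zeta> by (simp add: add_pos_nonneg)
  show thesis
  proof
    show "complex_of_real (c \<zeta>) \<noteq> 0" if "\<zeta> \<in> space \<omega>" for \<zeta>
      using gpos[OF that] pos[of \<zeta>] by (simp add: c_def)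
    show "(\<lambda>\<zeta>. hscale (H \<zeta>) (complex_of_real (c \<zeta>)) (x \<zeta>)) \<in> L2"
    proof (rule L2_bound[OF S_scale[OF x cm] gi], rule AE_I2)
      fix \<zeta> assume \<zeta>: "\<zeta> \<in> space \<omega>"
      have "(hnorm (H \<zeta>) (hscale (H \<zeta>) (complex_of_real (c \<zeta>)) (x \<zeta>)))\<^sup>2
          = g \<zeta> / (1 + (hnorm (H \<zeta>) (x \<zeta>))\<^sup>2) * (hnorm (H \<zeta>) (x \<zeta>))\<^sup>2"
        using x gpos[OF \<zeta>] pos[of \<zeta>] by (simp add: fib.norm_scale power_mult_distrib c_def)
      also have "\<dots> \<le> g \<zeta>" using gpos[OF \<zeta>] pos[of \<zeta>] by (simp add: field_simps)
      finally show "(hnorm (H \<zeta>) (hscale (H \<zeta>) (complex_of_real (c \<zeta>)) (x \<zeta>)))\<^sup>2 \<le> g \<zeta>" .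
    qed
  qed
qed

text \<open>The projections \<open>k(\<zeta>)\<close> onto the kernels of the resolvents integrate to the projection onto the
  kernel of the resolvent of the integral, which is \<open>0\<close>. So, almost everywhere, \<open>k(\<zeta>)\<close> annihilates
  each member of a fundamental sequence, first rescaled to be square integrable, and therefore
  the whole fibre.\<close>

lemma dense_fibres:
  assumes sf: "sigma_finite_measure \<omega>" and d: "densely_defined DI TI"
  shows "AE \<zeta> in \<omega>. densely_defined (H \<zeta>) (T \<zeta>)"
proof -
  let ?k = "\<lambda>\<zeta>. fixed_proj (H \<zeta>) (hcompl (H \<zeta>) (resolvent (H \<zeta>) (T \<zeta>)))"
  let ?K = "fixed_proj DI (hcompl DI (resolvent DI TI))"
  have r: "firm DI (resolvent DI TI)" and rf: "firm (H \<zeta>) (resolvent (H \<zeta>) (T \<zeta>))" for \<zeta>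
    by (intro DI.firm_resolvent fib.firm_resolvent closed_op_integral T_closed)+
  have dk: "decomposes ?K ?k" by (intro decomposes_fixed_proj decomposes_compl decomposes_resolvent DI.firm_compl fib.firm_compl r rf)
  have kf: "firm (H \<zeta>) (?k \<zeta>)" for \<zeta> by (intro fib.firm_fixed_proj fib.firm_compl rf)
  have K0: "?K X = hzero DI" if X: "X \<in> hcarrier DI" for X
  proof -
    have "resolvent DI TI (?K X) = hzero DI" by (rule DI.firm_fixed_proj_null[OF r X])
    moreover have "?K X \<in> hcarrier DI"
      using DI.firmD(1)[OF DI.firm_fixed_proj[OF DI.firm_compl[OF r]] X] .
    ultimately show ?thesis using DI.dense_iff_resolvent_injective[OF closed_op_integral] d by blast
  qed
  obtain X :: "nat \<Rightarrow> 'z \<Rightarrow> 'a" where X: "\<And>n. X n \<in> S"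
    and dense: "\<And>\<zeta>. hdense (H \<zeta>) (hspan (H \<zeta>) (range (\<lambda>n. X n \<zeta>)))"
    using fundamental by blast
  have "AE \<zeta> in \<omega>. ?k \<zeta> (X n \<zeta>) = hzero (H \<zeta>)" for n
  proof -
    obtain c where c: "\<And>\<zeta>. \<zeta> \<in> space \<omega> \<Longrightarrow> c \<zeta> \<noteq> 0" "(\<lambda>\<zeta>. hscale (H \<zeta>) (c \<zeta>) (X n \<zeta>)) \<in> L2"
      using square_integrable_rescaling[OF sf X] by metis
    have "cls (\<lambda>\<zeta>. ?k \<zeta> (hscale (H \<zeta>) (c \<zeta>) (X n \<zeta>))) = cls (\<lambda>\<zeta>. hzero (H \<zeta>))"
      using decomposesD(3)[OF dk c(2)] K0[OF cls_mem[OF c(2)]] by (simp add: DI_zero)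
    then have "AE \<zeta> in \<omega>. ?k \<zeta> (hscale (H \<zeta>) (c \<zeta>) (X n \<zeta>)) = hzero (H \<zeta>)"
      using cls_eq_iff[OF decomposesD(4)[OF dk c(2)] L2_zero] by simp
    then show ?thesis
      using AE_space
    proof eventually_elim
      case (elim \<zeta>)
      have m: "X n \<zeta> \<in> hcarrier (H \<zeta>)" "?k \<zeta> (X n \<zeta>) \<in> hcarrier (H \<zeta>)" using X fib.firmD(1)[OF kf] by simp_all
      have "hscale (H \<zeta>) (c \<zeta>) (?k \<zeta> (X n \<zeta>)) = hzero (H \<zeta>)"
        using elim(1) fib.bopD(3)[OF fib.firm_bop[OF kf] m(1)] by simp
      then have "cmod (c \<zeta>) * hnorm (H \<zeta>) (?k \<zeta> (X n \<zeta>)) = 0"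
        using fib.norm_scale[OF m(2), of "c \<zeta>"] by simp
      then show ?case using c(1)[OF elim(2)] m by simp
    qed
  qed
  then have "AE \<zeta> in \<omega>. \<forall>n. ?k \<zeta> (X n \<zeta>) = hzero (H \<zeta>)" by (simp add: AE_all_countable)
  then show ?thesis
  proof eventually_elim
    case (elim \<zeta>)
    note k = fib.bopD[OF fib.firm_bop[OF kf[of \<zeta>]]]
    let ?N = "{u \<in> hcarrier (H \<zeta>). ?k \<zeta> u = hzero (H \<zeta>)}"
    have "hsubspace (H \<zeta>) ?N" by (rule fib.hsubspaceI) (auto simp: k)
    then have span: "hspan (H \<zeta>) (range (\<lambda>n. X n \<zeta>)) \<subseteq> ?N"
      using elim X by (intro hull_minimal) auto
    then have sub: "hspan (H \<zeta>) (range (\<lambda>n. X n \<zeta>)) \<subseteq> hcarrier (H \<zeta>)" by blast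
    have kz: "?k \<zeta> u = hzero (H \<zeta>)" if u: "u \<in> hcarrier (H \<zeta>)" for u
    proof -
      obtain f where f: "\<And>n. f n \<in> hspan (H \<zeta>) (range (\<lambda>n. X n \<zeta>))" "hlim (H \<zeta>) f u"
        using dense[of \<zeta>] u unfolding fib.hdense_iff[OF sub] by blast
      have "hlim (H \<zeta>) (\<lambda>n. ?k \<zeta> (f n)) (?k \<zeta> u)" by (rule fib.bop_hlim[OF fib.firm_bop[OF kf] f(2)])
      moreover have "?k \<zeta> (f n) = hzero (H \<zeta>)" for n using f(1) span by blast
      ultimately show ?thesis
        using fib.hlim_unique[of \<zeta> "\<lambda>n. hzero (H \<zeta>)" "?k \<zeta> u" "hzero (H \<zeta>)"] by simp
    qed
    have "u = hzero (H \<zeta>)" if u: "u \<in> hcarrier (H \<zeta>)" "resolvent (H \<zeta>) (T \<zeta>) u = hzero (H \<zeta>)" for u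
    proof -
      have "?k \<zeta> u = u"
        by (rule fib.fixed_proj_of_fixed[OF fib.firm_compl[OF rf] u(1)]) (use u in \<open>simp add: hcompl_def\<close>)
      then show ?thesis using kz u by simp
    qed
    then show "densely_defined (H \<zeta>) (T \<zeta>)"
      using fib.dense_iff_resolvent_injective[OF T_closed] by blast
  qed
qed

end

section \<open>The polar part of a decomposable operator\<close>

text \<open>The field \<open>polar_map\<close> is defined, and measurable, also in the fibres where the operator is not
  densely defined; it agrees with the polar part in almost every fibre.\<close>

theorem polar_part_op_integral:
  assumes sf: "sigma_finite_measure \<omega>" and T: "is_op_integral \<omega> H S Tf T" and d: "densely_defined DI T"
  shows "is_op_integral \<omega> H S (\<lambda>\<zeta>. polar_part (H \<zeta>) (Tf \<zeta>)) (polar_part DI T)"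
    and "is_bounded_op_integral \<omega> H S (\<lambda>\<zeta>. polar_part (H \<zeta>) (Tf \<zeta>)) (polar_part DI T)"
proof -
  obtain T' where T': "measurable_closed_field H S T'" "AE \<zeta> in \<omega>. T' \<zeta> = Tf \<zeta>" "T = op_integral \<omega> H S T'"
    using T unfolding is_op_integral_def by blast
  let ?V = "\<lambda>\<zeta>. graph_of (H \<zeta>) (polar_map (H \<zeta>) (T' \<zeta>))"
  have d': "densely_defined DI (op_integral \<omega> H S T')" using d T'(3) by simp
  have V: "polar_part DI T = op_integral \<omega> H S ?V"
    using DI.polar_part_eq[OF closed_op_integral[OF T'(1)] d'] op_integral_graph_of[OF decomposes_polar_map[OF T'(1)]] T'(3)
    by simp
  have ae: "AE \<zeta> in \<omega>. ?V \<zeta> = polar_part (H \<zeta>) (Tf \<zeta>)"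
    using dense_fibres[OF T'(1) sf d'] T'(2)
  proof eventually_elim
    case (elim \<zeta>)
    show ?case using fib.polar_part_eq[OF T_closed[OF T'(1)] elim(1)] elim(2) by simp
  qed
  show "is_op_integral \<omega> H S (\<lambda>\<zeta>. polar_part (H \<zeta>) (Tf \<zeta>)) (polar_part DI T)"
    unfolding is_op_integral_def using polar_map_closed_field[OF T'(1)] ae V by blast
  have "AE \<zeta> in \<omega>. \<forall>(u, v)\<in>?V \<zeta>. hnorm (H \<zeta>) v \<le> 1 * hnorm (H \<zeta>) u"
    using fib.polar_map_contraction[OF T_closed[OF T'(1)]] by (auto simp: graph_of_def)
  then show "is_bounded_op_integral \<omega> H S (\<lambda>\<zeta>. polar_part (H \<zeta>) (Tf \<zeta>)) (polar_part DI T)"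
    unfolding is_bounded_op_integral_def using polar_map_bounded_field[OF T'(1)] ae V by blast
qed

end

theorem proposition4p3:
  fixes \<omega> :: "'z::polish_space measure"
    and H :: "'z \<Rightarrow> 'a hilbert"
    and S :: "('z \<Rightarrow> 'a) set"
    and T :: "(('z \<Rightarrow> 'a) set \<times> ('z \<Rightarrow> 'a) set) set"
    and Tf :: "'z \<Rightarrow> ('a \<times> 'a) set"
  assumes "sets \<omega> = sets borel"
    and "sigma_finite_measure \<omega>"
    and "measurable_hilbert_field \<omega> H S"
    and "is_op_integral \<omega> H S Tf T"
    and "densely_defined (direct_integral \<omega> H S) T"
  shows "decomposable \<omega> H S (polar_part (direct_integral \<omega> H S) T)
    \<and> is_op_integral \<omega> H S (\<lambda>\<zeta>. polar_part (H \<zeta>) (Tf \<zeta>)) (polar_part (direct_integral \<omega> H S) T)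
    \<and> is_bounded_op_integral \<omega> H S (\<lambda>\<zeta>. polar_part (H \<zeta>) (Tf \<zeta>))
        (polar_part (direct_integral \<omega> H S) T)"
  using measurable_hilbert_field.polar_part_op_integral[OF assms(3,2,4,5)]
  unfolding decomposable_def by blast

end
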